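(* Let $\tau$ be in the limit circle case at $a$ with boundary condition basis $\{\phi_a,\psi_a\}$ at $a$, and in the limit point case at $b$. Let $T_\theta$ ($\theta\in[0,\pi)$) and $w_z$ ($z\in\rho(T_0)$) be as in the context, and suppose $\theta\in(0,\pi)$. Then $T_0$ and $T_\theta$ are relatively prime with respect to $T_{\min}$. Moreover, for each $z\in\rho(T_0)\cap\rho(T_\theta)$, the scalar $$k_\theta(z)=\cot(\theta)+[w_z,\psi_a](a)$$ is nonzero and the following operator equality holds: $$(T_\theta-zI)^{-1}-(T_0-zI)^{-1}=k_\theta(z)^{-1}\langle w_{\overline z},\,\cdot\,\rangle\, w_z .$$ In particular, for each $z\in\rho(T_0)\cap\rho(T_\theta)$, the operator $(T_\theta-zI)^{-1}-(T_0-zI)^{-1}$ is trace class on $L^2((a,b);r(x)\,dx)$ and $$\operatorname{tr}\big((T_\theta-zI)^{-1}-(T_0-zI)^{-1}\big)=\frac{\langle w_{\overline z},w_z\rangle}{\cot(\theta)+[w_z,\psi_a](a)} .$$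
   Context: Setting. Let $-\infty\le a<b\le\infty$ and let $p,q,r$ be real-valued Lebesgue measurable functions on $(a,b)$ with $p>0$, $r>0$ a.e. and $p^{-1},q,r\in L^1_{\mathrm{loc}}((a,b);dx)$. Let $\mathfrak D(a,b)$ be the set of $f\in AC_{\mathrm{loc}}(a,b)$ (complex-valued) with $pf'\in AC_{\mathrm{loc}}(a,b)$, and $\tau f=\frac1r[-(pf')'+qf]$ for $f\in\mathfrak D(a,b)$. The Lagrange bracket is $[f,g](x)=f(x)\overline{(pg')(x)}-(pf')(x)\overline{g(x)}$ for $f,g\in\mathfrak D(a,b)$. $I$ and $\langle\cdot,\cdot\rangle$ (linear in the second argument) are the identity and inner product of $L^2((a,b);r(x)\,dx)$, and $\operatorname{tr}$ is the trace on trace class operators there. The maximal operator is $T_{\max}f=\tau f$ with $\operatorname{dom}(T_{\max})=\{g\in\mathfrak D(a,b): g,\tau g\in L^2((a,b);r\,dx)\}$; it is densely defined, and the minimal operator is $T_{\min}:=(T_{\max})^*$, which is closed, symmetric, densely defined, with $(T_{\min})^*=T_{\max}$. For $f,g\in\operatorname{dom}(T_{\max})$ the limits $[f,g](a)=\lim_{x\downarrow a}[f,g](x)$ and $[f,g](b)=\lim_{x\uparrow b}[f,g](x)$ exist and are finite; the same holds at one endpoint if $f,g\in\mathfrak D(a,b)$ and $f,\tau f,g,\tau g$ are square integrable (w.r.t. $r\,dx$) near that endpoint only. $\tau$ is in the limit circle case at an endpoint if for each $z\in\mathbb C$ all solutions $y\in\mathfrak D(a,b)$ of $\tau y=zy$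 are square integrable w.r.t. $r\,dx$ near that endpoint; it is in the limit point case there if for each $z\in\mathbb C$ some solution is not. A boundary condition basis at $c\in\{a,b\}$ is a pair of real-valued functions $\phi,\psi\in\operatorname{dom}(T_{\max})$ with $[\psi,\phi](c)=1$. When $\tau$ is limit circle at $a$ (with boundary condition basis $\{\phi_a,\psi_a\}$) and limit point at $b$, for $\theta\in[0,\pi)$ the operator $T_\theta$ is the restriction of $T_{\max}$ to $$\operatorname{dom}(T_\theta)=\{g\in\operatorname{dom}(T_{\max}):\cos(\theta)[g,\phi_a](a)+\sin(\theta)[g,\psi_a](a)=0\};$$ it is known that these are exactly the self-adjoint extensions of $T_{\min}$. For $z\in\rho(T_0)$, $w_z$ (the Weyl–Titchmarsh solution) is the unique solution of $\tau w=zw$ with $w_z\in L^2((a,b);r\,dx)$ and $[w_z,\phi_a](a)=1$. For self-adjoint extensions $T,T'$ of a symmetric operator $S$, the maximal common part $C_{T,T'}$ is the restriction of $T$ to $\{f\in\operatorname{dom}(T)\cap\operatorname{dom}(T'): Tf=T'f\}$; $T$ and $T'$ are relatively prime with respect to $S$ if $C_{T,T'}=S$. *)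

theory Defs
  imports "HOL-Analysis.Analysis"
begin

section \<open>Operators in the Hilbert space of square integrable functions\<close>

text \<open>
  Elements of the Hilbert space are represented by square integrable functions, equality being
  almost everywhere equality.  A (possibly unbounded) operator is represented by its graph, taken
  as a set of pairs of functions that is closed under changing either component on a null set;
  operators are then equal iff their graphs are equal as sets, and \<open>S \<subseteq> T\<close> says that \<open>T\<close> extends
  \<open>S\<close>.
\<close>

type_synonym 'a l2_graph = "(('a \<Rightarrow> complex) \<times> ('a \<Rightarrow> complex)) set"

definition L2 :: "'a measure \<Rightarrow> ('a \<Rightarrow> complex) set" where
  "L2 M = {f \<in> borel_measurable M. integrable M (\<lambda>x. (cmod (f x))\<^sup>2)}"

definition L2_inner :: "'a measure \<Rightarrow> ('a \<Rightarrow> complex) \<Rightarrow> ('a \<Rightarrow> complex) \<Rightarrow> complex" where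
  "L2_inner M f g = (\<integral>x. cnj (f x) * g x \<partial>M)"

definition L2_norm :: "'a measure \<Rightarrow> ('a \<Rightarrow> complex) \<Rightarrow> real" where
  "L2_norm M f = sqrt (\<integral>x. (cmod (f x))\<^sup>2 \<partial>M)"

definition graph_on ::
    "'a measure \<Rightarrow> ('a \<Rightarrow> complex) set \<Rightarrow> (('a \<Rightarrow> complex) \<Rightarrow> 'a \<Rightarrow> complex) \<Rightarrow> 'a l2_graph" where
  "graph_on M D A = {(u, v). u \<in> L2 M \<and> v \<in> L2 M \<and>
     (\<exists>g\<in>D. (AE x in M. u x = g x) \<and> (AE x in M. v x = A g x))}"

definition linear_operator :: "'a measure \<Rightarrow> 'a l2_graph \<Rightarrow> bool" where
  "linear_operator M A \<longleftrightarrow>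
     A \<subseteq> L2 M \<times> L2 M \<and>
     (\<lambda>_. 0, \<lambda>_. 0) \<in> A \<and>
     (\<forall>f g f' g' c. (f, g) \<in> A \<longrightarrow> (f', g') \<in> A \<longrightarrow>
        (\<lambda>x. c * f x + f' x, \<lambda>x. c * g x + g' x) \<in> A) \<and>
     (\<forall>f g f' g'. (f, g) \<in> A \<longrightarrow> f' \<in> L2 M \<longrightarrow> g' \<in> L2 M \<longrightarrow>
        (AE x in M. f' x = f x) \<longrightarrow> (AE x in M. g' x = g x) \<longrightarrow> (f', g') \<in> A) \<and>
     (\<forall>f g g'. (f, g) \<in> A \<longrightarrow> (f, g') \<in> A \<longrightarrow> (AE x in M. g x = g' x))"

definition bounded_operator :: "'a measure \<Rightarrow> 'a l2_graph \<Rightarrow> bool" where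
  "bounded_operator M A \<longleftrightarrow> linear_operator M A \<and> Domain A = L2 M \<and>
     (\<exists>C. \<forall>(f, g)\<in>A. L2_norm M g \<le> C * L2_norm M f)"

text \<open>For a densely defined operator this is the graph of the Hilbert space adjoint.\<close>

definition adjoint_op :: "'a measure \<Rightarrow> 'a l2_graph \<Rightarrow> 'a l2_graph" where
  "adjoint_op M T = {(f, g). f \<in> L2 M \<and> g \<in> L2 M \<and>
     (\<forall>(u, v)\<in>T. L2_inner M f v = L2_inner M g u)}"

definition op_diff :: "'a measure \<Rightarrow> 'a l2_graph \<Rightarrow> 'a l2_graph \<Rightarrow> 'a l2_graph" where
  "op_diff M A B = {(f, g). g \<in> L2 M \<and>
     (\<exists>u v. (f, u) \<in> A \<and> (f, v) \<in> B \<and> (AE x in M. g x = u x - v x))}"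

definition op_minus_scalar :: "'a measure \<Rightarrow> 'a l2_graph \<Rightarrow> complex \<Rightarrow> 'a l2_graph" where
  "op_minus_scalar M T z = {(f, g). g \<in> L2 M \<and>
     (\<exists>v. (f, v) \<in> T \<and> (AE x in M. g x = v x - z * f x))}"

definition resolvent_op :: "'a measure \<Rightarrow> 'a l2_graph \<Rightarrow> complex \<Rightarrow> 'a l2_graph" where
  "resolvent_op M T z = (op_minus_scalar M T z)\<inverse>"

definition resolvent_set :: "'a measure \<Rightarrow> 'a l2_graph \<Rightarrow> complex set" where
  "resolvent_set M T = {z. bounded_operator M (resolvent_op M T z)}"

text \<open>The rank one operator \<open>c \<langle>u, \<cdot>\<rangle> v\<close>.\<close>

definition rank_one_op ::
    "'a measure \<Rightarrow> complex \<Rightarrow> ('a \<Rightarrow> complex) \<Rightarrow> ('a \<Rightarrow> complex) \<Rightarrow> 'a l2_graph" where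
  "rank_one_op M c u v = {(f, g). f \<in> L2 M \<and> g \<in> L2 M \<and>
     (AE x in M. g x = c * L2_inner M u f * v x)}"

definition max_common_part :: "'a measure \<Rightarrow> 'a l2_graph \<Rightarrow> 'a l2_graph \<Rightarrow> 'a l2_graph" where
  "max_common_part M T T' =
     {(f, g) \<in> T. \<exists>g'. (f, g') \<in> T' \<and> (AE x in M. g x = g' x)}"

text \<open>
  Used for self-adjoint extensions \<open>T\<close>, \<open>T'\<close> of a symmetric operator \<open>S\<close>.
\<close>

definition relatively_prime :: "'a measure \<Rightarrow> 'a l2_graph \<Rightarrow> 'a l2_graph \<Rightarrow> 'a l2_graph \<Rightarrow> bool" where
  "relatively_prime M S T T' \<longleftrightarrow> max_common_part M T T' = S"

definition orthonormal_basis :: "'a measure \<Rightarrow> ('a \<Rightarrow> complex) set \<Rightarrow> bool" where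
  "orthonormal_basis M E \<longleftrightarrow> E \<subseteq> L2 M \<and>
     (\<forall>e\<in>E. \<forall>e'\<in>E. L2_inner M e e' = (if e = e' then 1 else 0)) \<and>
     (\<forall>f\<in>L2 M. (\<forall>e\<in>E. L2_inner M e f = 0) \<longrightarrow> (AE x in M. f x = 0))"

text \<open>\<open>\<langle>f, A f\<rangle>\<close>; the choice of the representative of \<open>A f\<close> does not matter.\<close>

definition quadratic_form :: "'a measure \<Rightarrow> 'a l2_graph \<Rightarrow> ('a \<Rightarrow> complex) \<Rightarrow> complex" where
  "quadratic_form M A f = L2_inner M f (SOME g. (f, g) \<in> A)"

text \<open>\<open>B\<close> is the positive square root of \<open>A\<^sup>* A\<close>; note that \<open>R O S\<close> applies \<open>R\<close> first.\<close>

definition is_absolute_value :: "'a measure \<Rightarrow> 'a l2_graph \<Rightarrow> 'a l2_graph \<Rightarrow> bool" where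
  "is_absolute_value M A B \<longleftrightarrow> bounded_operator M B \<and>
     (\<forall>f\<in>L2 M. Im (quadratic_form M B f) = 0 \<and> 0 \<le> Re (quadratic_form M B f)) \<and>
     B O B = A O adjoint_op M A"

definition trace_class :: "'a measure \<Rightarrow> 'a l2_graph \<Rightarrow> bool" where
  "trace_class M A \<longleftrightarrow> bounded_operator M A \<and>
     (\<exists>B E. is_absolute_value M A B \<and> orthonormal_basis M E \<and>
        (\<lambda>e. quadratic_form M B e) summable_on E)"

definition op_trace :: "'a measure \<Rightarrow> 'a l2_graph \<Rightarrow> complex" where
  "op_trace M A = (THE t. \<forall>E. orthonormal_basis M E \<longrightarrow>
     ((\<lambda>e. quadratic_form M A e) has_sum t) E)"


section \<open>Sturm--Liouville expressions\<close>

definition abs_continuous_Icc :: "(real \<Rightarrow> complex) \<Rightarrow> real \<Rightarrow> real \<Rightarrow> bool" where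
  "abs_continuous_Icc f c d \<longleftrightarrow> (\<forall>\<epsilon>>0. \<exists>\<delta>>0. \<forall>I :: (real \<times> real) set.
     finite I \<longrightarrow> (\<forall>(x, y)\<in>I. c \<le> x \<and> x < y \<and> y \<le> d) \<longrightarrow>
     disjoint_family_on (\<lambda>(x, y). {x<..<y}) I \<longrightarrow>
     (\<Sum>(x, y)\<in>I. y - x) < \<delta> \<longrightarrow> (\<Sum>(x, y)\<in>I. cmod (f y - f x)) < \<epsilon>)"

text \<open>
  Throughout, functions on \<open>(a, b)\<close> are total functions on the reals whose values outside of
  \<open>(a, b)\<close> are irrelevant.
\<close>

definition AC_loc :: "ereal \<Rightarrow> ereal \<Rightarrow> (real \<Rightarrow> complex) set" where
  "AC_loc a b = {f. \<forall>c\<in>einterval a b. \<forall>d\<in>einterval a b. abs_continuous_Icc f c d}"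

definition L1_loc :: "ereal \<Rightarrow> ereal \<Rightarrow> (real \<Rightarrow> real) set" where
  "L1_loc a b = {f. \<forall>c\<in>einterval a b. \<forall>d\<in>einterval a b. set_integrable lebesgue {c..d} f}"

definition sl_coefficients ::
    "ereal \<Rightarrow> ereal \<Rightarrow> (real \<Rightarrow> real) \<Rightarrow> (real \<Rightarrow> real) \<Rightarrow> (real \<Rightarrow> real) \<Rightarrow> bool" where
  "sl_coefficients a b p q r \<longleftrightarrow> a < b \<and>
     p \<in> borel_measurable (lebesgue_on (einterval a b)) \<and>
     q \<in> borel_measurable (lebesgue_on (einterval a b)) \<and>
     r \<in> borel_measurable (lebesgue_on (einterval a b)) \<and>
     (AE x in lebesgue_on (einterval a b). 0 < p x) \<and>
     (AE x in lebesgue_on (einterval a b). 0 < r x) \<and>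
     (\<lambda>x. 1 / p x) \<in> L1_loc a b \<and> q \<in> L1_loc a b \<and> r \<in> L1_loc a b"

definition weighted :: "ereal \<Rightarrow> ereal \<Rightarrow> (real \<Rightarrow> real) \<Rightarrow> real measure" where
  "weighted a b r = density (lebesgue_on (einterval a b)) (\<lambda>x. ennreal (r x))"

context
  fixes a b :: ereal and p q r :: "real \<Rightarrow> real"
begin

text \<open>
  The product \<open>p f'\<close> is only defined almost everywhere; \<open>p f' \<in> AC_loc\<close> means that it has a
  (necessarily unique on \<open>(a, b)\<close>) locally absolutely continuous representative, and pointwise
  values of \<open>p f'\<close> are those of this representative.
\<close>

definition is_quasi_deriv :: "(real \<Rightarrow> complex) \<Rightarrow> (real \<Rightarrow> complex) \<Rightarrow> bool" where
  "is_quasi_deriv f h \<longleftrightarrow> h \<in> AC_loc a b \<and>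
     (AE x in lebesgue_on (einterval a b).
        h x = complex_of_real (p x) * vector_derivative f (at x))"

definition sl_functions :: "(real \<Rightarrow> complex) set" where
  "sl_functions = {f \<in> AC_loc a b. \<exists>h. is_quasi_deriv f h}"

definition quasi_deriv :: "(real \<Rightarrow> complex) \<Rightarrow> real \<Rightarrow> complex" where
  "quasi_deriv f = (SOME h. is_quasi_deriv f h)"

definition sl_expr :: "(real \<Rightarrow> complex) \<Rightarrow> real \<Rightarrow> complex" where
  "sl_expr f x = (- vector_derivative (quasi_deriv f) (at x) + complex_of_real (q x) * f x)
     / complex_of_real (r x)"

definition sl_solution :: "complex \<Rightarrow> (real \<Rightarrow> complex) \<Rightarrow> bool" where
  "sl_solution z y \<longleftrightarrow> y \<in> sl_functions \<and>
     (AE x in lebesgue_on (einterval a b). sl_expr y x = z * y x)"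

definition lagrange_bracket ::
    "(real \<Rightarrow> complex) \<Rightarrow> (real \<Rightarrow> complex) \<Rightarrow> real \<Rightarrow> complex" where
  "lagrange_bracket f g x = f x * cnj (quasi_deriv g x) - quasi_deriv f x * cnj (g x)"

text \<open>The limit \<open>[f, g](a)\<close> for \<open>x \<down> a\<close>, where \<open>a\<close> may be \<open>-\<infinity>\<close>.\<close>

definition lagrange_bracket_left :: "(real \<Rightarrow> complex) \<Rightarrow> (real \<Rightarrow> complex) \<Rightarrow> complex" where
  "lagrange_bracket_left f g = Lim (at_right a) (lagrange_bracket f g \<circ> real_of_ereal)"

definition limit_circle_left :: bool where
  "limit_circle_left \<longleftrightarrow> (\<forall>z y. sl_solution z y \<longrightarrow>
     (\<exists>c\<in>einterval a b. set_integrable (weighted a b r) {..<c} (\<lambda>x. (cmod (y x))\<^sup>2)))"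

definition limit_point_right :: bool where
  "limit_point_right \<longleftrightarrow> (\<forall>z. \<exists>y. sl_solution z y \<and>
     \<not> (\<exists>c\<in>einterval a b. set_integrable (weighted a b r) {c<..} (\<lambda>x. (cmod (y x))\<^sup>2)))"

definition dom_max :: "(real \<Rightarrow> complex) set" where
  "dom_max = {g \<in> sl_functions. g \<in> L2 (weighted a b r) \<and> sl_expr g \<in> L2 (weighted a b r)}"

definition T_max :: "real l2_graph" where
  "T_max = graph_on (weighted a b r) dom_max sl_expr"

definition T_min :: "real l2_graph" where
  "T_min = adjoint_op (weighted a b r) T_max"

definition bc_basis_left :: "(real \<Rightarrow> complex) \<Rightarrow> (real \<Rightarrow> complex) \<Rightarrow> bool" where
  "bc_basis_left \<phi> \<psi> \<longleftrightarrow> \<phi> \<in> dom_max \<and> \<psi> \<in> dom_max \<and>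
     (\<forall>x\<in>einterval a b. \<phi> x \<in> \<real> \<and> \<psi> x \<in> \<real>) \<and>
     lagrange_bracket_left \<psi> \<phi> = 1"

definition T_bc :: "(real \<Rightarrow> complex) \<Rightarrow> (real \<Rightarrow> complex) \<Rightarrow> real \<Rightarrow> real l2_graph" where
  "T_bc \<phi> \<psi> \<theta> = graph_on (weighted a b r)
     {g \<in> dom_max. complex_of_real (cos \<theta>) * lagrange_bracket_left g \<phi>
        + complex_of_real (sin \<theta>) * lagrange_bracket_left g \<psi> = 0} sl_expr"

text \<open>The last condition only pins down the irrelevant values outside of \<open>(a, b)\<close>.\<close>

definition weyl_solution :: "(real \<Rightarrow> complex) \<Rightarrow> complex \<Rightarrow> real \<Rightarrow> complex" where
  "weyl_solution \<phi> z = (THE w. sl_solution z w \<and> w \<in> L2 (weighted a b r) \<and>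
     lagrange_bracket_left w \<phi> = 1 \<and> (\<forall>x. x \<notin> einterval a b \<longrightarrow> w x = 0))"

end

end

theory Submission
  imports Defs
begin

text \<open>
  Write \<open>R_\<theta>(z)\<close> for the resolvent of \<open>T_\<theta>\<close>.  For \<open>z \<in> \<rho>(T_0)\<close> the Weyl solution \<open>w_z\<close> is
  \<open>\<psi> - R_0(z) (\<tau> - z) \<psi>\<close>, and the Weyl solution at the conjugate point is the conjugate of \<open>w_z\<close>
  because all data are real.  For \<open>u = R_\<theta>(z) f\<close> and
  \<open>v = R_0(z) f\<close> the difference \<open>u - v\<close> lies in \<open>ker (T_max - z)\<close>, hence equals \<open>c w_z\<close>; the
  boundary condition of \<open>u\<close> gives \<open>c k_\<theta>(z) = - [v, \<psi>](a)\<close>, and Green's formula with the Pluecker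
  identity for the brackets gives the same value for the inner product of \<open>f\<close> with the conjugate
  Weyl solution.  If \<open>k_\<theta>(z)\<close> vanished, \<open>w_z\<close> would be an eigenfunction of \<open>T_\<theta>\<close>.

  Two facts carry the analysis.  In the limit point case the bracket of two elements of the maximal
  domain vanishes at \<open>b\<close>.  And \<open>T_max\<^sup>*\<close> is contained in \<open>T_max\<close>, because on a compact interval a
  function orthogonal to the compactly supported part of the range of \<open>\<tau>\<close> is a solution of
  \<open>\<tau> y = 0\<close>.  Both rest on the fundamental theorem of calculus for absolutely continuous functions,
  obtained from the Radon--Nikodym theorem applied to the variation measure and Lebesgue's
  differentiation theorem.
\<close>

section \<open>Absolutely continuous functions\<close>

text \<open>Graphs of operators see functions up to null sets, whereas brackets and boundary
  conditions need pointwise values. Continuity connects the two: elements of the maximal domain that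
  agree almost everywhere agree on the whole interval, and so do their quasi-derivatives. The
  expression \<tau> is handled as the first-order system \<open>f' = v / p\<close>,
  \<open>v' = q f - r k\<close>, with \<open>k\<close> in the role of \<tau> f, in integrated form,
  which suits merely locally integrable \<open>1 / p\<close>, \<open>q\<close>, \<open>r\<close>.
  Existence of solutions enters for \<tau> y = 0 only: variation of constants solves \<tau> h = g,
  and the limit point hypothesis is exploited at spectral parameter 0.

  \<open>T_min\<close> is defined as an adjoint; the inclusion of that adjoint in
  \<open>T_max\<close> makes its domain explicit, namely
  \<open>[F, \<phi>](a) = [F, \<psi>](a) = 0\<close>. As \<open>[\<psi>, \<phi>](a) = 1\<close>,
  these two functionals determine every bracket at \<open>a\<close>. For \<open>v\<close> in the
  domain of \<open>T_0\<close> and the Weyl solution \<open>w'\<close> at the conjugate point,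
  \<open>[v, \<phi>](a) = 0\<close> and \<open>[w', \<phi>](a) = 1\<close> give
  \<open>[v, w'](a) = [v, \<psi>](a)\<close>; this is why the two computations of
  \<open>c k_\<theta>(z)\<close> meet.\<close>

definition nonoverlapping :: "real \<Rightarrow> real \<Rightarrow> (real \<times> real) set \<Rightarrow> bool" where
  "nonoverlapping c d I \<longleftrightarrow> finite I \<and> (\<forall>(x, y)\<in>I. c \<le> x \<and> x < y \<and> y \<le> d) \<and>
     disjoint_family_on (\<lambda>(x, y). {x<..<y}) I"

definition var_sum :: "(real \<Rightarrow> 'a::real_normed_vector) \<Rightarrow> (real \<times> real) set \<Rightarrow> real" where
  "var_sum f I = (\<Sum>(x, y)\<in>I. norm (f y - f x))"

text \<open>The values lie in an arbitrary normed space because the argument also needs the real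
  variation function, coordinates, and pairs of complex functions. If \<open>d < c\<close>, only the
  empty family qualifies and the condition holds trivially, which lets endpoints be quantified in
  either order.\<close>

definition ac_on :: "(real \<Rightarrow> 'a::real_normed_vector) \<Rightarrow> real \<Rightarrow> real \<Rightarrow> bool" where
  "ac_on f c d \<longleftrightarrow> (\<forall>\<epsilon>>0. \<exists>\<delta>>0. \<forall>I. nonoverlapping c d I \<longrightarrow>
     (\<Sum>(x, y)\<in>I. y - x) < \<delta> \<longrightarrow> var_sum f I < \<epsilon>)"

lemma abs_continuous_Icc_iff: "abs_continuous_Icc f c d \<longleftrightarrow> ac_on f c d"
  unfolding abs_continuous_Icc_def ac_on_def nonoverlapping_def var_sum_def by meson

lemma ac_onD:
  assumes "ac_on f c d" "\<epsilon> > 0"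
  obtains \<delta> where "\<delta> > 0"
    "\<And>I. nonoverlapping c d I \<Longrightarrow> (\<Sum>(x, y)\<in>I. y - x) < \<delta> \<Longrightarrow> var_sum f I < \<epsilon>"
  using assms unfolding ac_on_def by metis

lemma nonoverlapping_subinterval:
  "nonoverlapping c' d' I \<Longrightarrow> c \<le> c' \<Longrightarrow> d' \<le> d \<Longrightarrow> nonoverlapping c d I"
  unfolding nonoverlapping_def by fastforce

lemma nonoverlapping_subset: "nonoverlapping c d I \<Longrightarrow> J \<subseteq> I \<Longrightarrow> nonoverlapping c d J"
  unfolding nonoverlapping_def by (auto intro: finite_subset disjoint_family_on_mono)

lemma ac_on_subinterval: "ac_on f c d \<Longrightarrow> c \<le> c' \<Longrightarrow> d' \<le> d \<Longrightarrow> ac_on f c' d'"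
  unfolding ac_on_def by (meson nonoverlapping_subinterval)

text \<open>Domination of increments is the common form of the closure properties used later:
  differences, coordinates, products of bounded factors.\<close>

lemma ac_on_bounded_by:
  fixes f :: "real \<Rightarrow> 'a::real_normed_vector" and g :: "real \<Rightarrow> 'b::real_normed_vector"
    and h :: "real \<Rightarrow> 'c::real_normed_vector"
  assumes f: "ac_on f c d" and g: "ac_on g c d"
    and h: "\<And>x y. c \<le> x \<Longrightarrow> x < y \<Longrightarrow> y \<le> d \<Longrightarrow>
      norm (h y - h x) \<le> K * (norm (f y - f x) + norm (g y - g x))"
  shows "ac_on h c d"
  unfolding ac_on_def
proof (intro allI impI)
  fix \<epsilon> :: real assume e: "\<epsilon> > 0"
  define L where "L = \<bar>K\<bar> + 1"
  have L: "L > 0" "K \<le> L" unfolding L_def by auto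
  have pos: "\<epsilon> / (2 * L) > 0" using e L by auto
  obtain \<delta>1 where d1: "\<delta>1 > 0" "\<And>I. nonoverlapping c d I \<Longrightarrow> (\<Sum>(x, y)\<in>I. y - x) < \<delta>1 \<Longrightarrow> var_sum f I < \<epsilon> / (2 * L)"
    using ac_onD[OF f pos] by blast
  obtain \<delta>2 where d2: "\<delta>2 > 0" "\<And>I. nonoverlapping c d I \<Longrightarrow> (\<Sum>(x, y)\<in>I. y - x) < \<delta>2 \<Longrightarrow> var_sum g I < \<epsilon> / (2 * L)"
    using ac_onD[OF g pos] by blast
  show "\<exists>\<delta>>0. \<forall>I. nonoverlapping c d I \<longrightarrow> (\<Sum>(x, y)\<in>I. y - x) < \<delta> \<longrightarrow> var_sum h I < \<epsilon>"
  proof (intro exI[of _ "min \<delta>1 \<delta>2"] conjI allI impI)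
    fix I assume I: "nonoverlapping c d I" "(\<Sum>(x, y)\<in>I. y - x) < min \<delta>1 \<delta>2"
    have "var_sum h I \<le> (\<Sum>p\<in>I. L * ((case p of (x, y) \<Rightarrow> norm (f y - f x)) + (case p of (x, y) \<Rightarrow> norm (g y - g x))))"
      unfolding var_sum_def
    proof (intro sum_mono)
      fix p assume p: "p \<in> I"
      obtain x y where xy: "p = (x, y)" by (cases p)
      have "c \<le> x" "x < y" "y \<le> d" using p I(1) unfolding nonoverlapping_def xy by auto
      from h[OF this] have "norm (h y - h x) \<le> K * (norm (f y - f x) + norm (g y - g x))" .
      also have "\<dots> \<le> L * (norm (f y - f x) + norm (g y - g x))" using L by (intro mult_right_mono) auto
      finally show "(case p of (x, y) \<Rightarrow> norm (h y - h x)) \<le> L * ((case p of (x, y) \<Rightarrow> norm (f y - f x)) + (case p of (x, y) \<Rightarrow> norm (g y - g x)))"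
        by (simp add: xy)
    qed
    also have "\<dots> = L * (var_sum f I + var_sum g I)"
      unfolding var_sum_def by (simp add: sum_distrib_left[symmetric] sum.distrib)
    also have "\<dots> < L * (\<epsilon> / (2 * L) + \<epsilon> / (2 * L))"
      using d1(2)[OF I(1)] d2(2)[OF I(1)] I(2) L by (intro mult_strict_left_mono add_strict_mono) auto
    also have "\<dots> = \<epsilon>" using L by (simp add: field_simps)
    finally show "var_sum h I < \<epsilon>" .
  qed (use d1 d2 in auto)
qed

lemma ac_on_continuous:
  assumes "ac_on f c d" shows "continuous_on {c..d} f"
  unfolding continuous_on_iff
proof (intro ballI allI impI)
  fix x e assume x: "x \<in> {c..d}" and "(0::real) < e"
  then obtain \<delta> where d: "\<delta> > 0" "\<And>I. nonoverlapping c d I \<Longrightarrow> (\<Sum>(x, y)\<in>I. y - x) < \<delta> \<Longrightarrow> var_sum f I < e"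
    using ac_onD[OF assms] by metis
  have *: "norm (f v - f u) < e" if "u < v" "v - u < \<delta>" "c \<le> u" "v \<le> d" for u v
    using d(2)[of "{(u, v)}"] that by (simp add: nonoverlapping_def var_sum_def disjoint_family_on_def)
  show "\<exists>d'>0. \<forall>x'\<in>{c..d}. dist x' x < d' \<longrightarrow> dist (f x') (f x) < e"
  proof (intro exI[of _ \<delta>] conjI ballI impI d)
    fix x' assume "x' \<in> {c..d}" "dist x' x < \<delta>"
    then show "dist (f x') (f x) < e"
      using *[of x x'] *[of x' x] x \<open>0 < e\<close>
      by (cases x x' rule: linorder_cases) (auto simp: dist_norm norm_minus_commute)
  qed
qed

lemma nonoverlapping_union:
  "nonoverlapping x y I \<Longrightarrow> nonoverlapping y z J \<Longrightarrow> x \<le> y \<Longrightarrow> y \<le> z \<Longrightarrow> nonoverlapping x z (I \<union> J) \<and> I \<inter> J = {}"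
proof -
  assume I: "nonoverlapping x y I" and J: "nonoverlapping y z J" and xyz: "x \<le> y" "y \<le> z"
  have "I \<inter> J = {}" using I J unfolding nonoverlapping_def by fastforce
  moreover have "disjoint_family_on (\<lambda>(x, y). {x<..<y}) (I \<union> J)"
    unfolding disjoint_family_on_def
  proof (intro ballI impI)
    fix m n assume mn: "m \<in> I \<union> J" "n \<in> I \<union> J" "m \<noteq> n"
    have I1: "(case m of (x, y) \<Rightarrow> {x<..<y}) \<subseteq> {..<y}" if "m \<in> I" for m using that I unfolding nonoverlapping_def by fastforce
    have J1: "(case m of (x, y) \<Rightarrow> {x<..<y}) \<subseteq> {y<..}" if "m \<in> J" for m using that J unfolding nonoverlapping_def by fastforce
    have I2: "disjoint_family_on (\<lambda>(x, y). {x<..<y}) I" "disjoint_family_on (\<lambda>(x, y). {x<..<y}) J"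
      using I J unfolding nonoverlapping_def by auto
    have e: "{..<y} \<inter> {y<..} = {}" by auto
    show "(case m of (x, y) \<Rightarrow> {x<..<y}) \<inter> (case n of (x, y) \<Rightarrow> {x<..<y}) = {}"
      using mn I1[of m] I1[of n] J1[of m] J1[of n] I2 e unfolding disjoint_family_on_def
      by blast
  qed
  ultimately show ?thesis using I J xyz unfolding nonoverlapping_def by fastforce
qed

text \<open>Serves to cut the one interval that straddles an interior point: each of its two pieces
  joins the intervals on its own side.\<close>

lemma nonoverlapping_replace:
  assumes I: "nonoverlapping c d I" and uv: "(u, v) \<in> I" and A: "A \<subseteq> I - {(u, v)}"
    and s: "u \<le> s" "s < t" "t \<le> v" and A1: "\<And>x y. (x, y) \<in> A \<Longrightarrow> c' \<le> x \<and> y \<le> d'" and cs: "c' \<le> s" "t \<le> d'"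
  shows "nonoverlapping c' d' (insert (s, t) A) \<and> (s, t) \<notin> A"
proof -
  have dI: "disjoint_family_on (\<lambda>(x, y). {x<..<y}) I" and fin: "finite I" and I': "\<And>x y. (x, y) \<in> I \<Longrightarrow> x < y"
    using I unfolding nonoverlapping_def by auto
  have *: "{x<..<y} \<inter> {s<..<t} = {}" if "(x, y) \<in> A" for x y
  proof -
    have "{x<..<y} \<inter> {u<..<v} = {}"
      using dI that A uv unfolding disjoint_family_on_def by fastforce
    then show ?thesis using s by fastforce
  qed
  \<comment> \<open>Otherwise the nonempty \<open>{s<..<t}\<close> would be disjoint from
    itself.\<close>
  have ne: "(s, t) \<notin> A"
    using *[of s t] s by (metis Int_absorb greaterThanLessThan_empty_iff not_le)
  have "disjoint_family_on (\<lambda>(x, y). {x<..<y}) A" using dI A by (auto intro: disjoint_family_on_mono)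
  moreover have "{s<..<t} \<inter> (\<Union>p\<in>A. case p of (x, y) \<Rightarrow> {x<..<y}) = {}"
  proof (intro equals0I)
    fix w assume "w \<in> {s<..<t} \<inter> (\<Union>p\<in>A. case p of (x, y) \<Rightarrow> {x<..<y})"
    then obtain x y where "(x, y) \<in> A" "w \<in> {x<..<y} \<inter> {s<..<t}" by auto
    with *[of x y] show False by blast
  qed
  ultimately have "disjoint_family_on (\<lambda>(x, y). {x<..<y}) (insert (s, t) A)"
    using ne by (subst disjoint_family_on_insert) auto
  moreover have "finite A" using fin A finite_subset by (meson Diff_subset subset_trans)
  ultimately show ?thesis using A1 A I' ne s cs unfolding nonoverlapping_def by fastforce
qed

section \<open>Total variation\<close>

definition variation :: "(real \<Rightarrow> 'a::real_normed_vector) \<Rightarrow> real \<Rightarrow> real \<Rightarrow> real" where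
  "variation f x y = (SUP I\<in>{I. nonoverlapping x y I}. var_sum f I)"

lemma nonoverlapping_empty: "nonoverlapping c d {}"
  unfolding nonoverlapping_def disjoint_family_on_def by auto

text \<open>A real supremum has its meaning only for a set that is bounded above. The bound on
  \<open>{c..d}\<close> passes to every subinterval, so \<open>variation\<close> is the true
  supremum there.\<close>

locale bounded_variation =
  fixes f :: "real \<Rightarrow> 'a::real_normed_vector" and c d B :: real
  assumes bounded: "\<And>I. nonoverlapping c d I \<Longrightarrow> var_sum f I \<le> B"
begin

lemma var_sum_le_variation:
  assumes "nonoverlapping x y I" "c \<le> x" "y \<le> d"
  shows "var_sum f I \<le> variation f x y"
  unfolding variation_def
  using assms by (intro cSUP_upper bdd_aboveI2[where M=B] bounded) (auto intro: nonoverlapping_subinterval)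

lemma variation_leI:
  assumes "\<And>I. nonoverlapping x y I \<Longrightarrow> var_sum f I \<le> C"
  shows "variation f x y \<le> C"
  unfolding variation_def using nonoverlapping_empty assms by (intro cSUP_least) auto

lemma variation_approx:
  assumes "e > 0" obtains I where "nonoverlapping x y I" "variation f x y < var_sum f I + e"
proof -
  have "\<not> variation f x y \<le> variation f x y - e" using assms by auto
  then obtain I where "nonoverlapping x y I" "\<not> var_sum f I \<le> variation f x y - e" using variation_leI by blast
  then show ?thesis using that by force
qed

text \<open>For the upper estimate, at most one member \<open>(u, v)\<close> of a family straddles
  \<open>y\<close>. Replacing it by \<open>(u, y)\<close> and \<open>(y, v)\<close> does not lower
  the sum, by the triangle inequality.\<close>

lemma variation_add:
  assumes xyz: "c \<le> x" "x \<le> y" "y \<le> z" "z \<le> d"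
  shows "variation f x z = variation f x y + variation f y z"
proof (rule antisym)
  show "variation f x y + variation f y z \<le> variation f x z"
  proof (rule field_le_epsilon)
    fix e :: real assume "e > 0"
    then have "e / 2 > 0" by auto
    obtain I where I: "nonoverlapping x y I" "variation f x y < var_sum f I + e / 2" using variation_approx[OF \<open>e / 2 > 0\<close>] by blast
    obtain J where J: "nonoverlapping y z J" "variation f y z < var_sum f J + e / 2" using variation_approx[OF \<open>e / 2 > 0\<close>] by blast
    have IJ: "nonoverlapping x z (I \<union> J)" "I \<inter> J = {}" using nonoverlapping_union[OF I(1) J(1)] xyz by auto
    have "var_sum f (I \<union> J) = var_sum f I + var_sum f J"
      using I J IJ unfolding var_sum_def nonoverlapping_def by (intro sum.union_disjoint) auto
    moreover have "var_sum f (I \<union> J) \<le> variation f x z" using var_sum_le_variation[OF IJ(1)] xyz by auto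
    ultimately show "variation f x y + variation f y z \<le> variation f x z + e" using I J by auto
  qed
  show "variation f x z \<le> variation f x y + variation f y z"
  proof (rule variation_leI)
    fix I assume I: "nonoverlapping x z I"
    have fin: "finite I" and I': "\<And>u v. (u, v) \<in> I \<Longrightarrow> x \<le> u \<and> u < v \<and> v \<le> z" using I unfolding nonoverlapping_def by auto
    define A where "A = {(u, v)\<in>I. v \<le> y}"
    define C where "C = {(u, v)\<in>I. y \<le> u}"
    have AC: "A \<inter> C = {}" "A \<subseteq> I" "C \<subseteq> I" using I' unfolding A_def C_def by fastforce+
    have finAC: "finite A" "finite C" using AC(2,3)[THEN finite_subset, OF fin] by auto
    show "var_sum f I \<le> variation f x y + variation f y z"
    proof (cases "\<exists>u v. (u, v) \<in> I \<and> u < y \<and> y < v")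
      case False
      then have "I = A \<union> C" unfolding A_def C_def by force
      then have "var_sum f I = var_sum f A + var_sum f C"
        unfolding var_sum_def by (simp add: sum.union_disjoint[OF finAC AC(1)])
      moreover have "nonoverlapping x y A"
        using nonoverlapping_subset[OF I AC(2)] unfolding nonoverlapping_def A_def by fastforce
      moreover have "nonoverlapping y z C"
        using nonoverlapping_subset[OF I AC(3)] unfolding nonoverlapping_def C_def by fastforce
      ultimately show ?thesis using var_sum_le_variation[of x y A] var_sum_le_variation[of y z C] xyz by auto
    next
      case True
      then obtain u v where uv: "(u, v) \<in> I" "u < y" "y < v" by auto
      have dI: "disjoint_family_on (\<lambda>(x, y). {x<..<y}) I" using I unfolding nonoverlapping_def by auto
      have uniq: "(u', v') = (u, v)" if "(u', v') \<in> I" "u' < y" "y < v'" for u' v'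
      proof (rule ccontr)
        assume "(u', v') \<noteq> (u, v)"
        then have "{u'<..<v'} \<inter> {u<..<v} = {}" using dI that(1) uv(1) unfolding disjoint_family_on_def by fastforce
        moreover have "y \<in> {u'<..<v'} \<inter> {u<..<v}" using that uv by auto
        ultimately show False by auto
      qed
      have Ieq: "I = insert (u, v) (A \<union> C)"
      proof (intro set_eqI)
        fix p show "p \<in> I \<longleftrightarrow> p \<in> insert (u, v) (A \<union> C)"
          using uv(1) uniq[of "fst p" "snd p"] unfolding A_def C_def by (cases p) force
      qed
      have nu: "(u, v) \<notin> A" "(u, v) \<notin> C" using uv unfolding A_def C_def by auto
      have 1: "nonoverlapping x y (insert (u, y) A) \<and> (u, y) \<notin> A"
      proof (rule nonoverlapping_replace[OF I uv(1)])
        show "A \<subseteq> I - {(u, v)}" using AC nu by blast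
        show "x \<le> u" using I'[OF uv(1)] by simp
        show "x \<le> s \<and> t \<le> y" if "(s, t) \<in> A" for s t using that I'[of s t] unfolding A_def by simp
      qed (use uv in auto)
      have 2: "nonoverlapping y z (insert (y, v) C) \<and> (y, v) \<notin> C"
      proof (rule nonoverlapping_replace[OF I uv(1)])
        show "C \<subseteq> I - {(u, v)}" using AC nu by blast
        show "v \<le> z" using I'[OF uv(1)] by simp
        show "y \<le> s \<and> t \<le> z" if "(s, t) \<in> C" for s t using that I'[of s t] unfolding C_def by simp
      qed (use uv in auto)
      have "var_sum f I = norm (f v - f u) + (var_sum f A + var_sum f C)"
        unfolding var_sum_def Ieq by (subst sum.insert) (use finAC nu in \<open>simp_all add: sum.union_disjoint[OF finAC AC(1)]\<close>)
      also have "\<dots> \<le> (norm (f y - f u) + var_sum f A) + (norm (f v - f y) + var_sum f C)"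
        using norm_triangle_ineq[of "f v - f y" "f y - f u"] by simp
      also have "\<dots> = var_sum f (insert (u, y) A) + var_sum f (insert (y, v) C)"
        unfolding var_sum_def using 1 2 finAC by simp
      also have "\<dots> \<le> variation f x y + variation f y z"
        using var_sum_le_variation[of x y "insert (u, y) A"] var_sum_le_variation[of y z "insert (y, v) C"] 1 2 xyz by auto
      finally show ?thesis .
    qed
  qed
qed

lemma norm_diff_le_variation:
  assumes "c \<le> x" "x \<le> y" "y \<le> d" shows "norm (f y - f x) \<le> variation f x y"
proof (cases "x = y")
  case True then show ?thesis using var_sum_le_variation[OF nonoverlapping_empty, of x y] assms by (simp add: var_sum_def)
next
  case False
  then show ?thesis using var_sum_le_variation[of x y "{(x, y)}"] assms
    by (simp add: nonoverlapping_def var_sum_def disjoint_family_on_def)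
qed

end

lemma nonoverlapping_length_le:
  assumes I: "nonoverlapping c d I" and "c \<le> d"
  shows "(\<Sum>(x, y)\<in>I. y - x) \<le> d - c"
proof -
  have fin: "finite I" and I': "\<And>x y. (x, y) \<in> I \<Longrightarrow> c \<le> x \<and> x < y \<and> y \<le> d"
    and dI: "disjoint_family_on (\<lambda>(x, y). {x<..<y}) I" using I unfolding nonoverlapping_def by auto
  have "(\<Sum>(x, y)\<in>I. y - x) = (\<Sum>p\<in>I. measure lborel (case p of (x, y) \<Rightarrow> {x<..<y}))"
  proof (intro sum.cong refl)
    fix p assume "p \<in> I"
    then have "fst p \<le> snd p" using I'[of "fst p" "snd p"] by simp
    then show "(case p of (x, y) \<Rightarrow> y - x) = measure lborel (case p of (x, y) \<Rightarrow> {x<..<y})"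
      by (simp add: case_prod_unfold)
  qed
  also have "\<dots> = measure lborel (\<Union>p\<in>I. case p of (x, y) \<Rightarrow> {x<..<y})"
  proof (rule measure_finite_Union[symmetric, OF fin _ dI])
    fix p assume "p \<in> I"
    then have "fst p \<le> snd p" using I'[of "fst p" "snd p"] by simp
    then show "emeasure lborel (case p of (x, y) \<Rightarrow> {x<..<y}) \<noteq> \<infinity>" by (simp add: case_prod_unfold)
  qed (simp add: case_prod_unfold image_subset_iff)
  also have "\<dots> \<le> measure lborel {c..d}"
  proof (rule measure_mono_fmeasurable)
    show "(\<Union>p\<in>I. case p of (x, y) \<Rightarrow> {x<..<y}) \<subseteq> {c..d}" using I' by force
    show "(\<Union>p\<in>I. case p of (x, y) \<Rightarrow> {x<..<y}) \<in> sets lborel"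
      using fin by (intro sets.finite_UN) (simp_all add: case_prod_unfold)
    show "{c..d} \<in> fmeasurable lborel" using \<open>c \<le> d\<close> by (intro fmeasurableI) auto
  qed
  also have "\<dots> = d - c" using \<open>c \<le> d\<close> by simp
  finally show ?thesis .
qed

text \<open>Each interval of the given family is refined by a family that almost exhausts the
  variation over it. Together the refinements are nonoverlapping and have no larger total length, so
  the \<delta> that \<open>f\<close> needs for \<epsilon>/2 serves for the variation.\<close>

lemma (in bounded_variation) variation_ac_on:
  assumes ac: "ac_on f c d"
  shows "ac_on (variation f c) c d"
  unfolding ac_on_def
proof (intro allI impI)
  fix \<epsilon> :: real assume e: "\<epsilon> > 0"
  then have "\<epsilon> / 2 > 0" by auto
  then obtain \<delta> where d: "\<delta> > 0" "\<And>I. nonoverlapping c d I \<Longrightarrow> (\<Sum>(x, y)\<in>I. y - x) < \<delta> \<Longrightarrow> var_sum f I < \<epsilon> / 2"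
    using ac_onD[OF ac] by metis
  show "\<exists>\<delta>>0. \<forall>I. nonoverlapping c d I \<longrightarrow> (\<Sum>(x, y)\<in>I. y - x) < \<delta> \<longrightarrow> var_sum (variation f c) I < \<epsilon>"
  proof (intro exI[of _ \<delta>] conjI allI impI d)
    fix I assume I: "nonoverlapping c d I" and len: "(\<Sum>(x, y)\<in>I. y - x) < \<delta>"
    have fin: "finite I" and I': "\<And>x y. (x, y) \<in> I \<Longrightarrow> c \<le> x \<and> x < y \<and> y \<le> d"
      and dI: "disjoint_family_on (\<lambda>(x, y). {x<..<y}) I" using I unfolding nonoverlapping_def by auto
    \<comment> \<open>One share of the remaining \<epsilon>/2 per interval; the \<open>+ 1\<close>
      makes the total strictly smaller and covers the empty family.\<close>
    define \<eta> where "\<eta> = \<epsilon> / (2 * (card I + 1))"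
    have eta: "\<eta> > 0" "card I * \<eta> < \<epsilon> / 2" using e unfolding \<eta>_def by (auto simp: field_simps)
    have "\<exists>J. nonoverlapping (fst p) (snd p) J \<and> variation f (fst p) (snd p) < var_sum f J + \<eta>" for p
      using variation_approx[OF eta(1)] by metis
    then obtain J where J: "\<And>p. nonoverlapping (fst p) (snd p) (J p)" "\<And>p. variation f (fst p) (snd p) < var_sum f (J p) + \<eta>"
      by metis
    define K where "K = (\<Union>p\<in>I. J p)"
    have Jfin: "finite (J p)" and JI: "(u, v) \<in> J p \<Longrightarrow> fst p \<le> u \<and> u < v \<and> v \<le> snd p"
      and Jd: "disjoint_family_on (\<lambda>(x, y). {x<..<y}) (J p)" for p u v
      using J(1)[of p] unfolding nonoverlapping_def by auto
    have Jdisj: "{u<..<v} \<inter> {u'<..<v'} = {}" if "p \<in> I" "p' \<in> I" "p \<noteq> p'" "(u, v) \<in> J p" "(u', v') \<in> J p'" for p p' u v u' v'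
    proof -
      have "{fst p<..<snd p} \<inter> {fst p'<..<snd p'} = {}"
        using dI that(1-3) unfolding disjoint_family_on_def by (cases p; cases p') fastforce
      moreover have "{u<..<v} \<subseteq> {fst p<..<snd p}" "{u'<..<v'} \<subseteq> {fst p'<..<snd p'}" using JI that(4,5) by fastforce+
      ultimately show ?thesis by blast
    qed
    have Jint: "J p \<inter> J p' = {}" if p: "p \<in> I" "p' \<in> I" "p \<noteq> p'" for p p'
    proof -
      have False if "(u, v) \<in> J p" "(u, v) \<in> J p'" for u v
        using Jdisj[OF p that] JI[OF that(1)] by auto
      then show ?thesis by auto
    qed
    have K: "nonoverlapping c d K"
      unfolding nonoverlapping_def
    proof (intro conjI)
      show "finite K" unfolding K_def using fin Jfin by auto
      show "\<forall>(x, y)\<in>K. c \<le> x \<and> x < y \<and> y \<le> d"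
        unfolding K_def using JI I' by fastforce
      show "disjoint_family_on (\<lambda>(x, y). {x<..<y}) K"
        unfolding disjoint_family_on_def
      proof (intro ballI impI)
        fix m n assume "m \<in> K" "n \<in> K" "m \<noteq> n"
        then obtain p p' where p: "p \<in> I" "p' \<in> I" "m \<in> J p" "n \<in> J p'" unfolding K_def by auto
        obtain u v u' v' where m: "m = (u, v)" "n = (u', v')" by (cases m, cases n) auto
        show "(case m of (x, y) \<Rightarrow> {x<..<y}) \<inter> (case n of (x, y) \<Rightarrow> {x<..<y}) = {}"
        proof (cases "p = p'")
          case True
          then show ?thesis using disjoint_family_onD[OF Jd[of p], of m n] \<open>m \<noteq> n\<close> p by blast
        next
          case False
          then show ?thesis using Jdisj[of p p' u v u' v'] p unfolding m prod.case by blast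
        qed
      qed
    qed
    have sumK: "sum g K = (\<Sum>p\<in>I. sum g (J p))" for g :: "real \<times> real \<Rightarrow> real"
      unfolding K_def using fin Jfin Jint by (intro sum.UNION_disjoint) auto
    have "(\<Sum>(x, y)\<in>K. y - x) \<le> (\<Sum>(x, y)\<in>I. y - x)"
      unfolding sumK using nonoverlapping_length_le[OF J(1)] I' by (intro sum_mono) (force split: prod.splits)
    then have *: "var_sum f K < \<epsilon> / 2" using d(2)[OF K] len by linarith
    have "var_sum (variation f c) I = (\<Sum>p\<in>I. variation f (fst p) (snd p))"
      unfolding var_sum_def
    proof (intro sum.cong refl)
      fix p assume "p \<in> I"
      then show "(case p of (x, y) \<Rightarrow> norm (variation f c y - variation f c x)) = variation f (fst p) (snd p)"
        using variation_add[of c "fst p" "snd p"] I'[of "fst p" "snd p"]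
          order_trans[OF norm_ge_zero norm_diff_le_variation[of "fst p" "snd p"]]
        by (auto split: prod.splits)
    qed
    also have "\<dots> \<le> (\<Sum>p\<in>I. var_sum f (J p) + \<eta>)" using J(2) by (intro sum_mono) (auto intro: less_imp_le)
    also have "\<dots> = var_sum f K + card I * \<eta>" unfolding var_sum_def sumK by (simp add: sum.distrib)
    also have "\<dots> < \<epsilon>" using * eta by linarith
    finally show "var_sum (variation f c) I < \<epsilon>" .
  qed
qed


text \<open>A null set is covered by countably many compact intervals with disjoint interiors and
  total length below \<delta>. Absolute continuity keeps the Stieltjes mass of every finite
  subfamily below \<epsilon>, and continuity from below extends this to the whole cover. Continuity
  of \<open>F\<close> makes the mass of a closed interval the plain increment.\<close>

lemma mono_ac_null_measure:
  fixes F :: "real \<Rightarrow> real"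
  assumes cd: "c < d" and mono: "\<And>x y. x \<le> y \<Longrightarrow> F x \<le> F y" and cont: "continuous_on UNIV F"
    and ac: "ac_on F c d" and A: "A \<in> null_sets lborel" "A \<subseteq> {c..d}"
  shows "emeasure (interval_measure F) A = 0"
proof -
  let ?N = "interval_measure F"
  have Ab: "A \<in> sets borel" using A by (auto simp: null_sets_def)
  have negl: "negligible A" using A(1) by (simp add: negligible_iff_null_sets null_sets_completionI)
  have "emeasure ?N A \<le> ennreal \<epsilon>" if e: "\<epsilon> > 0" for \<epsilon> :: real
  proof -
    obtain \<delta> where d: "\<delta> > 0" "\<And>I. nonoverlapping c d I \<Longrightarrow> (\<Sum>(x, y)\<in>I. y - x) < \<delta> \<Longrightarrow> var_sum F I < \<epsilon>"
      using ac_onD[OF ac e] by metis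
    obtain \<D> where D: "countable \<D>" "\<And>K. K \<in> \<D> \<Longrightarrow> K \<subseteq> cbox c d \<and> K \<noteq> {} \<and> (\<exists>c d. K = cbox c d)"
        "pairwise (\<lambda>A B. interior A \<inter> interior B = {}) \<D>"
        "\<And>K. \<lbrakk>K \<in> \<D>; box c d \<noteq> {}\<rbrakk> \<Longrightarrow> interior K \<noteq> {}"
        "A \<subseteq> \<Union>\<D>" "\<Union>\<D> \<in> lmeasurable" "measure lebesgue (\<Union>\<D>) \<le> measure lebesgue A + \<delta> / 2"
    proof (rule measurable_outer_intervals_bounded[of A c d "\<delta> / 2"])
      show "A \<in> lmeasurable" using negl by (rule negligible_imp_measurable)
    qed (use A(2) d(1) in auto)
    have mA: "measure lebesgue A = 0" using negl by (rule negligible_imp_measure0)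
    have "\<exists>u v. K = {u..v} \<and> c \<le> u \<and> u < v \<and> v \<le> d" if K: "K \<in> \<D>" for K
    proof -
      obtain u v where uv: "K = {u..v}" using D(2)[OF K] by auto
      have "interior K \<noteq> {}" using D(4)[OF K] cd by auto
      then have "u < v" unfolding uv by simp
      then show ?thesis using D(2)[OF K] uv by auto
    qed
    then obtain l r where Keq: "\<And>K. K \<in> \<D> \<Longrightarrow> K = {l K..r K}"
      and lr: "\<And>K. K \<in> \<D> \<Longrightarrow> c \<le> l K \<and> l K < r K \<and> r K \<le> d" by metis
    have Ksets: "K \<in> sets ?N" if K: "K \<in> \<D>" for K
      by (subst Keq[OF K]) simp
    have fin: "emeasure ?N (\<Union>E) \<le> ennreal \<epsilon>" if E: "finite E" "E \<subseteq> \<D>" for E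
    proof -
      define I where "I = (\<lambda>K. (l K, r K)) ` E"
      have inj: "inj_on (\<lambda>K. (l K, r K)) E"
      proof (rule inj_onI)
        fix K K' assume K: "K \<in> E" "K' \<in> E" "(l K, r K) = (l K', r K')"
        then show "K = K'" using Keq[of K] Keq[of K'] E(2) by (metis Pair_inject subsetD)
      qed
      have int: "interior K = {l K<..<r K}" if "K \<in> E" for K
        using Keq[of K] that E(2) by (metis interior_atLeastAtMost_real subsetD)
      have disj: "disjoint_family_on (\<lambda>K. {l K<..<r K}) E"
        unfolding disjoint_family_on_def
      proof (intro ballI impI)
        fix m n assume mn: "m \<in> E" "n \<in> E" "m \<noteq> n"
        then have "interior m \<inter> interior n = {}" using D(3) E(2) unfolding pairwise_def by blast
        then show "{l m<..<r m} \<inter> {l n<..<r n} = {}" using int mn by metis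
      qed
      have I: "nonoverlapping c d I"
        unfolding nonoverlapping_def
      proof (intro conjI)
        show "finite I" unfolding I_def using E by auto
        show "\<forall>(x, y)\<in>I. c \<le> x \<and> x < y \<and> y \<le> d" unfolding I_def using lr E(2) by auto
        show "disjoint_family_on (\<lambda>(x, y). {x<..<y}) I"
          unfolding disjoint_family_on_def I_def
        proof (intro ballI impI)
          fix m n assume "m \<in> (\<lambda>K. (l K, r K)) ` E" "n \<in> (\<lambda>K. (l K, r K)) ` E" "m \<noteq> n"
          then obtain K K' where K: "K \<in> E" "K' \<in> E" "m = (l K, r K)" "n = (l K', r K')" "K \<noteq> K'" by auto
          show "(case m of (x, y) \<Rightarrow> {x<..<y}) \<inter> (case n of (x, y) \<Rightarrow> {x<..<y}) = {}"
            using disjoint_family_onD[OF disj K(1,2,5)] unfolding K(3,4) prod.case .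
        qed
      qed
      have "(\<Sum>(x, y)\<in>I. y - x) = (\<Sum>K\<in>E. r K - l K)" unfolding I_def by (simp add: sum.reindex[OF inj])
      also have "\<dots> = (\<Sum>K\<in>E. measure lebesgue {l K<..<r K})"
      proof (intro sum.cong refl)
        fix K assume "K \<in> E"
        then have "l K \<le> r K" using lr[of K] E(2) by auto
        then show "r K - l K = measure lebesgue {l K<..<r K}" by simp
      qed
      also have "\<dots> = measure lebesgue (\<Union>K\<in>E. {l K<..<r K})"
      proof (rule measure_finite_Union[symmetric, OF E(1) _ disj])
        fix K assume "K \<in> E"
        then have "l K \<le> r K" using lr[of K] E(2) by auto
        then show "emeasure lebesgue {l K<..<r K} \<noteq> \<infinity>" by simp
      qed auto
      also have "\<dots> \<le> measure lebesgue (\<Union>\<D>)"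
      proof (rule measure_mono_fmeasurable[OF _ _ D(6)])
        show "(\<Union>K\<in>E. {l K<..<r K}) \<subseteq> \<Union>\<D>" using int interior_subset E(2) by blast
        show "(\<Union>K\<in>E. {l K<..<r K}) \<in> sets lebesgue" using E(1) by (intro sets.finite_UN) auto
      qed
      also have "\<dots> < \<delta>" using D(7) mA d(1) by auto
      finally have vs: "var_sum F I < \<epsilon>" using d(2)[OF I] by auto
      have "emeasure ?N (\<Union>E) \<le> (\<Sum>K\<in>E. emeasure ?N K)"
      proof -
        have "(\<lambda>K. K) ` E \<subseteq> sets ?N" using Ksets E(2) by auto
        from emeasure_subadditive_finite[OF E(1) this] show ?thesis by simp
      qed
      also have "\<dots> = (\<Sum>K\<in>E. ennreal (norm (F (r K) - F (l K))))"
      proof (intro sum.cong refl)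
        fix K assume K: "K \<in> E"
        then have lrK: "K = {l K..r K}" "l K \<le> r K" using Keq[of K] lr[of K] E(2) by (blast, auto)
        have "emeasure ?N K = emeasure ?N {l K..r K}" using lrK(1) by (rule arg_cong)
        also have "\<dots> = ennreal (norm (F (r K) - F (l K)))"
          using emeasure_interval_measure_Icc[OF lrK(2) mono cont] mono[OF lrK(2)] by simp
        finally show "emeasure ?N K = ennreal (norm (F (r K) - F (l K)))" .
      qed
      also have "\<dots> = ennreal (\<Sum>K\<in>E. norm (F (r K) - F (l K)))" by (rule sum_ennreal) auto
      also have "\<dots> = ennreal (var_sum F I)" unfolding var_sum_def I_def by (simp add: sum.reindex[OF inj])
      also have "\<dots> \<le> ennreal \<epsilon>" using vs by (intro ennreal_leI) auto
      finally show ?thesis .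
    qed
    show ?thesis
    proof (cases "\<D> = {}")
      case True then show ?thesis using D(5) by auto
    next
      case False
      \<comment> \<open>An enumeration with possible repetitions, since \<open>\<D>\<close> may be
        finite; only the increasing finite unions \<open>U n\<close> matter.\<close>
      define h where "h = from_nat_into \<D>"
      have h: "range h = \<D>" unfolding h_def using D(1) False by simp
      define U where "U n = \<Union>(h ` {..n})" for n :: nat
      have hs: "h n \<in> sets ?N" for n using Ksets[of "h n"] h by blast
      have Us: "range U \<subseteq> sets ?N" unfolding U_def using hs by (auto intro!: sets.finite_UN)
      have "incseq U" unfolding U_def incseq_def by (auto intro: order_trans)
      have "emeasure ?N A \<le> emeasure ?N (\<Union>n. U n)"
      proof (rule emeasure_mono)
        show "A \<subseteq> (\<Union>n. U n)" using D(5) unfolding U_def h[symmetric] by auto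
        show "(\<Union>n. U n) \<in> sets ?N" using Us by (intro sets.countable_UN) auto
      qed
      also have "\<dots> = (SUP n. emeasure ?N (U n))"
        using SUP_emeasure_incseq[OF Us \<open>incseq U\<close>] by simp
      also have "\<dots> \<le> ennreal \<epsilon>" using h unfolding U_def by (intro SUP_least fin) auto
      finally show ?thesis .
    qed
  qed
  then show ?thesis by (metis ennreal_le_epsilon add_0 le_zero_eq)
qed

text \<open>\<open>G\<close> continues \<open>F\<close> by constants, so its Stieltjes measure is
  carried by \<open>{c..d}\<close> and is absolutely continuous by the null set lemma;
  \<open>g\<close> is its Radon-Nikodym density, made real valued.\<close>

lemma mono_ac_indefinite_integral:
  fixes F :: "real \<Rightarrow> real"
  assumes cd: "c < d" and mono: "\<And>x y. c \<le> x \<Longrightarrow> x \<le> y \<Longrightarrow> y \<le> d \<Longrightarrow> F x \<le> F y" and ac: "ac_on F c d"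
  obtains g where "g absolutely_integrable_on {c..d}"
    "\<And>x y. c \<le> x \<Longrightarrow> x \<le> y \<Longrightarrow> y \<le> d \<Longrightarrow> integral {x..y} g = F y - F x"
proof -
  define G where "G x = F (max c (min d x))" for x
  have Gmono: "G x \<le> G y" if "x \<le> y" for x y
    unfolding G_def using that cd by (intro mono) auto
  have GF: "G x = F x" if "x \<in> {c..d}" for x using that unfolding G_def by (auto simp: max_def min_def)
  have Gcont: "continuous_on UNIV G"
    unfolding G_def using cd
    by (intro continuous_on_compose2[OF ac_on_continuous[OF ac]] continuous_intros) auto
  have Gac: "ac_on G c d"
    using ac unfolding ac_on_def
  proof -
    have "var_sum G I = var_sum F I" if "nonoverlapping c d I" for I
      unfolding var_sum_def using that by (intro sum.cong refl) (fastforce simp: nonoverlapping_def GF)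
    then show "\<forall>\<epsilon>>0. \<exists>\<delta>>0. \<forall>I. nonoverlapping c d I \<longrightarrow> (\<Sum>(x, y)\<in>I. y - x) < \<delta> \<longrightarrow> var_sum G I < \<epsilon>"
      using ac unfolding ac_on_def by metis
  qed
  let ?N = "interval_measure G"
  have Ioc: "emeasure ?N {x<..y} = ennreal (G y - G x)" if "x \<le> y" for x y
    using that Gcont by (intro emeasure_interval_measure_Ioc Gmono)
      (auto intro: continuous_within_subset simp: continuous_on_eq_continuous_within)
  have out: "emeasure ?N (- {c..d}) = 0"
  proof -
    have 1: "{d<..d + real n} \<in> null_sets ?N" for n
      using Ioc[of d "d + real n"] cd by (intro null_setsI) (auto simp: G_def min_def)
    have 2: "{c - real n<..c} \<in> null_sets ?N" for n
      using Ioc[of "c - real n" c] cd by (intro null_setsI) (auto simp: G_def min_def max_def)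
    have "(\<Union>n. {d<..d + real n}) \<union> (\<Union>n. {c - real n<..c}) \<in> null_sets ?N"
      using 1 2 by (intro null_sets.Un null_sets_UN) auto
    moreover have "- {c..d} \<subseteq> (\<Union>n. {d<..d + real n}) \<union> (\<Union>n. {c - real n<..c})"
    proof
      fix x assume x: "x \<in> - {c..d}"
      obtain n :: nat where "\<bar>x\<bar> + \<bar>c\<bar> + \<bar>d\<bar> < real n" using reals_Archimedean2 by blast
      then have "x \<in> {d<..d + real n} \<or> x \<in> {c - real n<..c}" using x by auto
      then show "x \<in> (\<Union>n. {d<..d + real n}) \<union> (\<Union>n. {c - real n<..c})" by blast
    qed
    moreover have "- {c..d} \<in> sets ?N" by simp
    ultimately show ?thesis by (meson null_sets_subset null_setsD1)
  qed
  have "absolutely_continuous lborel ?N"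
    unfolding absolutely_continuous_def
  proof
    fix A :: "real set" assume A: "A \<in> null_sets lborel"
    then have b: "A \<in> sets borel" by (auto simp: null_sets_def)
    have "A \<inter> {c..d} \<in> null_sets lborel" using A by (intro null_set_Int2) auto
    then have "emeasure ?N (A \<inter> {c..d}) = 0"
      using mono_ac_null_measure[OF cd Gmono Gcont Gac] by blast
    moreover have "emeasure ?N (A \<inter> - {c..d}) = 0"
      using out emeasure_mono[of "A \<inter> - {c..d}" "- {c..d}" ?N] by auto
    moreover have "emeasure ?N A \<le> emeasure ?N (A \<inter> {c..d}) + emeasure ?N (A \<inter> - {c..d})"
    proof -
      have "A = (A \<inter> {c..d}) \<union> (A \<inter> - {c..d})" by auto
      then show ?thesis using emeasure_subadditive[of "A \<inter> {c..d}" ?N "A \<inter> - {c..d}"] b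
        by (metis sets_interval_measure atLeastAtMost_borel sets.Int sets.compl_sets space_borel Compl_eq_Diff_UNIV)
    qed
    ultimately have "emeasure ?N A = 0" by simp
    then show "A \<in> null_sets ?N" using b by (intro null_setsI) auto
  qed
  then obtain h where h: "h \<in> borel_measurable lborel" "density lborel h = ?N"
    using sigma_finite_measure.Radon_Nikodym[OF lborel.sigma_finite_measure_axioms, of ?N] by auto
  have hI: "(\<integral>\<^sup>+t. h t * indicator {x<..y} t \<partial>lborel) = ennreal (G y - G x)" if "x \<le> y" for x y
    using Ioc[OF that] h(1) unfolding h(2)[symmetric] by (subst (asm) emeasure_density) auto
  define g where "g t = enn2real (h t)" for t
  have gm: "g \<in> borel_measurable borel" using h(1) unfolding g_def by measurable
  \<comment> \<open>The density has finite integral over \<open>{c<..d}\<close>, so passing to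
    \<open>enn2real\<close> changes it there on a null set only.\<close>
  have fin: "AE t in lborel. h t * indicator {c<..d} t \<noteq> \<infinity>"
    using h(1) hI[of c d] cd by (intro nn_integral_noteq_infinite) auto
  have has: "(g has_integral (F y - F x)) {x..y}" if xy: "c \<le> x" "x \<le> y" "y \<le> d" for x y
  proof -
    let ?f = "\<lambda>t. if t \<in> {x<..y} then g t else 0"
    have "(\<integral>\<^sup>+t. ennreal (?f t) \<partial>lebesgue) = (\<integral>\<^sup>+t. ennreal (?f t) \<partial>lborel)"
      by (rule nn_integral_completion)
    also have "\<dots> = (\<integral>\<^sup>+t. h t * indicator {x<..y} t \<partial>lborel)"
      by (rule nn_integral_cong_AE, rule AE_mp[OF fin], rule AE_I2)
         (use xy in \<open>auto simp: g_def indicator_def ennreal_enn2real_if less_top\<close>)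
    also have "\<dots> = ennreal (F y - F x)" using hI[OF xy(2)] GF xy by auto
    finally have "(\<integral>\<^sup>+t. ennreal (?f t) \<partial>lebesgue) = ennreal (F y - F x)" .
    moreover have "?f \<in> borel_measurable lebesgue"
    proof (rule measurable_completion)
      have "?f \<in> borel_measurable borel" using gm by measurable
      then show "?f \<in> borel_measurable lborel" by simp
    qed
    ultimately have "(?f has_integral (F y - F x)) UNIV"
      using mono[OF xy] by (subst has_integral_iff_nn_integral_lebesgue) (auto simp: g_def)
    then have "(g has_integral (F y - F x)) {x<..y}" by (simp only: has_integral_restrict_UNIV)
    then show ?thesis
    proof (rule has_integral_spike_set_eq[THEN iffD1, rotated 2])
      show "negligible {t \<in> {x<..y} - {x..y}. g t \<noteq> 0}" by (rule negligible_subset[of "{}"]) auto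
      show "negligible {t \<in> {x..y} - {x<..y}. g t \<noteq> 0}" by (rule negligible_subset[of "{x}"]) auto
    qed
  qed
  show thesis
  proof (rule that[of g])
    show "g absolutely_integrable_on {c..d}"
      using has[of c d] cd by (intro nonnegative_absolutely_integrable_1) (auto simp: g_def integrable_on_def)
    show "integral {x..y} g = F y - F x" if "c \<le> x" "x \<le> y" "y \<le> d" for x y
      using has[OF that] by (rule integral_unique)
  qed
qed

text \<open>Lebesgue's theorem is used for averages over \<open>{x..x + h}\<close> with
  \<open>h > 0\<close>, which gives right derivatives. Left derivatives come from the reflected
  function \<open>g0 (- t)\<close>, and therefore the second exceptional set enters
  reflected.\<close>

lemma indefinite_integral_has_vector_derivative_ae:
  fixes g :: "real \<Rightarrow> 'a::euclidean_space"
  assumes g: "g integrable_on {c..d}"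
    and F: "\<And>x y. c \<le> x \<Longrightarrow> x \<le> y \<Longrightarrow> y \<le> d \<Longrightarrow> integral {x..y} g = F y - F x"
  obtains N where "negligible N" "\<And>x. x \<in> {c<..<d} - N \<Longrightarrow> (F has_vector_derivative g x) (at x)"
proof -
  \<comment> \<open>Extension by zero makes the integrand integrable on every interval, as the
    differentiation theorem requires.\<close>
  define g0 where "g0 t = (if t \<in> {c..d} then g t else 0)" for t
  have int: "g0 integrable_on cbox u v" for u v
  proof -
    have "g0 integrable_on UNIV" unfolding g0_def using g by (simp only: integrable_restrict_UNIV)
    then show ?thesis by (rule integrable_on_subcbox) auto
  qed
  have g0: "integral {x..y} g0 = F y - F x" if "c \<le> x" "x \<le> y" "y \<le> d" for x y
    unfolding F[OF that, symmetric] using that by (intro integral_cong) (auto simp: g0_def)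
  have intr: "(\<lambda>t. g0 (- t)) integrable_on cbox u v" for u v
    using int[of "-v" "-u"] integrable_reflect[of g0 "-u" "-v"] by simp
  obtain N1 where N1: "negligible N1" "\<And>x e. \<lbrakk>x \<notin> N1; 0 < e\<rbrakk> \<Longrightarrow> \<exists>d>0. \<forall>h. 0 < h \<and> h < d \<longrightarrow>
      norm (integral (cbox x (x + h *\<^sub>R One)) g0 /\<^sub>R h ^ DIM(real) - g0 x) < e"
    using integrable_ccontinuous_explicit[OF int] by metis
  obtain N2 where N2: "negligible N2" "\<And>x e. \<lbrakk>x \<notin> N2; 0 < e\<rbrakk> \<Longrightarrow> \<exists>d>0. \<forall>h. 0 < h \<and> h < d \<longrightarrow>
      norm (integral (cbox x (x + h *\<^sub>R One)) (\<lambda>t. g0 (- t)) /\<^sub>R h ^ DIM(real) - g0 (- x)) < e"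
    using integrable_ccontinuous_explicit[OF intr] by metis
  show thesis
  proof (rule that[of "N1 \<union> uminus ` N2"])
    show "negligible (N1 \<union> uminus ` N2)"
      using N1(1) N2(1)
      by (intro negligible_Un negligible_differentiable_image_negligible) (auto intro!: differentiable_on_minus)
    fix x assume x: "x \<in> {c<..<d} - (N1 \<union> uminus ` N2)"
    then have xN: "x \<notin> N1" "- x \<notin> N2" and xcd: "c < x" "x < d" by (auto simp: image_iff)
    have g0x: "g0 x = g x" using xcd by (simp add: g0_def)
    show "(F has_vector_derivative g x) (at x)"
      unfolding has_vector_derivative_def has_derivative_at_alt
    proof (intro conjI allI impI)
      show "bounded_linear (\<lambda>h. h *\<^sub>R g x)" by (rule bounded_linear_scaleR_left)
      fix e :: real assume e: "e > 0"
      obtain d1 where d1: "d1 > 0" "\<And>h. 0 < h \<Longrightarrow> h < d1 \<Longrightarrow> norm (integral {x..x + h} g0 /\<^sub>R h - g x) < e"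
        using N1(2)[OF xN(1) e] g0x by auto
      obtain d2 where d2: "d2 > 0" "\<And>h. 0 < h \<Longrightarrow> h < d2 \<Longrightarrow> norm (integral {-x..-x + h} (\<lambda>t. g0 (-t)) /\<^sub>R h - g x) < e"
        using N2(2)[OF xN(2) e] g0x by auto
      have scale: "norm (D - h *\<^sub>R v) \<le> e * h" if "h > 0" "norm (D /\<^sub>R h - v) < e" for D v :: 'a and h
      proof -
        have "D - h *\<^sub>R v = h *\<^sub>R (D /\<^sub>R h - v)" using that(1) by (simp add: algebra_simps)
        then have "norm (D - h *\<^sub>R v) = h * norm (D /\<^sub>R h - v)" using that(1) by simp
        then show ?thesis using that by (simp add: mult.commute)
      qed
      show "\<exists>da>0. \<forall>y. norm (y - x) < da \<longrightarrow> norm (F y - F x - (y - x) *\<^sub>R g x) \<le> e * norm (y - x)"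
      proof (intro exI[of _ "Min {d1, d2, x - c, d - x}"] conjI allI impI)
        show "Min {d1, d2, x - c, d - x} > 0" using d1 d2 xcd by auto
        fix y assume y: "norm (y - x) < Min {d1, d2, x - c, d - x}"
        consider "y = x" | "x < y" | "y < x" by linarith
        then show "norm (F y - F x - (y - x) *\<^sub>R g x) \<le> e * norm (y - x)"
        proof cases
          case 1 then show ?thesis by simp
        next
          case 2
          then have "norm ((F y - F x) /\<^sub>R (y - x) - g x) < e"
            using d1(2)[of "y - x"] y g0[of x y] xcd by auto
          then show ?thesis using scale[of "y - x"] 2 by auto
        next
          case 3
          have "integral {-x..-y} (\<lambda>t. g0 (- t)) = integral {y..x} g0"
            by (rule Henstock_Kurzweil_Integration.integral_reflect_real)
          then have "norm ((F x - F y) /\<^sub>R (x - y) - g x) < e"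
            using d2(2)[of "x - y"] y g0[of y x] xcd 3 by auto
          then have "norm (F x - F y - (x - y) *\<^sub>R g x) \<le> e * (x - y)" using scale[of "x - y"] 3 by auto
          moreover have "norm (F y - F x - (y - x) *\<^sub>R g x) = norm (F x - F y - (x - y) *\<^sub>R g x)"
            by (metis (no_types, opaque_lifting) minus_diff_eq norm_minus_cancel scaleR_minus_left minus_diff_minus)
          ultimately show ?thesis using 3 by auto
        qed
      qed
    qed
  qed
qed

text \<open>Jordan decomposition: \<open>f = V - (V - f)\<close> with the variation function
  \<open>V\<close>; both parts are monotone and absolutely continuous.\<close>

lemma ac_bv_indefinite_integral_real:
  fixes f :: "real \<Rightarrow> real"
  assumes cd: "c < d" and ac: "ac_on f c d" and bv: "bounded_variation f c d B"
  shows "\<exists>g. g absolutely_integrable_on {c..d} \<and>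
    (\<forall>x y. c \<le> x \<longrightarrow> x \<le> y \<longrightarrow> y \<le> d \<longrightarrow> integral {x..y} g = f y - f x)"
proof -
  interpret bounded_variation f c d B by fact
  define V where "V = variation f c"
  have Vd: "\<bar>f y - f x\<bar> \<le> V y - V x" if "c \<le> x" "x \<le> y" "y \<le> d" for x y
    using variation_add[of c x y] norm_diff_le_variation[of x y] that unfolding V_def by auto
  have acV: "ac_on V c d" unfolding V_def by (rule variation_ac_on[OF ac])
  have acW: "ac_on (\<lambda>x. V x - f x) c d"
    by (rule ac_on_bounded_by[OF acV ac, where K=1]) auto
  obtain g where g: "g absolutely_integrable_on {c..d}"
    "\<And>x y. c \<le> x \<Longrightarrow> x \<le> y \<Longrightarrow> y \<le> d \<Longrightarrow> integral {x..y} g = V y - V x"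
  proof (rule mono_ac_indefinite_integral[OF cd _ acV])
    show "V x \<le> V y" if "c \<le> x" "x \<le> y" "y \<le> d" for x y using Vd[OF that] by auto
  qed blast
  obtain h where h: "h absolutely_integrable_on {c..d}"
    "\<And>x y. c \<le> x \<Longrightarrow> x \<le> y \<Longrightarrow> y \<le> d \<Longrightarrow> integral {x..y} h = (V y - f y) - (V x - f x)"
  proof (rule mono_ac_indefinite_integral[OF cd _ acW])
    show "V x - f x \<le> V y - f y" if "c \<le> x" "x \<le> y" "y \<le> d" for x y using Vd[OF that] by auto
  qed blast
  show ?thesis
  proof (intro exI[of _ "\<lambda>t. g t - h t"] conjI allI impI)
    show "(\<lambda>t. g t - h t) absolutely_integrable_on {c..d}" using g h by (intro set_integral_diff)
    fix x y assume xy: "c \<le> x" "x \<le> y" "y \<le> d"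
    have "g integrable_on {x..y}" "h integrable_on {x..y}"
      using g(1) h(1) xy by (auto intro: integrable_on_subinterval set_lebesgue_integral_eq_integral(1))
    then show "integral {x..y} (\<lambda>t. g t - h t) = f y - f x"
      using g(2)[OF xy] h(2)[OF xy] by (simp add: Henstock_Kurzweil_Integration.integral_diff)
  qed
qed

text \<open>\<open>vector_derivative\<close> is an arbitrary value where \<open>f\<close> is not
  differentiable, so differentiability almost everywhere is made part of the notion. In this form
  the property is additive over adjacent intervals, which reduces it to short ones.\<close>

definition ae_ftc :: "(real \<Rightarrow> 'a::euclidean_space) \<Rightarrow> real \<Rightarrow> real \<Rightarrow> bool" where
  "ae_ftc f c d \<longleftrightarrow> (\<lambda>x. vector_derivative f (at x)) absolutely_integrable_on {c..d} \<and>
     integral {c..d} (\<lambda>x. vector_derivative f (at x)) = f d - f c \<and>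
     negligible {x\<in>{c..d}. \<not> (f has_vector_derivative vector_derivative f (at x)) (at x)}"

lemma ac_bv_ae_ftc:
  fixes f :: "real \<Rightarrow> 'a::euclidean_space"
  assumes cd: "c < d" and ac: "ac_on f c d" and bv: "bounded_variation f c d B"
  shows "ae_ftc f c d"
proof -
  have "\<exists>g. g absolutely_integrable_on {c..d} \<and>
    (\<forall>x y. c \<le> x \<longrightarrow> x \<le> y \<longrightarrow> y \<le> d \<longrightarrow> integral {x..y} g = f y \<bullet> i - f x \<bullet> i)" if i: "i \<in> Basis" for i
  proof (rule ac_bv_indefinite_integral_real[OF cd])
    have *: "norm (f y \<bullet> i - f x \<bullet> i) \<le> norm (f y - f x)" for x y
      using Basis_le_norm[OF i, of "f y - f x"] by (simp add: inner_diff_left)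
    have "norm (f y \<bullet> i - f x \<bullet> i) \<le> 1 * (norm (f y - f x) + norm (f y - f x))" for x y
      by (rule order_trans[OF *]) simp
    then show "ac_on (\<lambda>x. f x \<bullet> i) c d" by (rule ac_on_bounded_by[OF ac ac])
    show "bounded_variation (\<lambda>x. f x \<bullet> i) c d B"
    proof
      fix I assume I: "nonoverlapping c d I"
      have "var_sum (\<lambda>x. f x \<bullet> i) I \<le> var_sum f I"
        unfolding var_sum_def using * by (intro sum_mono) (auto split: prod.splits)
      also have "\<dots> \<le> B" using bv I by (rule bounded_variation.bounded)
      finally show "var_sum (\<lambda>x. f x \<bullet> i) I \<le> B" .
    qed
  qed
  then obtain g where g: "\<And>i. i \<in> Basis \<Longrightarrow> g i absolutely_integrable_on {c..d}"
    "\<And>i x y. i \<in> Basis \<Longrightarrow> c \<le> x \<Longrightarrow> x \<le> y \<Longrightarrow> y \<le> d \<Longrightarrow> integral {x..y} (g i) = f y \<bullet> i - f x \<bullet> i"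
    by metis
  define G where "G t = (\<Sum>i\<in>Basis. g i t *\<^sub>R i)" for t
  have Gi: "G absolutely_integrable_on {c..d}"
    unfolding G_def by (intro absolutely_integrable_sum absolutely_integrable_scaleR_right[of _ _ "_::'a"] g finite_Basis
      absolutely_integrable_scaleR_left)
  have GI: "integral {x..y} G = f y - f x" if xy: "c \<le> x" "x \<le> y" "y \<le> d" for x y
  proof -
    have gi: "g i integrable_on {x..y}" if "i \<in> Basis" for i
      using g(1)[OF that] xy by (auto intro: integrable_on_subinterval set_lebesgue_integral_eq_integral(1))
    have "integral {x..y} G = (\<Sum>i\<in>Basis. integral {x..y} (\<lambda>t. g i t *\<^sub>R i))"
      unfolding G_def using gi by (intro Henstock_Kurzweil_Integration.integral_sum integrable_on_scaleR_left) auto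
    also have "\<dots> = (\<Sum>i\<in>Basis. ((f y - f x) \<bullet> i) *\<^sub>R i)"
    proof (intro sum.cong refl)
      fix i :: 'a assume i: "i \<in> Basis"
      have "integral {x..y} ((\<lambda>r. r *\<^sub>R i) \<circ> g i) = integral {x..y} (g i) *\<^sub>R i"
        by (rule integral_linear[OF gi[OF i] bounded_linear_scaleR_left])
      then show "integral {x..y} (\<lambda>t. g i t *\<^sub>R i) = ((f y - f x) \<bullet> i) *\<^sub>R i"
        using g(2)[OF i xy] by (simp add: o_def inner_diff_left)
    qed
    finally show ?thesis by (simp add: euclidean_representation)
  qed
  obtain N where N: "negligible N" "\<And>x. x \<in> {c<..<d} - N \<Longrightarrow> (f has_vector_derivative G x) (at x)"
    using indefinite_integral_has_vector_derivative_ae[of G c d f] Gi GI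
    by (metis set_lebesgue_integral_eq_integral(1))
  let ?N = "N \<union> {c, d}"
  have N': "negligible ?N" using N(1) by simp
  have D: "(f has_vector_derivative G x) (at x)" "vector_derivative f (at x) = G x" if "x \<in> {c..d} - ?N" for x
    using N(2)[of x] that by (auto intro: vector_derivative_at)
  show ?thesis
    unfolding ae_ftc_def
  proof (intro conjI)
    show "(\<lambda>x. vector_derivative f (at x)) absolutely_integrable_on {c..d}"
      by (rule absolutely_integrable_spike[OF Gi N' D(2)])
    show "integral {c..d} (\<lambda>x. vector_derivative f (at x)) = f d - f c"
      using integral_spike[OF N', of "{c..d}" "\<lambda>x. vector_derivative f (at x)" G] D(2) GI[of c d] cd by force
    show "negligible {x \<in> {c..d}. \<not> (f has_vector_derivative vector_derivative f (at x)) (at x)}"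
      by (rule negligible_subset[OF N']) (use D in force)
  qed
qed

lemma ae_ftc_combine:
  fixes f :: "real \<Rightarrow> 'a::euclidean_space"
  assumes "ae_ftc f c m" "ae_ftc f m d" "c \<le> m" "m \<le> d"
  shows "ae_ftc f c d"
proof -
  let ?D = "\<lambda>x. vector_derivative f (at x)"
  have ab: "?D absolutely_integrable_on {c..d}"
    using assms absolutely_integrable_on_combine unfolding ae_ftc_def by blast
  have "integral {c..m} ?D + integral {m..d} ?D = integral {c..d} ?D"
    using assms ab by (intro Henstock_Kurzweil_Integration.integral_combine) (auto intro: set_lebesgue_integral_eq_integral(1))
  moreover have "negligible ({x\<in>{c..m}. \<not> (f has_vector_derivative ?D x) (at x)} \<union> {x\<in>{m..d}. \<not> (f has_vector_derivative ?D x) (at x)})"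
    using assms unfolding ae_ftc_def by auto
  then have "negligible {x\<in>{c..d}. \<not> (f has_vector_derivative ?D x) (at x)}"
    by (rule negligible_subset) auto
  ultimately show ?thesis using ab assms unfolding ae_ftc_def by auto
qed

text \<open>On intervals shorter than the \<open>\<delta>\<close> belonging to \<open>\<epsilon> = 1\<close> the variation is at most 1, so
  bounded variation of absolutely continuous functions is only needed locally.\<close>

lemma ac_on_ae_ftc:
  fixes f :: "real \<Rightarrow> 'a::euclidean_space"
  assumes ac: "ac_on f c d" and cd: "c \<le> d"
  shows "ae_ftc f c d"
proof -
  obtain \<delta> where d: "\<delta> > 0" "\<And>I. nonoverlapping c d I \<Longrightarrow> (\<Sum>(x, y)\<in>I. y - x) < \<delta> \<Longrightarrow> var_sum f I < 1"
    using ac_onD[OF ac, of 1] by auto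
  have refl: "ae_ftc f x x" for x
    unfolding ae_ftc_def by (auto intro: negligible_subset[of "{x}"] absolutely_integrable_on_null[of x x, simplified] )
  have short: "ae_ftc f x y" if xy: "c \<le> x" "x \<le> y" "y \<le> d" "y - x < \<delta>" for x y
  proof (cases "x = y")
    case False
    show ?thesis
    proof (rule ac_bv_ae_ftc)
      show "bounded_variation f x y 1"
      proof
        fix I assume I: "nonoverlapping x y I"
        have "nonoverlapping c d I" using nonoverlapping_subinterval[OF I] xy by auto
        then show "var_sum f I \<le> 1" using d(2)[of I] nonoverlapping_length_le[OF I] xy by auto
      qed
    qed (use False xy ac_on_subinterval[OF ac] in auto)
  qed (simp add: refl)
  have "ae_ftc f x y" if "c \<le> x" "x \<le> y" "y \<le> d" "y - x \<le> real n * (\<delta> / 2)" for n x y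
    using that
  proof (induction n arbitrary: y)
    case 0
    then show ?case using refl by simp
  next
    case (Suc n)
    \<comment> \<open>The last piece has length at most \<delta>/2, hence below \<delta>, and the
      rest is covered by \<open>n\<close> steps; the maximum takes care of the case in which nothing
      remains.\<close>
    define m where "m = max x (y - \<delta> / 2)"
    have "ae_ftc f x m" using Suc.prems d(1) by (intro Suc.IH) (auto simp: m_def max_def algebra_simps)
    moreover have "ae_ftc f m y" using Suc.prems d(1) by (intro short) (auto simp: m_def)
    ultimately show ?case using Suc.prems d(1) by (intro ae_ftc_combine[of f x m y]) (auto simp: m_def)
  qed
  moreover obtain n where "d - c \<le> real n * (\<delta> / 2)"
    using d(1) by (metis half_gt_zero ex_less_of_nat_mult less_imp_le)
  ultimately show ?thesis using cd by blast
qed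

lemma integral_nonoverlapping_le:
  fixes h :: "real \<Rightarrow> real"
  assumes h: "h integrable_on {c..d}" "\<And>x. x \<in> {c..d} \<Longrightarrow> 0 \<le> h x" and I: "nonoverlapping c d I"
  shows "(\<Sum>(x, y)\<in>I. integral {x..y} h) \<le> integral {c..d} h"
proof -
  have fin: "finite I" and I': "\<And>x y. (x, y) \<in> I \<Longrightarrow> c \<le> x \<and> x < y \<and> y \<le> d"
    and dI: "disjoint_family_on (\<lambda>(x, y). {x<..<y}) I" using I unfolding nonoverlapping_def by auto
  let ?T = "\<lambda>(x, y). {x<..<y :: real}"
  have "(h has_integral (\<Sum>p\<in>I. case p of (x, y) \<Rightarrow> integral {x..y} h)) (\<Union>p\<in>I. ?T p)"
  proof (rule has_integral_UN[OF fin])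
    fix p assume p: "p \<in> I"
    obtain x y where xy: "p = (x, y)" by (cases p)
    have "h integrable_on {x..y}" using I'[of x y] p xy h(1) by (intro integrable_on_subinterval[OF h(1)]) auto
    then show "(h has_integral (case p of (x, y) \<Rightarrow> integral {x..y} h)) (?T p)"
      unfolding xy prod.case has_integral_Icc_iff_Ioo[symmetric] by (rule integrable_integral)
  next
    show "pairwise (\<lambda>i i'. negligible (?T i \<inter> ?T i')) I"
      unfolding pairwise_def
    proof (intro ballI impI)
      fix p p' assume "p \<in> I" "p' \<in> I" "p \<noteq> p'"
      then have "?T p \<inter> ?T p' = {}" using dI unfolding disjoint_family_on_def by blast
      then show "negligible (?T p \<inter> ?T p')" by (simp only: negligible_empty)
    qed
  qed
  moreover have "(h has_integral integral {c..d} h) {c..d}" using h(1) by (rule integrable_integral)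
  moreover have "(\<Union>p\<in>I. ?T p) \<subseteq> {c..d}" using I' by force
  ultimately have "(\<Sum>p\<in>I. case p of (x, y) \<Rightarrow> integral {x..y} h) \<le> integral {c..d} h"
    using h(2) by (intro has_integral_subset_le[of "\<Union>p\<in>I. ?T p" "{c..d}" h]) auto
  then show ?thesis .
qed

text \<open>\<open>norm (g t)\<close> is truncated at a level \<open>n\<close> so high that the
  excess has integral below \<epsilon>/2. The truncated part contributes at most \<open>n\<close>
  times the total length, which \<delta> keeps below \<epsilon>/2.\<close>

lemma indefinite_integral_ac_on:
  fixes g :: "real \<Rightarrow> 'a::euclidean_space"
  assumes g: "g absolutely_integrable_on {c..d}"
    and F: "\<And>x y. c \<le> x \<Longrightarrow> x \<le> y \<Longrightarrow> y \<le> d \<Longrightarrow> integral {x..y} g = F y - F x"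
  shows "ac_on F c d"
  unfolding ac_on_def
proof (intro allI impI)
  fix \<epsilon> :: real assume e: "\<epsilon> > 0"
  define G where "G t = norm (g t)" for t
  have Ga: "G absolutely_integrable_on {c..d}" unfolding G_def using g by (rule absolutely_integrable_norm[unfolded o_def])
  have G: "G integrable_on {c..d}" using Ga by (rule set_lebesgue_integral_eq_integral(1))
  define m where "m n t = min (G t) (real n)" for n t
  have mi: "m n integrable_on {c..d}" for n
    unfolding m_def using absolutely_integrable_min_1[OF Ga, of "\<lambda>t. real n"] set_lebesgue_integral_eq_integral(1) by auto
  have "(\<lambda>n. integral {c..d} (m n)) \<longlonglongrightarrow> integral {c..d} G"
  proof (rule dominated_convergence(2)[OF mi G])
    show "norm (m n x) \<le> G x" for n x unfolding m_def G_def by auto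
    fix x
    obtain k :: nat where "G x \<le> real k" using real_arch_simple by blast
    then have "eventually (\<lambda>n. m n x = G x) sequentially"
      unfolding m_def eventually_sequentially by (intro exI[of _ k]) (auto simp: min_def)
    then show "(\<lambda>n. m n x) \<longlonglongrightarrow> G x" by (rule tendsto_eventually)
  qed
  then have "eventually (\<lambda>n. dist (integral {c..d} (m n)) (integral {c..d} G) < \<epsilon> / 2) sequentially"
    using e by (intro tendstoD) auto
  then obtain n where "dist (integral {c..d} (m n)) (integral {c..d} G) < \<epsilon> / 2"
    by (meson eventually_sequentially order_refl)
  then have "integral {c..d} G - integral {c..d} (m n) < \<epsilon> / 2" unfolding dist_real_def by linarith
  then have n: "integral {c..d} (\<lambda>t. G t - m n t) < \<epsilon> / 2"
    using G mi by (simp add: Henstock_Kurzweil_Integration.integral_diff)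
  define \<delta> where "\<delta> = \<epsilon> / (2 * (real n + 1))"
  have d: "\<delta> > 0" "real n * \<delta> < \<epsilon> / 2" using e unfolding \<delta>_def by (auto simp: field_simps)
  show "\<exists>\<delta>>0. \<forall>I. nonoverlapping c d I \<longrightarrow> (\<Sum>(x, y)\<in>I. y - x) < \<delta> \<longrightarrow> var_sum F I < \<epsilon>"
  proof (intro exI[of _ \<delta>] conjI allI impI d)
    fix I assume I: "nonoverlapping c d I" and len: "(\<Sum>(x, y)\<in>I. y - x) < \<delta>"
    have "var_sum F I \<le> (\<Sum>p\<in>I. (case p of (x, y) \<Rightarrow> integral {x..y} (\<lambda>t. G t - m n t)) + real n * (case p of (x, y) \<Rightarrow> y - x))"
      unfolding var_sum_def
    proof (intro sum_mono)
      fix p assume p: "p \<in> I"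
      obtain x y where xyp: "p = (x, y)" by (cases p)
      have xy: "c \<le> x" "x < y" "y \<le> d" using p I(1) unfolding nonoverlapping_def xyp by auto
      have ints: "g integrable_on {x..y}" "G integrable_on {x..y}" "m n integrable_on {x..y}"
        using xy g G integrable_on_subinterval[OF mi[of n], of x y]
      by (auto intro: integrable_on_subinterval set_lebesgue_integral_eq_integral(1))
      have "norm (F y - F x) = norm (integral {x..y} g)" using F[of x y] xy by auto
      also have "\<dots> \<le> integral {x..y} (\<lambda>t. (G t - m n t) + real n)"
        using ints unfolding G_def m_def
        by (intro integral_norm_bound_integral integrable_add integrable_diff) auto
      also have "\<dots> = integral {x..y} (\<lambda>t. G t - m n t) + real n * (y - x)"
        using ints xy by (subst Henstock_Kurzweil_Integration.integral_add) (auto intro: integrable_diff)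
      finally show "(case p of (x, y) \<Rightarrow> norm (F y - F x)) \<le> (case p of (x, y) \<Rightarrow> integral {x..y} (\<lambda>t. G t - m n t)) + real n * (case p of (x, y) \<Rightarrow> y - x)"
        by (simp add: xyp)
    qed
    also have "\<dots> = (\<Sum>(x, y)\<in>I. integral {x..y} (\<lambda>t. G t - m n t)) + real n * (\<Sum>(x, y)\<in>I. y - x)"
      by (simp add: sum.distrib sum_distrib_left)
    also have "\<dots> \<le> integral {c..d} (\<lambda>t. G t - m n t) + real n * \<delta>"
      using len G mi mi[of n, unfolded m_def] by (intro add_mono mult_left_mono integral_nonoverlapping_le I integrable_diff) (auto simp: m_def)
    also have "\<dots> < \<epsilon>" using n d by linarith
    finally show "var_sum F I < \<epsilon>" .
  qed
qed

section \<open>Indefinite integrals on an interval\<close>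

lemma AE_lebesgue_on_iff_negligible:
  fixes S :: "'a::euclidean_space set"
  assumes "S \<in> sets lebesgue"
  shows "(AE x in lebesgue_on S. P x) \<longleftrightarrow> negligible {x\<in>S. \<not> P x}"
proof -
  have "(AE x in lebesgue_on S. P x) \<longleftrightarrow> (AE x in lebesgue. x \<in> S \<longrightarrow> P x)"
    using assms by (intro AE_restrict_space_iff) auto
  also have "\<dots> \<longleftrightarrow> {x. \<not> (x \<in> S \<longrightarrow> P x)} \<in> null_sets lebesgue"
    by (simp add: completion.AE_iff_null_sets AE_iff_null_sets flip: null_sets_def)
  also have "\<dots> \<longleftrightarrow> negligible {x\<in>S. \<not> P x}" by (simp add: negligible_iff_null_sets)
  finally show ?thesis .
qed


lemma einterval_Icc_subset: "c \<in> einterval a b \<Longrightarrow> d \<in> einterval a b \<Longrightarrow> {c..d} \<subseteq> einterval a b"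
  unfolding einterval_def
  by (auto intro: less_le_trans le_less_trans)
    (metis (no_types, lifting) ereal_less_eq(3) less_le_trans le_less_trans)+

text \<open>The compact subintervals with rational endpoints are countably many and cover the open
  interval.\<close>

lemma negligible_einterval:
  assumes "\<And>c d. c \<in> einterval a b \<Longrightarrow> d \<in> einterval a b \<Longrightarrow> negligible (S \<inter> {c..d})"
  shows "negligible (S \<inter> einterval a b)"
proof -
  let ?F = "(\<lambda>(c, d). S \<inter> {c..d}) ` ((einterval a b \<inter> \<rat>) \<times> (einterval a b \<inter> \<rat>))"
  have "countable ?F" using countable_rat by (intro countable_image countable_SIGMA) (auto intro: countable_subset)
  moreover have "negligible A" if "A \<in> ?F" for A using that assms by auto
  ultimately have "negligible (\<Union>?F)" by (intro negligible_countable_Union)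
  moreover have "S \<inter> einterval a b \<subseteq> \<Union>?F"
  proof
    fix x assume x: "x \<in> S \<inter> einterval a b"
    then obtain e where e: "e > 0" "ball x e \<subseteq> einterval a b" using open_contains_ball by (metis IntD2 open_einterval)
    obtain c where c: "c \<in> \<rat>" "x - e < c" "c < x" using Rats_dense_in_real[of "x - e" x] e(1) by auto
    obtain d where d: "d \<in> \<rat>" "x < d" "d < x + e" using Rats_dense_in_real[of x "x + e"] e(1) by auto
    have "c \<in> einterval a b" "d \<in> einterval a b" using e(2) c d by (auto simp: subset_eq dist_real_def)
    then have "(c, d) \<in> (einterval a b \<inter> \<rat>) \<times> (einterval a b \<inter> \<rat>)" "x \<in> S \<inter> {c..d}" using c d x by auto
    then show "x \<in> \<Union>?F" by blast
  qed
  ultimately show ?thesis by (rule negligible_subset)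
qed

lemma AE_einterval_iff:
  "(AE x in lebesgue_on (einterval a b). P x) \<longleftrightarrow>
     (\<forall>c\<in>einterval a b. \<forall>d\<in>einterval a b. negligible {x\<in>{c..d}. \<not> P x})"
proof
  assume "AE x in lebesgue_on (einterval a b). P x"
  then have n: "negligible {x\<in>einterval a b. \<not> P x}" by (subst (asm) AE_lebesgue_on_iff_negligible) auto
  show "\<forall>c\<in>einterval a b. \<forall>d\<in>einterval a b. negligible {x\<in>{c..d}. \<not> P x}"
    using einterval_Icc_subset[of _ a b] by (intro ballI negligible_subset[OF n]) blast
next
  assume *: "\<forall>c\<in>einterval a b. \<forall>d\<in>einterval a b. negligible {x\<in>{c..d}. \<not> P x}"
  have "negligible ({x. \<not> P x} \<inter> einterval a b)"
  proof (rule negligible_einterval)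
    fix c d assume cd: "c \<in> einterval a b" "d \<in> einterval a b"
    have "{x\<in>{c..d}. \<not> P x} = {x. \<not> P x} \<inter> {c..d}" by auto
    then show "negligible ({x. \<not> P x} \<inter> {c..d})" using * cd by metis
  qed
  moreover have "{x. \<not> P x} \<inter> einterval a b = {x\<in>einterval a b. \<not> P x}" by auto
  ultimately show "AE x in lebesgue_on (einterval a b). P x" by (subst AE_lebesgue_on_iff_negligible) auto
qed

section \<open>Primitives on an open interval\<close>

definition loc_integrable :: "ereal \<Rightarrow> ereal \<Rightarrow> (real \<Rightarrow> 'a::euclidean_space) \<Rightarrow> bool" where
  "loc_integrable a b g \<longleftrightarrow> (\<forall>c\<in>einterval a b. \<forall>d\<in>einterval a b. g absolutely_integrable_on {c..d})"

text \<open>The relation \<open>f' = g\<close> in the sense of Caratheodory. The integrated form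
  ignores null sets in \<open>g\<close>, carries local integrability along, and amounts to local
  absolute continuity of \<open>f\<close> with \<open>g\<close> as almost everywhere
  derivative.\<close>

definition primitive :: "ereal \<Rightarrow> ereal \<Rightarrow> (real \<Rightarrow> 'a::euclidean_space) \<Rightarrow> (real \<Rightarrow> 'a) \<Rightarrow> bool" where
  "primitive a b f g \<longleftrightarrow> loc_integrable a b g \<and>
     (\<forall>c\<in>einterval a b. \<forall>d\<in>einterval a b. c \<le> d \<longrightarrow> integral {c..d} g = f d - f c)"

lemma primitive_loc_integrable: "primitive a b f g \<Longrightarrow> loc_integrable a b g"
  by (simp add: primitive_def)

lemma loc_integrableD: "loc_integrable a b g \<Longrightarrow> c \<in> einterval a b \<Longrightarrow> d \<in> einterval a b \<Longrightarrow> g absolutely_integrable_on {c..d}"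
  by (simp add: loc_integrable_def)

lemma loc_integrable_integrable: "loc_integrable a b g \<Longrightarrow> c \<in> einterval a b \<Longrightarrow> d \<in> einterval a b \<Longrightarrow> g integrable_on {c..d}"
  using loc_integrableD set_lebesgue_integral_eq_integral(1) by blast

lemma primitiveD:
  "primitive a b f g \<Longrightarrow> c \<in> einterval a b \<Longrightarrow> d \<in> einterval a b \<Longrightarrow> c \<le> d \<Longrightarrow> integral {c..d} g = f d - f c"
  by (simp add: primitive_def)

lemma AC_loc_iff: "f \<in> AC_loc a b \<longleftrightarrow> (\<forall>c\<in>einterval a b. \<forall>d\<in>einterval a b. ac_on f c d)"
  by (simp add: AC_loc_def abs_continuous_Icc_iff)

lemma ac_on_primitive:
  fixes f :: "real \<Rightarrow> 'a::euclidean_space"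
  assumes "\<And>c d. c \<in> einterval a b \<Longrightarrow> d \<in> einterval a b \<Longrightarrow> ac_on f c d"
  shows "primitive a b f (\<lambda>x. vector_derivative f (at x))"
    "AE x in lebesgue_on (einterval a b). (f has_vector_derivative vector_derivative f (at x)) (at x)"
proof -
  have *: "ae_ftc f c d" if "c \<in> einterval a b" "d \<in> einterval a b" "c \<le> d" for c d
    using assms that by (intro ac_on_ae_ftc) auto
  have **: "(\<lambda>x. vector_derivative f (at x)) absolutely_integrable_on {c..d}"
    if "c \<in> einterval a b" "d \<in> einterval a b" for c d
    using *[OF that] by (cases "c \<le> d") (auto simp: ae_ftc_def)
  show "primitive a b f (\<lambda>x. vector_derivative f (at x))"
    unfolding primitive_def loc_integrable_def using * ** by (auto simp: ae_ftc_def)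
  show "AE x in lebesgue_on (einterval a b). (f has_vector_derivative vector_derivative f (at x)) (at x)"
    unfolding AE_einterval_iff
  proof (intro ballI)
    fix c d assume "c \<in> einterval a b" "d \<in> einterval a b"
    then show "negligible {x \<in> {c..d}. \<not> (f has_vector_derivative vector_derivative f (at x)) (at x)}"
      using *[of c d] by (cases "c \<le> d") (auto simp: ae_ftc_def)
  qed
qed

lemma AC_loc_primitive:
  assumes "f \<in> AC_loc a b"
  shows "primitive a b f (\<lambda>x. vector_derivative f (at x))"
    "AE x in lebesgue_on (einterval a b). (f has_vector_derivative vector_derivative f (at x)) (at x)"
  using assms by (auto simp: AC_loc_iff intro: ac_on_primitive)

lemma primitive_ac_on:
  assumes f: "primitive a b f g" and cd: "c \<in> einterval a b" "d \<in> einterval a b"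
  shows "ac_on f c d"
proof (rule indefinite_integral_ac_on)
  show "g absolutely_integrable_on {c..d}" using f cd unfolding primitive_def loc_integrable_def by auto
  show "integral {x..y} g = f y - f x" if "c \<le> x" "x \<le> y" "y \<le> d" for x y
  proof -
    have "{c..d} \<subseteq> einterval a b" by (rule einterval_Icc_subset[OF cd])
    then show ?thesis using that by (intro primitiveD[OF f]) auto
  qed
qed

lemma primitive_AC_loc: "primitive a b f g \<Longrightarrow> f \<in> AC_loc a b"
  unfolding AC_loc_iff using primitive_ac_on by blast

lemma primitive_has_vector_derivative_ae:
  assumes f: "primitive a b f g"
  shows "AE x in lebesgue_on (einterval a b). (f has_vector_derivative g x) (at x)"
  unfolding AE_einterval_iff
proof (intro ballI)
  fix c d assume cd: "c \<in> einterval a b" "d \<in> einterval a b"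
  obtain N where N: "negligible N" "\<And>x. x \<in> {c<..<d} - N \<Longrightarrow> (f has_vector_derivative g x) (at x)"
  proof (rule indefinite_integral_has_vector_derivative_ae[of g c d f])
    show "g integrable_on {c..d}" using f cd primitive_loc_integrable loc_integrable_integrable by blast
    show "integral {x..y} g = f y - f x" if "c \<le> x" "x \<le> y" "y \<le> d" for x y
      using einterval_Icc_subset[OF cd] that by (intro primitiveD[OF f]) auto
  qed blast
  show "negligible {x \<in> {c..d}. \<not> (f has_vector_derivative g x) (at x)}"
  proof (rule negligible_subset)
    show "negligible (N \<union> {c, d})" using N(1) by simp
    show "{x \<in> {c..d}. \<not> (f has_vector_derivative g x) (at x)} \<subseteq> N \<union> {c, d}" using N(2) by force
  qed
qed

lemma primitive_continuous_on: "primitive a b f g \<Longrightarrow> continuous_on (einterval a b) f"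
proof -
  assume f: "primitive a b f g"
  have "isCont f x" if x: "x \<in> einterval a b" for x
  proof -
    obtain e where e: "e > 0" "ball x e \<subseteq> einterval a b" using open_contains_ball x by (metis open_einterval)
    have "x - e / 2 \<in> einterval a b" "x + e / 2 \<in> einterval a b"
      using e by (auto simp: subset_eq dist_real_def)
    then have "continuous_on {x - e / 2..x + e / 2} f"
      by (intro ac_on_continuous primitive_ac_on[OF f])
    then show ?thesis using e(1) by (auto intro!: continuous_on_interior[of "{x - e / 2..x + e / 2}"])
  qed
  then show ?thesis by (simp add: continuous_at_imp_continuous_on)
qed

lemma loc_integrable_cong_AE:
  assumes "loc_integrable a b g" "AE x in lebesgue_on (einterval a b). g x = h x"
  shows "loc_integrable a b h"
  unfolding loc_integrable_def
proof (intro ballI)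
  fix c d assume cd: "c \<in> einterval a b" "d \<in> einterval a b"
  have "negligible {x\<in>{c..d}. g x \<noteq> h x}" using assms(2) cd unfolding AE_einterval_iff by auto
  then show "h absolutely_integrable_on {c..d}"
    by (rule absolutely_integrable_spike[OF loc_integrableD[OF assms(1) cd]]) auto
qed

lemma primitive_cong_AE:
  assumes f: "primitive a b f g" and eq: "\<And>x. x \<in> einterval a b \<Longrightarrow> f x = f' x"
    and ae: "AE x in lebesgue_on (einterval a b). g x = g' x"
  shows "primitive a b f' g'"
  unfolding primitive_def
proof (intro conjI ballI impI)
  show "loc_integrable a b g'" using loc_integrable_cong_AE[OF primitive_loc_integrable[OF f] ae] .
  fix c d assume cd: "c \<in> einterval a b" "d \<in> einterval a b" "c \<le> d"
  have "negligible {x\<in>{c..d}. g x \<noteq> g' x}" using ae cd unfolding AE_einterval_iff by auto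
  then have "integral {c..d} g' = integral {c..d} g" by (rule integral_spike) auto
  then show "integral {c..d} g' = f' d - f' c" using primitiveD[OF f cd] eq cd by simp
qed

lemma primitive_unique_AE:
  assumes "primitive a b f g" "primitive a b f' g'" "\<And>x. x \<in> einterval a b \<Longrightarrow> f x = f' x"
  shows "AE x in lebesgue_on (einterval a b). g x = g' x"
proof -
  have "primitive a b f g'"
    unfolding primitive_def using assms(2,3) by (auto simp: primitive_def)
  from primitive_has_vector_derivative_ae[OF this] primitive_has_vector_derivative_ae[OF assms(1)]
  show ?thesis by eventually_elim (rule vector_derivative_unique_at)
qed

lemma loc_integrable_add: "loc_integrable a b f \<Longrightarrow> loc_integrable a b g \<Longrightarrow> loc_integrable a b (\<lambda>x. f x + g x)"
  unfolding loc_integrable_def by (auto intro: set_integral_add)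

lemma loc_integrable_bounded_linear:
  "bounded_linear h \<Longrightarrow> loc_integrable a b f \<Longrightarrow> loc_integrable a b (\<lambda>x. h (f x))"
  unfolding loc_integrable_def using absolutely_integrable_linear[unfolded o_def] by blast

lemma primitive_add:
  assumes "primitive a b f f'" "primitive a b g g'"
  shows "primitive a b (\<lambda>x. f x + g x) (\<lambda>x. f' x + g' x)"
  unfolding primitive_def
proof (intro conjI ballI impI)
  show "loc_integrable a b (\<lambda>x. f' x + g' x)" using assms by (intro loc_integrable_add primitive_loc_integrable)
  fix c d assume cd: "c \<in> einterval a b" "d \<in> einterval a b" "c \<le> d"
  have "f' integrable_on {c..d}" "g' integrable_on {c..d}"
    by (rule loc_integrable_integrable[OF primitive_loc_integrable[OF assms(1)] cd(1,2)],
        rule loc_integrable_integrable[OF primitive_loc_integrable[OF assms(2)] cd(1,2)])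
  then have "integral {c..d} (\<lambda>x. f' x + g' x) = integral {c..d} f' + integral {c..d} g'"
    by (rule Henstock_Kurzweil_Integration.integral_add)
  then show "integral {c..d} (\<lambda>x. f' x + g' x) = f d + g d - (f c + g c)"
    using primitiveD[OF assms(1) cd] primitiveD[OF assms(2) cd] by simp
qed

lemma primitive_bounded_linear:
  assumes h: "bounded_linear h" and f: "primitive a b f f'"
  shows "primitive a b (\<lambda>x. h (f x)) (\<lambda>x. h (f' x))"
  unfolding primitive_def
proof (intro conjI ballI impI)
  show "loc_integrable a b (\<lambda>x. h (f' x))" by (rule loc_integrable_bounded_linear[OF h primitive_loc_integrable[OF f]])
  fix c d assume cd: "c \<in> einterval a b" "d \<in> einterval a b" "c \<le> d"
  have "integral {c..d} (h \<circ> f') = h (integral {c..d} f')"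
    by (rule integral_linear[OF loc_integrable_integrable[OF primitive_loc_integrable[OF f] cd(1,2)] h])
  then show "integral {c..d} (\<lambda>x. h (f' x)) = h (f d) - h (f c)"
    using primitiveD[OF f cd] linear_diff[OF bounded_linear.linear[OF h]] by (simp add: o_def)
qed

text \<open>Integration by parts. On a compact interval both factors are bounded, so the product is
  absolutely continuous; its derivative is given by the Leibniz rule wherever both factors are
  differentiable, that is, almost everywhere.\<close>

lemma primitive_mult:
  fixes f g :: "real \<Rightarrow> 'a::{euclidean_space, real_normed_algebra}"
  assumes f: "primitive a b f f'" and g: "primitive a b g g'"
  shows "primitive a b (\<lambda>x. f x * g x) (\<lambda>x. f x * g' x + f' x * g x)"
proof -
  have "ac_on (\<lambda>x. f x * g x) c d" if cd: "c \<in> einterval a b" "d \<in> einterval a b" for c d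
  proof -
    have ac: "ac_on f c d" "ac_on g c d" using f g cd by (auto intro: primitive_ac_on)
    have "bounded (f ` {c..d})" "bounded (g ` {c..d})"
      using ac by (auto intro!: compact_imp_bounded compact_continuous_image ac_on_continuous)
    then obtain K L where KL: "\<And>x. x \<in> {c..d} \<Longrightarrow> norm (f x) \<le> K" "\<And>x. x \<in> {c..d} \<Longrightarrow> norm (g x) \<le> L"
      unfolding bounded_iff by fast
    show "ac_on (\<lambda>x. f x * g x) c d"
    proof (rule ac_on_bounded_by[OF ac, where K = "\<bar>K\<bar> + \<bar>L\<bar>"])
      fix x y assume xy: "c \<le> x" "x < y" "y \<le> d"
      have "f y * g y - f x * g x = f y * (g y - g x) + (f y - f x) * g x" by (simp add: algebra_simps)
      then have "norm (f y * g y - f x * g x) \<le> norm (f y) * norm (g y - g x) + norm (f y - f x) * norm (g x)"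
        using norm_triangle_ineq[of "f y * (g y - g x)" "(f y - f x) * g x"]
          norm_mult_ineq[of "f y" "g y - g x"] norm_mult_ineq[of "f y - f x" "g x"]
        by (simp only:)
      also have "\<dots> \<le> (\<bar>K\<bar> + \<bar>L\<bar>) * norm (g y - g x) + norm (f y - f x) * (\<bar>K\<bar> + \<bar>L\<bar>)"
        using KL(1)[of y] KL(2)[of x] xy by (intro add_mono mult_mono) auto
      also have "\<dots> = (\<bar>K\<bar> + \<bar>L\<bar>) * (norm (f y - f x) + norm (g y - g x))" by (simp add: algebra_simps)
      finally show "norm (f y * g y - f x * g x) \<le> (\<bar>K\<bar> + \<bar>L\<bar>) * (norm (f y - f x) + norm (g y - g x))" .
    qed
  qed
  from ac_on_primitive(1)[OF this] show ?thesis
  proof (rule primitive_cong_AE)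
    show "AE x in lebesgue_on (einterval a b). vector_derivative (\<lambda>x. f x * g x) (at x) = f x * g' x + f' x * g x"
      using primitive_has_vector_derivative_ae[OF f] primitive_has_vector_derivative_ae[OF g]
      by eventually_elim (auto intro: vector_derivative_at has_vector_derivative_mult)
  qed simp_all
qed

lemma loc_integrable_continuous_mult:
  fixes f g :: "real \<Rightarrow> complex"
  assumes f: "continuous_on (einterval a b) f" and g: "loc_integrable a b g"
  shows "loc_integrable a b (\<lambda>x. f x * g x)"
  unfolding loc_integrable_def
proof (intro ballI)
  fix c d assume cd: "c \<in> einterval a b" "d \<in> einterval a b"
  have cont: "continuous_on {c..d} f" using f einterval_Icc_subset[OF cd] by (rule continuous_on_subset)
  show "(\<lambda>x. f x * g x) absolutely_integrable_on {c..d}"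
  proof (rule absolutely_integrable_bounded_measurable_product[where h = "(*)"])
    show "bilinear ((*) :: complex \<Rightarrow> complex \<Rightarrow> complex)" by (rule bilinear_times)
    show "f \<in> borel_measurable (lebesgue_on {c..d})"
      by (rule continuous_imp_measurable_on_sets_lebesgue[OF cont]) auto
    show "bounded (f ` {c..d})" using cont by (auto intro!: compact_imp_bounded compact_continuous_image)
    show "g absolutely_integrable_on {c..d}" by (rule loc_integrableD[OF g cd])
  qed auto
qed

lemma primitive_exists:
  fixes g :: "real \<Rightarrow> 'a::euclidean_space"
  assumes g: "loc_integrable a b g" and x0: "x0 \<in> einterval a b"
  obtains f where "primitive a b f g" "f x0 = y"
proof -
  \<comment> \<open>The oriented integral from \<open>x0\<close>, written out for both orders of the
    endpoints.\<close>
  define f where "f x = y + (if x0 \<le> x then integral {x0..x} g else - integral {x..x0} g)" for x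
  have "integral {c..d} g = f d - f c" if cd: "c \<in> einterval a b" "d \<in> einterval a b" "c \<le> d" for c d
  proof -
    have comb: "integral {u..v} g + integral {v..w} g = integral {u..w} g"
      if "u \<in> einterval a b" "w \<in> einterval a b" "u \<le> v" "v \<le> w" for u v w
      using that loc_integrable_integrable[OF g] by (intro Henstock_Kurzweil_Integration.integral_combine) auto
    consider "x0 \<le> c" | "c < x0" "x0 \<le> d" | "d < x0" by linarith
    then show ?thesis
    proof cases
      case 1 then show ?thesis using comb[of x0 d c] x0 cd by (simp add: f_def algebra_simps)
    next
      case 2 then show ?thesis using comb[of c d x0] x0 cd by (simp add: f_def algebra_simps)
    next
      case 3 then show ?thesis using comb[of c x0 d] x0 cd by (simp add: f_def algebra_simps)
    qed
  qed
  then have "primitive a b f g" unfolding primitive_def using g by auto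
  moreover have "f x0 = y" by (simp add: f_def)
  ultimately show ?thesis by (rule that)
qed

section \<open>The Hilbert space of square integrable functions\<close>

lemma L2_measurable: "f \<in> L2 M \<Longrightarrow> f \<in> borel_measurable M"
  by (simp add: L2_def)

lemma L2_integrable: "f \<in> L2 M \<Longrightarrow> integrable M (\<lambda>x. (cmod (f x))\<^sup>2)"
  by (simp add: L2_def)

lemma norm_mult_le_sum_squares: "cmod (u * v) \<le> (cmod u)\<^sup>2 + (cmod v)\<^sup>2"
proof -
  have "2 * (cmod u * cmod v) \<le> (cmod u)\<^sup>2 + (cmod v)\<^sup>2"
    using zero_le_power2[of "cmod u - cmod v"] by (simp add: power2_diff)
  moreover have "0 \<le> cmod u * cmod v" by simp
  ultimately show ?thesis unfolding norm_mult by linarith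
qed

lemma L2_mult_integrable:
  assumes "f \<in> L2 M" "g \<in> L2 M"
  shows "integrable M (\<lambda>x. f x * g x)"
proof (rule Bochner_Integration.integrable_bound)
  show "integrable M (\<lambda>x. (cmod (f x))\<^sup>2 + (cmod (g x))\<^sup>2)" using assms by (intro Bochner_Integration.integrable_add L2_integrable)
  show "(\<lambda>x. f x * g x) \<in> borel_measurable M" using assms by (intro borel_measurable_times L2_measurable)
  show "AE x in M. norm (f x * g x) \<le> norm ((cmod (f x))\<^sup>2 + (cmod (g x))\<^sup>2)"
    using norm_mult_le_sum_squares by (auto intro!: AE_I2 simp: abs_of_nonneg)
qed

lemma L2_cnj: "f \<in> L2 M \<Longrightarrow> (\<lambda>x. cnj (f x)) \<in> L2 M"
  unfolding L2_def by (auto intro: borel_measurable_continuous_onI[THEN measurable_compose[rotated]] continuous_intros)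

lemma L2_cmult: "f \<in> L2 M \<Longrightarrow> (\<lambda>x. c * f x) \<in> L2 M"
  unfolding L2_def by (auto simp: norm_mult power_mult_distrib)

lemma L2_add:
  assumes "f \<in> L2 M" "g \<in> L2 M" shows "(\<lambda>x. f x + g x) \<in> L2 M"
proof -
  have m: "(\<lambda>x. f x + g x) \<in> borel_measurable M" using assms by (intro borel_measurable_add L2_measurable)
  have "integrable M (\<lambda>x. (cmod (f x + g x))\<^sup>2)"
  proof (rule Bochner_Integration.integrable_bound)
    show "integrable M (\<lambda>x. 2 * (cmod (f x))\<^sup>2 + 2 * (cmod (g x))\<^sup>2)"
      using assms by (intro Bochner_Integration.integrable_add integrable_mult_right L2_integrable)
    show "(\<lambda>x. (cmod (f x + g x))\<^sup>2) \<in> borel_measurable M" using m by measurable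
    have "(cmod (u + v))\<^sup>2 \<le> 2 * (cmod u)\<^sup>2 + 2 * (cmod v)\<^sup>2" for u v :: complex
    proof -
      have "(cmod (u + v))\<^sup>2 \<le> (cmod u + cmod v)\<^sup>2" by (intro power_mono norm_triangle_ineq) auto
      also have "\<dots> \<le> 2 * (cmod u)\<^sup>2 + 2 * (cmod v)\<^sup>2"
        using zero_le_power2[of "cmod u - cmod v"] by (simp add: power2_diff power2_sum)
      finally show ?thesis .
    qed
    then show "AE x in M. norm ((cmod (f x + g x))\<^sup>2) \<le> norm (2 * (cmod (f x))\<^sup>2 + 2 * (cmod (g x))\<^sup>2)"
      by (auto intro!: AE_I2 simp: abs_of_nonneg)
  qed
  then show ?thesis using m by (simp add: L2_def)
qed

lemma L2_zero: "(\<lambda>x. 0) \<in> L2 M"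
  by (simp add: L2_def)

lemma L2_diff: "f \<in> L2 M \<Longrightarrow> g \<in> L2 M \<Longrightarrow> (\<lambda>x. f x - g x) \<in> L2 M"
  using L2_add[of f M "\<lambda>x. (-1) * g x"] L2_cmult[of g M "-1"] by simp

lemma L2_sum: "(\<And>i. i \<in> A \<Longrightarrow> f i \<in> L2 M) \<Longrightarrow> (\<lambda>x. \<Sum>i\<in>A. f i x) \<in> L2 M"
  by (induction A rule: infinite_finite_induct) (auto intro: L2_zero L2_add)

lemma L2_cong_AE:
  assumes "f \<in> L2 M" "g \<in> borel_measurable M" "AE x in M. f x = g x"
  shows "g \<in> L2 M"
proof -
  have "integrable M (\<lambda>x. (cmod (f x))\<^sup>2) = integrable M (\<lambda>x. (cmod (g x))\<^sup>2)"
    by (rule integrable_cong_AE) (use assms L2_measurable[OF assms(1)] in auto)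
  then show ?thesis using assms by (simp add: L2_def)
qed

lemma L2_inner_integrable: "f \<in> L2 M \<Longrightarrow> g \<in> L2 M \<Longrightarrow> integrable M (\<lambda>x. cnj (f x) * g x)"
  by (intro L2_mult_integrable L2_cnj)

lemma L2_inner_add_right: "f \<in> L2 M \<Longrightarrow> g \<in> L2 M \<Longrightarrow> h \<in> L2 M \<Longrightarrow>
    L2_inner M f (\<lambda>x. g x + h x) = L2_inner M f g + L2_inner M f h"
  unfolding L2_inner_def by (simp add: distrib_left L2_inner_integrable)

lemma L2_inner_diff_right: "f \<in> L2 M \<Longrightarrow> g \<in> L2 M \<Longrightarrow> h \<in> L2 M \<Longrightarrow>
    L2_inner M f (\<lambda>x. g x - h x) = L2_inner M f g - L2_inner M f h"
  unfolding L2_inner_def by (simp add: right_diff_distrib L2_inner_integrable)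

lemma L2_inner_cmult_right: "L2_inner M f (\<lambda>x. c * g x) = c * L2_inner M f g"
proof -
  have "L2_inner M f (\<lambda>x. c * g x) = (\<integral>x. c * (cnj (f x) * g x) \<partial>M)"
    unfolding L2_inner_def by (intro Bochner_Integration.integral_cong) auto
  then show ?thesis by (simp add: L2_inner_def)
qed

lemma L2_inner_commute: "L2_inner M g f = cnj (L2_inner M f g)"
proof -
  have "cnj (L2_inner M f g) = (\<integral>x. cnj (cnj (f x) * g x) \<partial>M)" unfolding L2_inner_def by (rule Bochner_Integration.integral_cnj[symmetric])
  also have "\<dots> = L2_inner M g f" unfolding L2_inner_def by (intro Bochner_Integration.integral_cong) (auto simp: mult.commute)
  finally show ?thesis by simp
qed

lemma L2_inner_diff_left: "f \<in> L2 M \<Longrightarrow> g \<in> L2 M \<Longrightarrow> h \<in> L2 M \<Longrightarrow>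
    L2_inner M (\<lambda>x. g x - h x) f = L2_inner M g f - L2_inner M h f"
  using L2_inner_diff_right[of f M g h] by (metis L2_inner_commute complex_cnj_diff)

lemma L2_inner_cmult_left: "L2_inner M (\<lambda>x. c * g x) f = cnj c * L2_inner M g f"
  using L2_inner_cmult_right[of M f c g] by (metis L2_inner_commute complex_cnj_mult)

lemma L2_inner_sum_right:
  "f \<in> L2 M \<Longrightarrow> (\<And>i. i \<in> A \<Longrightarrow> g i \<in> L2 M) \<Longrightarrow> L2_inner M f (\<lambda>x. \<Sum>i\<in>A. g i x) = (\<Sum>i\<in>A. L2_inner M f (g i))"
proof (induction A rule: infinite_finite_induct)
  case (insert i A)
  then show ?case using L2_inner_add_right[of f M "g i" "\<lambda>x. \<Sum>i\<in>A. g i x"] L2_sum[of A g M] by simp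
qed (simp_all add: L2_inner_def)

lemma L2_inner_cong_AE:
  assumes "AE x in M. f x = f' x" "AE x in M. g x = g' x"
    "f \<in> borel_measurable M" "f' \<in> borel_measurable M" "g \<in> borel_measurable M" "g' \<in> borel_measurable M"
  shows "L2_inner M f g = L2_inner M f' g'"
proof -
  have c: "(\<lambda>x. cnj (h x)) \<in> borel_measurable M" if "h \<in> borel_measurable M" for h
    using that by (auto intro: borel_measurable_continuous_onI[THEN measurable_compose[rotated]] continuous_intros)
  have "AE x in M. cnj (f x) * g x = cnj (f' x) * g' x" using assms(1,2) by eventually_elim simp
  then show ?thesis unfolding L2_inner_def using assms(3-6) by (intro integral_cong_AE borel_measurable_times c)
qed

lemma L2_norm_nonneg: "0 \<le> L2_norm M f"
  by (simp add: L2_norm_def)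

lemma L2_norm_square: "(L2_norm M f)\<^sup>2 = (\<integral>x. (cmod (f x))\<^sup>2 \<partial>M)"
  unfolding L2_norm_def by simp

lemma L2_inner_self: "L2_inner M f f = complex_of_real ((L2_norm M f)\<^sup>2)"
proof -
  have "L2_inner M f f = (\<integral>x. complex_of_real ((cmod (f x))\<^sup>2) \<partial>M)"
    unfolding L2_inner_def by (intro Bochner_Integration.integral_cong refl) (simp add: complex_norm_square mult.commute del: of_real_power)
  then show ?thesis by (simp add: L2_norm_square del: of_real_power)
qed

lemma L2_norm_eq_0_iff: "f \<in> L2 M \<Longrightarrow> L2_norm M f = 0 \<longleftrightarrow> (AE x in M. f x = 0)"
  unfolding L2_norm_def using integral_nonneg_eq_0_iff_AE[OF L2_integrable, of f M] by simp

lemma L2_norm_cmult: "L2_norm M (\<lambda>x. c * f x) = cmod c * L2_norm M f"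
  unfolding L2_norm_def by (simp add: norm_mult power_mult_distrib real_sqrt_mult)

lemma L2_norm_cong_AE:
  assumes "AE x in M. f x = g x" "f \<in> borel_measurable M" "g \<in> borel_measurable M"
  shows "L2_norm M f = L2_norm M g"
proof -
  have "AE x in M. (cmod (f x))\<^sup>2 = (cmod (g x))\<^sup>2" using assms(1) by eventually_elim simp
  then have "(\<integral>x. (cmod (f x))\<^sup>2 \<partial>M) = (\<integral>x. (cmod (g x))\<^sup>2 \<partial>M)"
    using assms(2,3) by (intro integral_cong_AE) auto
  then show ?thesis by (simp add: L2_norm_def)
qed

lemma L2_norm_diff_square:
  assumes "f \<in> L2 M" "g \<in> L2 M"
  shows "(L2_norm M (\<lambda>x. f x - g x))\<^sup>2 = (L2_norm M f)\<^sup>2 + (L2_norm M g)\<^sup>2 - 2 * Re (L2_inner M g f)"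
proof -
  have d: "(\<lambda>x. f x - g x) \<in> L2 M" using assms by (rule L2_diff)
  have "complex_of_real ((L2_norm M (\<lambda>x. f x - g x))\<^sup>2) = L2_inner M (\<lambda>x. f x - g x) (\<lambda>x. f x - g x)"
    by (rule L2_inner_self[symmetric])
  also have "\<dots> = L2_inner M f f + L2_inner M g g - (L2_inner M g f + cnj (L2_inner M g f))"
    using assms d by (simp add: L2_inner_diff_left L2_inner_diff_right L2_inner_commute[of M f g])
  also have "\<dots> = complex_of_real ((L2_norm M f)\<^sup>2 + (L2_norm M g)\<^sup>2 - 2 * Re (L2_inner M g f))"
    by (simp add: L2_inner_self complex_add_cnj)
  finally show ?thesis by (simp only: of_real_eq_iff)
qed

text \<open>Expands the squared norm of \<open>g - t f\<close> at its minimiser, the Fourier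
  coefficient \<open>t = <f, g> / <f, f>\<close>.\<close>

lemma L2_Cauchy_Schwarz:
  assumes "f \<in> L2 M" "g \<in> L2 M"
  shows "cmod (L2_inner M f g) \<le> L2_norm M f * L2_norm M g"
proof (cases "L2_norm M f = 0")
  case True
  then have "AE x in M. f x = 0" using L2_norm_eq_0_iff assms by auto
  then have "L2_inner M f g = L2_inner M (\<lambda>x. 0) g"
    using assms by (intro L2_inner_cong_AE) (auto intro: L2_measurable L2_cmult)
  then show ?thesis using True by (simp add: L2_inner_def)
next
  case False
  define N where "N = (L2_norm M f)\<^sup>2"
  define t where "t = L2_inner M f g / of_real N"
  have N: "N > 0" using False unfolding N_def by simp
  have "0 \<le> (L2_norm M (\<lambda>x. g x - t * f x))\<^sup>2" by simp
  also have "\<dots> = (L2_norm M g)\<^sup>2 + (cmod t)\<^sup>2 * N - 2 * Re (cnj t * L2_inner M f g)"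
    using L2_norm_diff_square[OF assms(2) L2_cmult[OF assms(1)], of t]
    by (simp add: L2_norm_cmult power_mult_distrib N_def L2_inner_cmult_left)
  also have "cnj t * L2_inner M f g = of_real ((cmod (L2_inner M f g))\<^sup>2 / N)"
    unfolding t_def by (simp add: complex_norm_square mult.commute del: of_real_power)
  also have "(cmod t)\<^sup>2 * N = (cmod (L2_inner M f g))\<^sup>2 / N"
    unfolding t_def using N by (simp add: norm_divide power_divide power2_eq_square)
  finally have "(cmod (L2_inner M f g))\<^sup>2 / N \<le> (L2_norm M g)\<^sup>2" by simp
  then have "(cmod (L2_inner M f g))\<^sup>2 \<le> (L2_norm M f * L2_norm M g)\<^sup>2"
    using N by (simp add: N_def power_mult_distrib divide_le_eq mult.commute)
  then show ?thesis by (rule power2_le_imp_le) (simp add: L2_norm_nonneg)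
qed

lemma L2_norm_triangle:
  assumes "f \<in> L2 M" "g \<in> L2 M"
  shows "L2_norm M (\<lambda>x. f x - g x) \<le> L2_norm M f + L2_norm M g"
proof (rule power2_le_imp_le)
  have "- Re (L2_inner M g f) \<le> L2_norm M g * L2_norm M f"
    using L2_Cauchy_Schwarz[OF assms(2,1)] abs_Re_le_cmod[of "L2_inner M g f"] by linarith
  then show "(L2_norm M (\<lambda>x. f x - g x))\<^sup>2 \<le> (L2_norm M f + L2_norm M g)\<^sup>2"
    unfolding L2_norm_diff_square[OF assms] power2_sum by (simp add: mult.commute[of "L2_norm M g"])
qed (simp add: L2_norm_nonneg)

lemma L2_eq_AE_I:
  assumes "f \<in> L2 M" "g \<in> L2 M" "\<And>h. h \<in> L2 M \<Longrightarrow> L2_inner M f h = L2_inner M g h"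
  shows "AE x in M. f x = g x"
proof -
  have d: "(\<lambda>x. f x - g x) \<in> L2 M" using assms(1,2) by (rule L2_diff)
  have "L2_inner M (\<lambda>x. f x - g x) (\<lambda>x. f x - g x) = 0"
    using assms(3)[OF d] L2_inner_diff_left[OF d assms(1,2)] by simp
  then have "L2_norm M (\<lambda>x. f x - g x) = 0" by (simp add: L2_inner_self)
  then have "AE x in M. f x - g x = 0" using L2_norm_eq_0_iff[OF d] by simp
  then show ?thesis by eventually_elim simp
qed

text \<open>Geometrically small increments are the only case used. They force convergence almost
  everywhere, and Fatou's lemma carries the uniform bound on \<open>s m - s n\<close> over to
  \<open>l - s n\<close>.\<close>

lemma L2_complete:
  assumes s: "\<And>n. s n \<in> L2 M" and d: "\<And>n. L2_norm M (\<lambda>x. s (Suc n) x - s n x) \<le> (1/2) ^ n"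
  obtains l where "l \<in> L2 M" "(\<lambda>n. L2_norm M (\<lambda>x. l x - s n x)) \<longlonglongrightarrow> 0"
proof -
  note [measurable] = L2_measurable[OF s]
  have tail: "L2_norm M (\<lambda>x. s (n + k) x - s n x) \<le> 2 * (1/2) ^ n - 2 * (1/2) ^ (n + k)" for n k
  proof (induction k)
    case 0 show ?case by (simp add: L2_norm_def)
  next
    case (Suc k)
    have "L2_norm M (\<lambda>x. s (n + Suc k) x - s n x) = L2_norm M (\<lambda>x. (s (Suc (n + k)) x - s (n + k) x) - (s n x - s (n + k) x))"
      by simp
    also have "\<dots> \<le> L2_norm M (\<lambda>x. s (Suc (n + k)) x - s (n + k) x) + L2_norm M (\<lambda>x. s n x - s (n + k) x)"
      by (intro L2_norm_triangle L2_diff s)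
    also have "L2_norm M (\<lambda>x. s n x - s (n + k) x) = L2_norm M (\<lambda>x. s (n + k) x - s n x)"
      unfolding L2_norm_def by (simp add: norm_minus_commute)
    also have "L2_norm M (\<lambda>x. s (Suc (n + k)) x - s (n + k) x) \<le> (1/2) ^ (n + k)" by (rule d)
    finally show ?case using Suc by simp
  qed
  define D where "D n x = cmod (s (Suc n) x - s n x)" for n x
  have Dm[measurable]: "D n \<in> borel_measurable M" for n unfolding D_def by measurable
  \<comment> \<open>With the weight \<open>2 ^ n\<close> the integrals are still summable, because
    \<open>2 ^ n * (1/4) ^ n = (1/2) ^ n\<close>. Pointwise finiteness of the weighted series then
    makes \<open>D n x\<close> decay like \<open>(1 / sqrt 2) ^ n\<close>, which is summable in
    turn.\<close>
  have Dint: "(\<integral>\<^sup>+x. ennreal (2 ^ n * (D n x)\<^sup>2) \<partial>M) \<le> ennreal ((1/2) ^ n)" for n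
  proof -
    have int: "integrable M (\<lambda>x. (D n x)\<^sup>2)" unfolding D_def by (intro L2_integrable L2_diff s)
    have "(\<integral>\<^sup>+x. ennreal (2 ^ n * (D n x)\<^sup>2) \<partial>M) = ennreal (\<integral>x. 2 ^ n * (D n x)\<^sup>2 \<partial>M)"
      using int by (intro nn_integral_eq_integral) auto
    also have "(\<integral>x. 2 ^ n * (D n x)\<^sup>2 \<partial>M) = 2 ^ n * (L2_norm M (\<lambda>x. s (Suc n) x - s n x))\<^sup>2"
      by (simp add: L2_norm_square D_def)
    also have "\<dots> \<le> 2 ^ n * ((1/2) ^ n)\<^sup>2" by (intro mult_left_mono power_mono d L2_norm_nonneg) auto
    also have "\<dots> = (1/2) ^ n" by (simp add: power2_eq_square power_divide)
    finally show ?thesis by (simp add: ennreal_leI)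
  qed
  have "(\<integral>\<^sup>+x. (\<Sum>n. ennreal (2 ^ n * (D n x)\<^sup>2)) \<partial>M) = (\<Sum>n. \<integral>\<^sup>+x. ennreal (2 ^ n * (D n x)\<^sup>2) \<partial>M)"
    by (rule nn_integral_suminf) measurable
  also have "\<dots> \<le> (\<Sum>n. ennreal ((1/2) ^ n))" by (intro suminf_le Dint) auto
  also have "\<dots> = ennreal (\<Sum>n. (1/2) ^ n)" by (rule suminf_ennreal2) (auto intro: summable_geometric)
  finally have "(\<integral>\<^sup>+x. (\<Sum>n. ennreal (2 ^ n * (D n x)\<^sup>2)) \<partial>M) \<noteq> \<infinity>" by (auto simp: top_unique)
  then have "AE x in M. (\<Sum>n. ennreal (2 ^ n * (D n x)\<^sup>2)) \<noteq> \<infinity>"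
    by (intro nn_integral_noteq_infinite) measurable
  then have conv: "AE x in M. (\<lambda>n. s n x) \<longlonglongrightarrow> lim (\<lambda>n. s n x)"
  proof eventually_elim
    case (elim x)
    have "summable (\<lambda>n. 2 ^ n * (D n x)\<^sup>2)" using elim by (intro summable_suminf_not_top) auto
    then have "bounded (range (\<lambda>n. 2 ^ n * (D n x)\<^sup>2))"
      using summable_LIMSEQ_zero convergentI convergent_imp_bounded by blast
    then obtain C where "\<And>n. norm (2 ^ n * (D n x)\<^sup>2) \<le> C" unfolding bounded_iff by auto
    then have C: "2 ^ n * (D n x)\<^sup>2 \<le> C" for n by (metis abs_le_D1 real_norm_def)
    have "C \<ge> 0" using order_trans[OF zero_le_power2 C[of 0, simplified]] .
    have Dle: "D n x \<le> sqrt C * (1 / sqrt 2) ^ n" for n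
    proof -
      have "(D n x)\<^sup>2 \<le> C / 2 ^ n" using C[of n] by (simp add: field_simps)
      then have "D n x \<le> sqrt (C / 2 ^ n)" by (rule real_le_rsqrt)
      then show ?thesis by (simp add: real_sqrt_divide real_sqrt_power power_divide)
    qed
    have "summable (\<lambda>n. sqrt C * (1 / sqrt 2) ^ n)" by (intro summable_mult summable_geometric) simp
    then have "summable (\<lambda>n. s (Suc n) x - s n x)"
      by (rule summable_comparison_test'[where N=0]) (use Dle in \<open>simp add: D_def\<close>)
    then have "convergent (\<lambda>n. \<Sum>k<n. s (Suc k) x - s k x)" by (simp add: summable_iff_convergent)
    moreover have "(\<Sum>k<n. s (Suc k) x - s k x) = s n x - s 0 x" for n by (induction n) auto
    ultimately have "convergent (\<lambda>n. s n x - s 0 x)" by simp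
    then have "convergent (\<lambda>n. (s n x - s 0 x) + s 0 x)" by (intro convergent_add convergent_const)
    then show ?case by (simp add: convergent_LIMSEQ_iff)
  qed
  define l where "l x = lim (\<lambda>n. s n x)" for x
  have lm[measurable]: "l \<in> borel_measurable M" unfolding l_def by measurable
  have Fatou: "(\<integral>\<^sup>+x. ennreal ((cmod (l x - s n x))\<^sup>2) \<partial>M) \<le> ennreal ((2 * (1/2) ^ n)\<^sup>2)" for n
  proof -
    have "(\<integral>\<^sup>+x. ennreal ((cmod (l x - s n x))\<^sup>2) \<partial>M) = (\<integral>\<^sup>+x. liminf (\<lambda>m. ennreal ((cmod (s m x - s n x))\<^sup>2)) \<partial>M)"
    proof (rule nn_integral_cong_AE)
      show "AE x in M. ennreal ((cmod (l x - s n x))\<^sup>2) = liminf (\<lambda>m. ennreal ((cmod (s m x - s n x))\<^sup>2))"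
        using conv
      proof eventually_elim
        case (elim x)
        then have "(\<lambda>m. ennreal ((cmod (s m x - s n x))\<^sup>2)) \<longlonglongrightarrow> ennreal ((cmod (l x - s n x))\<^sup>2)"
          unfolding l_def by (intro tendsto_ennrealI tendsto_intros)
        then show ?case by (intro lim_imp_Liminf[symmetric]) auto
      qed
    qed
    also have "\<dots> \<le> liminf (\<lambda>m. \<integral>\<^sup>+x. ennreal ((cmod (s m x - s n x))\<^sup>2) \<partial>M)"
      by (rule nn_integral_liminf) measurable
    also have "\<dots> \<le> liminf (\<lambda>m. ennreal ((2 * (1/2) ^ n)\<^sup>2))"
    proof (rule Liminf_mono)
      show "\<forall>\<^sub>F m in sequentially. (\<integral>\<^sup>+x. ennreal ((cmod (s m x - s n x))\<^sup>2) \<partial>M) \<le> ennreal ((2 * (1/2) ^ n)\<^sup>2)"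
        unfolding eventually_sequentially
      proof (intro exI[of _ n] allI impI)
        fix m assume "n \<le> m"
        then obtain k where k: "m = n + k" using le_Suc_ex by blast
        have "(\<integral>\<^sup>+x. ennreal ((cmod (s m x - s n x))\<^sup>2) \<partial>M) = ennreal ((L2_norm M (\<lambda>x. s m x - s n x))\<^sup>2)"
          unfolding L2_norm_square by (intro nn_integral_eq_integral L2_integrable L2_diff s) auto
        also have "\<dots> \<le> ennreal ((2 * (1/2) ^ n)\<^sup>2)"
        proof (intro ennreal_leI power_mono L2_norm_nonneg)
          have "0 \<le> 2 * (1/2 :: real) ^ (n + k)" by simp
          then show "L2_norm M (\<lambda>x. s m x - s n x) \<le> 2 * (1/2) ^ n" using tail[of n k] unfolding k by linarith
        qed
        finally show "(\<integral>\<^sup>+x. ennreal ((cmod (s m x - s n x))\<^sup>2) \<partial>M) \<le> ennreal ((2 * (1/2) ^ n)\<^sup>2)" .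
      qed
    qed
    also have "\<dots> = ennreal ((2 * (1/2) ^ n)\<^sup>2)" by (simp add: Liminf_const)
    finally show ?thesis .
  qed
  have diff: "(\<lambda>x. l x - s n x) \<in> L2 M" for n
  proof -
    have "integrable M (\<lambda>x. (cmod (l x - s n x))\<^sup>2)"
      unfolding integrable_iff_bounded using le_less_trans[OF Fatou ennreal_less_top] by simp
    then show ?thesis by (simp add: L2_def)
  qed
  have bound: "L2_norm M (\<lambda>x. l x - s n x) \<le> 2 * (1/2) ^ n" for n
  proof (rule power2_le_imp_le)
    have "ennreal ((L2_norm M (\<lambda>x. l x - s n x))\<^sup>2) = (\<integral>\<^sup>+x. ennreal ((cmod (l x - s n x))\<^sup>2) \<partial>M)"
      unfolding L2_norm_square by (intro nn_integral_eq_integral[symmetric] L2_integrable diff) auto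
    then show "(L2_norm M (\<lambda>x. l x - s n x))\<^sup>2 \<le> (2 * (1/2) ^ n)\<^sup>2" using Fatou[of n]
      by (metis ennreal_le_iff zero_le_power2)
  qed simp
  show thesis
  proof (rule that)
    show "l \<in> L2 M" using L2_add[OF diff[of 0] s[of 0]] by simp
    show "(\<lambda>n. L2_norm M (\<lambda>x. l x - s n x)) \<longlonglongrightarrow> 0"
    proof (rule tendsto_sandwich[OF _ _ tendsto_const])
      show "(\<lambda>n. 2 * (1/2) ^ n :: real) \<longlonglongrightarrow> 0"
        by (intro tendsto_mult_right_zero LIMSEQ_power_zero) simp
    qed (auto simp: L2_norm_nonneg bound)
  qed
qed

section \<open>Orthonormal families, bases and Parseval's identity\<close>

definition orthonormal :: "'a measure \<Rightarrow> ('a \<Rightarrow> complex) set \<Rightarrow> bool" where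
  "orthonormal M E \<longleftrightarrow> E \<subseteq> L2 M \<and> (\<forall>e\<in>E. \<forall>e'\<in>E. L2_inner M e e' = (if e = e' then 1 else 0))"

text \<open>Zorn's lemma: a function that is not null and is orthogonal to a maximal orthonormal
  family could be normalised and adjoined. Started from the empty family, this shows that bases
  exist.\<close>

lemma orthonormal_basis_extend:
  assumes "orthonormal M E0"
  obtains E where "E0 \<subseteq> E" "orthonormal_basis M E"
proof -
  let ?A = "{E. E0 \<subseteq> E \<and> orthonormal M E}"
  have "\<exists>E\<in>?A. \<forall>X\<in>?A. E \<subseteq> X \<longrightarrow> X = E"
  proof (rule subset_Zorn_nonempty)
    show "?A \<noteq> {}" using assms by blast
    fix C assume C: "C \<noteq> {}" "subset.chain ?A C"
    have "orthonormal M (\<Union>C)"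
      unfolding orthonormal_def
    proof (intro conjI ballI)
      show "\<Union>C \<subseteq> L2 M" using C(2) unfolding subset.chain_def orthonormal_def by blast
      fix e e' assume "e \<in> \<Union>C" "e' \<in> \<Union>C"
      then obtain X X' where X: "X \<in> C" "X' \<in> C" "e \<in> X" "e' \<in> X'" by blast
      then have "X \<subseteq> X' \<or> X' \<subseteq> X" using C(2) unfolding subset_chain_def by blast
      then obtain Y where "Y \<in> C" "e \<in> Y" "e' \<in> Y" using X by blast
      then show "L2_inner M e e' = (if e = e' then 1 else 0)"
        using C(2) unfolding subset_chain_def orthonormal_def by blast
    qed
    then show "\<Union>C \<in> ?A" using C unfolding subset_chain_def by blast
  qed
  then obtain E where E': "E \<in> ?A" "\<forall>X\<in>?A. E \<subseteq> X \<longrightarrow> X = E" by (rule bexE)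
  then have E: "E0 \<subseteq> E" "orthonormal M E" "\<And>X. E0 \<subseteq> X \<Longrightarrow> orthonormal M X \<Longrightarrow> E \<subseteq> X \<Longrightarrow> X = E" by auto
  have "AE x in M. f x = 0" if f: "f \<in> L2 M" "\<And>e. e \<in> E \<Longrightarrow> L2_inner M e f = 0" for f
  proof (rule ccontr)
    assume "\<not> (AE x in M. f x = 0)"
    then have nz: "L2_norm M f \<noteq> 0" using L2_norm_eq_0_iff[OF f(1)] by blast
    define g where "g x = of_real (1 / L2_norm M f) * f x" for x
    have gL: "g \<in> L2 M" unfolding g_def by (intro L2_cmult f)
    have eg: "L2_inner M e g = 0" if "e \<in> E" for e using f(2)[OF that] unfolding g_def by (simp only: L2_inner_cmult_right mult_zero_right)
    have ge: "L2_inner M g e = 0" if "e \<in> E" for e using eg[OF that] by (subst L2_inner_commute) simp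
    have "L2_norm M g = 1" unfolding g_def L2_norm_cmult using nz L2_norm_nonneg[of M f] by (simp add: norm_divide)
    then have gg: "L2_inner M g g = 1" by (simp add: L2_inner_self)
    have "g \<notin> E" using eg gg by force
    have "orthonormal M (insert g E)"
      using E(2) gL eg ge gg \<open>g \<notin> E\<close> unfolding orthonormal_def by auto
    then have "insert g E = E" using E(1) E(3)[of "insert g E"] by blast
    then show False using \<open>g \<notin> E\<close> by blast
  qed
  then have "orthonormal_basis M E" using E(2) unfolding orthonormal_basis_def orthonormal_def by blast
  then show thesis using that E(1) by blast
qed

lemma L2_norm_orthonormal_sum:
  assumes "orthonormal M E" "F \<subseteq> E" "finite F"
  shows "(L2_norm M (\<lambda>x. \<Sum>e\<in>F. c e * e x))\<^sup>2 = (\<Sum>e\<in>F. (cmod (c e))\<^sup>2)"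
proof -
  have L: "e \<in> L2 M" if "e \<in> F" for e using that assms unfolding orthonormal_def by blast
  let ?s = "\<lambda>x. \<Sum>e\<in>F. c e * e x"
  have sL: "?s \<in> L2 M" by (intro L2_sum L2_cmult L)
  have es: "L2_inner M e ?s = c e" if e: "e \<in> F" for e
  proof -
    have "L2_inner M e ?s = (\<Sum>e'\<in>F. c e' * L2_inner M e e')"
      by (subst L2_inner_sum_right) (auto simp: L2_inner_cmult_right intro: L2_cmult L e)
    also have "\<dots> = (\<Sum>e'\<in>F. if e = e' then c e' else 0)"
    proof (intro sum.cong refl)
      fix e' assume "e' \<in> F"
      then have "L2_inner M e e' = (if e = e' then 1 else 0)" using assms e unfolding orthonormal_def by blast
      then show "c e' * L2_inner M e e' = (if e = e' then c e' else 0)" by simp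
    qed
    finally show ?thesis using e assms(3) by simp
  qed
  have "complex_of_real ((L2_norm M ?s)\<^sup>2) = L2_inner M ?s ?s" by (rule L2_inner_self[symmetric])
  also have "\<dots> = (\<Sum>e\<in>F. c e * L2_inner M ?s e)"
    by (subst L2_inner_sum_right) (auto simp: L2_inner_cmult_right intro: L2_cmult L sL)
  also have "\<dots> = (\<Sum>e\<in>F. c e * cnj (c e))" using es by (intro sum.cong refl) (subst L2_inner_commute, simp)
  also have "\<dots> = complex_of_real (\<Sum>e\<in>F. (cmod (c e))\<^sup>2)" by (simp add: complex_norm_square del: of_real_power)
  finally show ?thesis by (simp only: of_real_eq_iff)
qed

text \<open>For a general measure the basis may be uncountable, so the sum is a limit over finite
  subsets. Finite sets that nearly exhaust the supremum of \<open>S\<close> yield an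
  \<open>L2\<close> limit \<open>l\<close> of partial sums; \<open>v - l\<close> is orthogonal to
  the basis, hence null. Enlarging a finite set only decreases the distance to \<open>v\<close>, so
  this sequence controls all larger sets.\<close>

lemma Parseval:
  assumes E: "orthonormal_basis M E" and u: "u \<in> L2 M" and v: "v \<in> L2 M"
  shows "((\<lambda>e. L2_inner M u e * L2_inner M e v) has_sum L2_inner M u v) E"
proof -
  have on: "orthonormal M E" using E unfolding orthonormal_def orthonormal_basis_def by blast
  have EL: "e \<in> L2 M" if "e \<in> E" for e using that on unfolding orthonormal_def by blast
  define c where "c e = L2_inner M e v" for e
  define P where "P F x = (\<Sum>e\<in>F. c e * e x)" for F and x
  define S where "S F = (\<Sum>e\<in>F. (cmod (c e))\<^sup>2)" for F
  have PL: "P F \<in> L2 M" if "F \<subseteq> E" for F unfolding P_def using that by (intro L2_sum L2_cmult EL) blast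
  have innerP: "L2_inner M f (P F) = (\<Sum>e\<in>F. c e * L2_inner M f e)" if "F \<subseteq> E" "f \<in> L2 M" for F f
    unfolding P_def using that by (subst L2_inner_sum_right) (auto simp: L2_inner_cmult_right intro: L2_cmult EL)
  have dist: "(L2_norm M (\<lambda>x. v x - P F x))\<^sup>2 = (L2_norm M v)\<^sup>2 - S F" if F: "F \<subseteq> E" "finite F" for F
  proof -
    have "L2_inner M v (P F) = (\<Sum>e\<in>F. complex_of_real ((cmod (c e))\<^sup>2))"
      unfolding innerP[OF F(1) v] c_def
      by (intro sum.cong refl) (subst L2_inner_commute[of M v], simp add: complex_norm_square del: of_real_power)
    then have "L2_inner M (P F) v = of_real (S F)" by (subst L2_inner_commute) (simp add: S_def)
    moreover have "(L2_norm M (P F))\<^sup>2 = S F" unfolding P_def S_def by (rule L2_norm_orthonormal_sum[OF on F])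
    ultimately show ?thesis using L2_norm_diff_square[OF v PL[OF F(1)]] by simp
  qed
  have Bessel: "S F \<le> (L2_norm M v)\<^sup>2" if F: "F \<subseteq> E" "finite F" for F
    using dist[OF F] zero_le_power2[of "L2_norm M (\<lambda>x. v x - P F x)"] by linarith
  let ?fin = "{F. F \<subseteq> E \<and> finite F}"
  define T where "T = (SUP F\<in>?fin. S F)"
  have bdd: "bdd_above (S ` ?fin)" using Bessel by (intro bdd_aboveI2) auto
  have ST: "S F \<le> T" if "F \<subseteq> E" "finite F" for F unfolding T_def using that bdd by (intro cSUP_upper) auto
  \<comment> \<open>\<open>(1/4) ^ n\<close> measures squared norms; the increments of the partial
    sums are then at most \<open>(1/2) ^ n\<close>, the rate demanded by
    \<open>L2_complete\<close>.\<close>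
  have "\<exists>F. F \<subseteq> E \<and> finite F \<and> T - (1/4) ^ n < S F" for n
  proof -
    have "T - (1/4) ^ n < (SUP F\<in>?fin. S F)" unfolding T_def by simp
    then show ?thesis using less_cSUP_iff[OF _ bdd] by blast
  qed
  then obtain G where G: "\<And>n. G n \<subseteq> E" "\<And>n. finite (G n)" "\<And>n. T - (1/4) ^ n < S (G n)" by metis
  define F where "F n = (\<Union>k\<le>n. G k)" for n :: nat
  have F: "F n \<subseteq> E" "finite (F n)" for n unfolding F_def using G by auto
  have Smono: "S A \<le> S B" if "A \<subseteq> B" "finite B" for A B unfolding S_def using that by (intro sum_mono2) auto
  have FT: "T - (1/4) ^ n < S (F n)" for n
    using G(3)[of n] Smono[of "G n" "F n"] F(2)[of n] unfolding F_def by (meson UN_upper atMost_iff le_refl less_le_trans)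
  \<comment> \<open>A set that avoids \<open>F n\<close> can carry only the gap left to the supremum
    \<open>T\<close>. Applied to \<open>{e}\<close>, this also bounds a coefficient not yet
    collected.\<close>
  have rest: "S B \<le> (1/4) ^ n" if "B \<subseteq> E" "finite B" "B \<inter> F n = {}" for B n
  proof -
    have "S (B \<union> F n) = S B + S (F n)" unfolding S_def using that F by (intro sum.union_disjoint) auto
    then show ?thesis using ST[of "B \<union> F n"] that F[of n] FT[of n] by auto
  qed
  have half: "((1/2) ^ n)\<^sup>2 = (1/4 :: real) ^ n" for n by (simp add: power2_eq_square flip: power_mult_distrib)
  have "L2_norm M (\<lambda>x. P (F (Suc n)) x - P (F n) x) \<le> (1/2) ^ n" for n
  proof (rule power2_le_imp_le)
    let ?B = "F (Suc n) - F n"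
    have sub: "F n \<subseteq> F (Suc n)" unfolding F_def by (intro UN_mono) auto
    have "(\<lambda>x. P (F (Suc n)) x - P (F n) x) = (\<lambda>x. \<Sum>e\<in>?B. c e * e x)"
      unfolding P_def using F sub by (intro ext) (simp add: sum_diff)
    then have "(L2_norm M (\<lambda>x. P (F (Suc n)) x - P (F n) x))\<^sup>2 = S ?B"
      unfolding S_def using F by (simp add: L2_norm_orthonormal_sum[OF on] Diff_subset subset_trans[OF Diff_subset])
    also have "\<dots> \<le> (1/4) ^ n" using F[of "Suc n"] by (intro rest) auto
    finally show "(L2_norm M (\<lambda>x. P (F (Suc n)) x - P (F n) x))\<^sup>2 \<le> ((1/2) ^ n)\<^sup>2" unfolding half .
  qed simp
  then obtain l where l: "l \<in> L2 M" "(\<lambda>n. L2_norm M (\<lambda>x. l x - P (F n) x)) \<longlonglongrightarrow> 0"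
    using L2_complete[of "\<lambda>n. P (F n)" M] PL[OF F(1)] by blast
  have "L2_inner M e (\<lambda>x. v x - l x) = 0" if e: "e \<in> E" for e
  proof -
    have e1: "L2_norm M e = 1"
    proof -
      have "complex_of_real ((L2_norm M e)\<^sup>2) = 1" using on e L2_inner_self[of M e] unfolding orthonormal_def by auto
      then have "(L2_norm M e)\<^sup>2 = 1" by (simp only: of_real_eq_1_iff)
      then show ?thesis using L2_norm_nonneg[of M e] by (simp add: power2_eq_1_iff)
    qed
    have bd: "cmod (L2_inner M e (\<lambda>x. v x - P (F n) x)) \<le> (1/2) ^ n" for n
    proof -
      have "L2_inner M e (P (F n)) = (\<Sum>e'\<in>F n. if e = e' then c e' else 0)"
        unfolding innerP[OF F(1) EL[OF e]]
      proof (intro sum.cong refl)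
        fix e' assume "e' \<in> F n"
        then have "L2_inner M e e' = (if e = e' then 1 else 0)" using F(1)[of n] e on unfolding orthonormal_def by blast
        then show "c e' * L2_inner M e e' = (if e = e' then c e' else 0)" by simp
      qed
      then have *: "L2_inner M e (P (F n)) = (if e \<in> F n then c e else 0)" using F(2)[of n] by simp
      have "L2_inner M e (\<lambda>x. v x - P (F n) x) = c e - L2_inner M e (P (F n))"
        unfolding c_def by (rule L2_inner_diff_right[OF EL[OF e] v PL[OF F(1)]])
      then have **: "L2_inner M e (\<lambda>x. v x - P (F n) x) = (if e \<in> F n then 0 else c e)" using * by simp
      show ?thesis
      proof (cases "e \<in> F n")
        case False
        have "(cmod (c e))\<^sup>2 \<le> (1/4) ^ n" using rest[of "{e}" n] False e unfolding S_def by auto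
        then have "cmod (c e) \<le> (1/2) ^ n" unfolding half[symmetric] by (rule power2_le_imp_le) simp
        then show ?thesis using ** False by simp
      qed (simp add: **)
    qed
    have "cmod (L2_inner M e (\<lambda>x. v x - l x)) \<le> (1/2) ^ n + L2_norm M (\<lambda>x. l x - P (F n) x)" for n
    proof -
      have "L2_inner M e (\<lambda>x. v x - l x) = L2_inner M e (\<lambda>x. (v x - P (F n) x) - (l x - P (F n) x))" by simp
      also have "\<dots> = L2_inner M e (\<lambda>x. v x - P (F n) x) - L2_inner M e (\<lambda>x. l x - P (F n) x)"
        by (intro L2_inner_diff_right L2_diff EL e v l(1) PL F)
      also have "cmod \<dots> \<le> cmod (L2_inner M e (\<lambda>x. v x - P (F n) x)) + cmod (L2_inner M e (\<lambda>x. l x - P (F n) x))"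
        by (rule norm_triangle_ineq4)
      also have "\<dots> \<le> (1/2) ^ n + L2_norm M (\<lambda>x. l x - P (F n) x)"
        using bd L2_Cauchy_Schwarz[OF EL[OF e] L2_diff[OF l(1) PL[OF F(1)]], of n] e1 by (intro add_mono) auto
      finally show ?thesis .
    qed
    moreover have "(\<lambda>n. (1/2) ^ n + L2_norm M (\<lambda>x. l x - P (F n) x)) \<longlonglongrightarrow> 0 + 0"
      by (intro tendsto_add l(2) LIMSEQ_power_zero) simp
    ultimately have "cmod (L2_inner M e (\<lambda>x. v x - l x)) \<le> 0"
      by (intro LIMSEQ_le_const[where X = "\<lambda>n. (1/2) ^ n + L2_norm M (\<lambda>x. l x - P (F n) x)"]) auto
    then show ?thesis by simp
  qed
  then have "AE x in M. v x - l x = 0"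
    using E L2_diff[OF v l(1)] unfolding orthonormal_basis_def by blast
  then have vl: "L2_norm M (\<lambda>x. v x - P (F n) x) = L2_norm M (\<lambda>x. l x - P (F n) x)" for n
    using L2_measurable[OF v] L2_measurable[OF l(1)] L2_measurable[OF PL[OF F(1)], of n]
    by (intro L2_norm_cong_AE) auto
  show ?thesis
    unfolding has_sum_def tendsto_iff
  proof (intro allI impI)
    fix \<epsilon> :: real assume e: "\<epsilon> > 0"
    define \<eta> where "\<eta> = \<epsilon> / (L2_norm M u + 1)"
    have N: "L2_norm M u + 1 > 0" using L2_norm_nonneg[of M u] by simp
    have "\<eta> > 0" unfolding \<eta>_def using e N by simp
    then have "eventually (\<lambda>n. dist (L2_norm M (\<lambda>x. l x - P (F n) x)) 0 < \<eta>) sequentially" using l(2) by (simp add: tendsto_iff)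
    then obtain n where "dist (L2_norm M (\<lambda>x. l x - P (F n) x)) 0 < \<eta>" by (meson eventually_sequentially order_refl)
    then have n: "L2_norm M (\<lambda>x. v x - P (F n) x) < \<eta>" using vl L2_norm_nonneg by (simp add: dist_real_def)
    show "\<forall>\<^sub>F A in finite_subsets_at_top E. dist (\<Sum>e\<in>A. L2_inner M u e * L2_inner M e v) (L2_inner M u v) < \<epsilon>"
      unfolding eventually_finite_subsets_at_top
    proof (intro exI[of _ "F n"] conjI F allI impI)
      fix A assume A: "finite A \<and> F n \<subseteq> A \<and> A \<subseteq> E"
      have "(L2_norm M (\<lambda>x. v x - P A x))\<^sup>2 \<le> (L2_norm M (\<lambda>x. v x - P (F n) x))\<^sup>2"
        using dist[of A] dist[OF F] Smono[of "F n" A] A by auto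
      then have "L2_norm M (\<lambda>x. v x - P A x) \<le> L2_norm M (\<lambda>x. v x - P (F n) x)"
        by (rule power2_le_imp_le) (rule L2_norm_nonneg)
      then have le: "L2_norm M (\<lambda>x. v x - P A x) < \<eta>" using n by simp
      have "(\<Sum>e\<in>A. L2_inner M u e * L2_inner M e v) = L2_inner M u (P A)"
        using A u by (subst innerP) (auto simp: c_def mult.commute)
      then have "dist (\<Sum>e\<in>A. L2_inner M u e * L2_inner M e v) (L2_inner M u v) = cmod (L2_inner M u (\<lambda>x. v x - P A x))"
        using L2_inner_diff_right[OF u v PL[of A]] A by (simp add: dist_norm norm_minus_commute)
      also have "\<dots> \<le> L2_norm M u * L2_norm M (\<lambda>x. v x - P A x)" using A by (intro L2_Cauchy_Schwarz L2_diff u v PL) auto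
      also have "\<dots> \<le> L2_norm M u * \<eta>" using le by (intro mult_left_mono L2_norm_nonneg) auto
      also have "\<dots> < (L2_norm M u + 1) * \<eta>" using \<open>\<eta> > 0\<close> by (simp add: algebra_simps)
      also have "\<dots> = \<epsilon>" unfolding \<eta>_def using N by simp
      finally show "dist (\<Sum>e\<in>A. L2_inner M u e * L2_inner M e v) (L2_inner M u v) < \<epsilon>" .
    qed
  qed
qed


section \<open>Rank one operators\<close>

lemma rank_one_op_iff:
  "(f, g) \<in> rank_one_op M c u v \<longleftrightarrow> f \<in> L2 M \<and> g \<in> L2 M \<and> (AE x in M. g x = c * L2_inner M u f * v x)"
  by (simp add: rank_one_op_def)

lemma rank_one_op_bounded:
  assumes u: "u \<in> L2 M" and v: "v \<in> L2 M"
  shows "bounded_operator M (rank_one_op M c u v)"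
  unfolding bounded_operator_def linear_operator_def
proof (intro conjI allI impI)
  show "rank_one_op M c u v \<subseteq> L2 M \<times> L2 M" by (auto simp: rank_one_op_def)
  show "(\<lambda>_. 0, \<lambda>_. 0) \<in> rank_one_op M c u v" by (simp add: rank_one_op_iff L2_zero L2_inner_def)
  show "(\<lambda>x. k * f x + f' x, \<lambda>x. k * g x + g' x) \<in> rank_one_op M c u v"
    if fg: "(f, g) \<in> rank_one_op M c u v" "(f', g') \<in> rank_one_op M c u v" for f g f' g' k
  proof -
    have L: "f \<in> L2 M" "f' \<in> L2 M" "g \<in> L2 M" "g' \<in> L2 M" using fg by (auto simp: rank_one_op_iff)
    have i: "L2_inner M u (\<lambda>x. k * f x + f' x) = k * L2_inner M u f + L2_inner M u f'"
      using L2_inner_add_right[OF u L2_cmult[OF L(1)] L(2)] by (simp add: L2_inner_cmult_right)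
    have "AE x in M. g x = c * L2_inner M u f * v x" "AE x in M. g' x = c * L2_inner M u f' * v x"
      using fg by (auto simp: rank_one_op_iff)
    then have "AE x in M. k * g x + g' x = c * L2_inner M u (\<lambda>x. k * f x + f' x) * v x"
      by eventually_elim (simp only: i, simp add: algebra_simps)
    then show ?thesis using L by (simp add: rank_one_op_iff L2_add L2_cmult)
  qed
  show "(f', g') \<in> rank_one_op M c u v"
    if "(f, g) \<in> rank_one_op M c u v" "f' \<in> L2 M" "g' \<in> L2 M" "AE x in M. f' x = f x" "AE x in M. g' x = g x" for f g f' g'
  proof -
    have "L2_inner M u f = L2_inner M u f'"
      using that u by (intro L2_inner_cong_AE) (auto simp: rank_one_op_iff intro: L2_measurable L2_cmult)
    moreover have "AE x in M. g x = c * L2_inner M u f * v x" using that(1) by (simp add: rank_one_op_iff)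
    with that(5) have "AE x in M. g' x = c * L2_inner M u f * v x" by eventually_elim simp
    ultimately show ?thesis using that by (simp add: rank_one_op_iff)
  qed
  show "AE x in M. g x = g' x" if "(f, g) \<in> rank_one_op M c u v" "(f, g') \<in> rank_one_op M c u v" for f g g'
  proof -
    have "AE x in M. g x = c * L2_inner M u f * v x" "AE x in M. g' x = c * L2_inner M u f * v x"
      using that by (auto simp: rank_one_op_iff)
    then show ?thesis by eventually_elim simp
  qed
  have "(f, \<lambda>x. c * L2_inner M u f * v x) \<in> rank_one_op M c u v" if "f \<in> L2 M" for f
    using that v by (simp add: rank_one_op_iff L2_cmult)
  then show "Domain (rank_one_op M c u v) = L2 M" by (auto simp: rank_one_op_def)
  show "\<exists>C. \<forall>(f, g)\<in>rank_one_op M c u v. L2_norm M g \<le> C * L2_norm M f"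
  proof (intro exI[of _ "cmod c * L2_norm M u * L2_norm M v"] ballI, clarify)
    fix f g assume "(f, g) \<in> rank_one_op M c u v"
    then have fg: "f \<in> L2 M" "g \<in> L2 M" "AE x in M. g x = c * L2_inner M u f * v x" by (auto simp: rank_one_op_iff)
    have "L2_norm M g = L2_norm M (\<lambda>x. c * L2_inner M u f * v x)"
      using fg v by (intro L2_norm_cong_AE) (auto intro: L2_measurable L2_cmult)
    also have "\<dots> = cmod c * cmod (L2_inner M u f) * L2_norm M v" by (simp add: L2_norm_cmult norm_mult)
    also have "\<dots> \<le> cmod c * (L2_norm M u * L2_norm M f) * L2_norm M v"
      by (intro mult_right_mono mult_left_mono L2_Cauchy_Schwarz u fg L2_norm_nonneg) auto
    finally show "L2_norm M g \<le> cmod c * L2_norm M u * L2_norm M v * L2_norm M f" by (simp add: mult_ac)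
  qed
qed

lemma rank_one_op_quadratic_form:
  assumes u: "u \<in> L2 M" and v: "v \<in> L2 M" and f: "f \<in> L2 M"
  shows "quadratic_form M (rank_one_op M c u v) f = c * (L2_inner M u f * L2_inner M f v)"
proof -
  let ?g = "SOME g. (f, g) \<in> rank_one_op M c u v"
  have "(f, \<lambda>x. c * L2_inner M u f * v x) \<in> rank_one_op M c u v" using f v by (simp add: rank_one_op_iff L2_cmult)
  then have "(f, ?g) \<in> rank_one_op M c u v" by (rule someI[where P = "\<lambda>g. (f, g) \<in> rank_one_op M c u v"])
  then have g: "?g \<in> L2 M" "AE x in M. ?g x = c * L2_inner M u f * v x" by (auto simp: rank_one_op_iff)
  have "L2_inner M f ?g = L2_inner M f (\<lambda>x. c * L2_inner M u f * v x)"
    using f g v by (intro L2_inner_cong_AE) (auto intro: L2_measurable L2_cmult)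
  then show ?thesis unfolding quadratic_form_def by (simp add: L2_inner_cmult_right)
qed

lemma rank_one_op_adjoint:
  assumes u: "u \<in> L2 M" and v: "v \<in> L2 M"
  shows "adjoint_op M (rank_one_op M c u v) = rank_one_op M (cnj c) v u"
proof (intro set_eqI)
  fix fg :: "('a \<Rightarrow> complex) \<times> ('a \<Rightarrow> complex)"
  obtain f g where fg: "fg = (f, g)" by (cases fg)
  have key: "L2_inner M f t = L2_inner M (\<lambda>x. cnj c * L2_inner M v f * u x) s"
    if "f \<in> L2 M" "(s, t) \<in> rank_one_op M c u v" for s t
  proof -
    have st: "s \<in> L2 M" "t \<in> L2 M" "AE x in M. t x = c * L2_inner M u s * v x" using that by (auto simp: rank_one_op_iff)
    have "L2_inner M f t = L2_inner M f (\<lambda>x. c * L2_inner M u s * v x)"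
      using that st v by (intro L2_inner_cong_AE) (auto intro: L2_measurable L2_cmult)
    also have "\<dots> = c * L2_inner M u s * L2_inner M f v" by (rule L2_inner_cmult_right)
    also have "\<dots> = L2_inner M (\<lambda>x. cnj c * L2_inner M v f * u x) s"
      by (simp only: L2_inner_cmult_left complex_cnj_mult complex_cnj_cnj L2_inner_commute[of M v f]) (simp add: mult_ac)
    finally show ?thesis .
  qed
  show "fg \<in> adjoint_op M (rank_one_op M c u v) \<longleftrightarrow> fg \<in> rank_one_op M (cnj c) v u"
  proof
    assume "fg \<in> adjoint_op M (rank_one_op M c u v)"
    then have L: "f \<in> L2 M" "g \<in> L2 M" and adj: "\<And>s t. (s, t) \<in> rank_one_op M c u v \<Longrightarrow> L2_inner M f t = L2_inner M g s"
      unfolding adjoint_op_def fg by auto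
    have "AE x in M. g x = cnj c * L2_inner M v f * u x"
    proof (rule L2_eq_AE_I[OF L(2)])
      show "(\<lambda>x. cnj c * L2_inner M v f * u x) \<in> L2 M" by (rule L2_cmult[OF u])
      fix h assume h: "h \<in> L2 M"
      have "(h, \<lambda>x. c * L2_inner M u h * v x) \<in> rank_one_op M c u v" using h v by (simp add: rank_one_op_iff L2_cmult)
      then show "L2_inner M g h = L2_inner M (\<lambda>x. cnj c * L2_inner M v f * u x) h" using adj key[OF L(1)] by metis
    qed
    then show "fg \<in> rank_one_op M (cnj c) v u" using L by (simp add: fg rank_one_op_iff)
  next
    assume "fg \<in> rank_one_op M (cnj c) v u"
    then have L: "f \<in> L2 M" "g \<in> L2 M" "AE x in M. g x = cnj c * L2_inner M v f * u x" by (auto simp: fg rank_one_op_iff)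
    have "L2_inner M f t = L2_inner M g s" if "(s, t) \<in> rank_one_op M c u v" for s t
    proof -
      have "L2_inner M g s = L2_inner M (\<lambda>x. cnj c * L2_inner M v f * u x) s"
        using that L u by (intro L2_inner_cong_AE) (auto simp: rank_one_op_iff intro: L2_measurable L2_cmult)
      then show ?thesis using key[OF L(1) that] by simp
    qed
    then show "fg \<in> adjoint_op M (rank_one_op M c u v)" using L unfolding adjoint_op_def fg by auto
  qed
qed

text \<open>The left operand of \<open>O\<close> acts first, so its vector \<open>v\<close> is fed
  into the functional \<open>u'\<close> of the right one.\<close>

lemma rank_one_op_comp:
  assumes v: "v \<in> L2 M" and u': "u' \<in> L2 M" and v': "v' \<in> L2 M"
  shows "rank_one_op M c u v O rank_one_op M c' u' v' = rank_one_op M (c * c' * L2_inner M u' v) u v'"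
proof (intro set_eqI)
  fix fh :: "('a \<Rightarrow> complex) \<times> ('a \<Rightarrow> complex)"
  obtain f h where fh: "fh = (f, h)" by (cases fh)
  have eq: "c' * L2_inner M u' g = c * c' * L2_inner M u' v * L2_inner M u f" if "(f, g) \<in> rank_one_op M c u v" for g
  proof -
    have "L2_inner M u' g = L2_inner M u' (\<lambda>x. c * L2_inner M u f * v x)"
      using that u' v by (intro L2_inner_cong_AE) (auto simp: rank_one_op_iff intro: L2_measurable L2_cmult)
    then show ?thesis by (simp add: L2_inner_cmult_right)
  qed
  show "fh \<in> rank_one_op M c u v O rank_one_op M c' u' v' \<longleftrightarrow> fh \<in> rank_one_op M (c * c' * L2_inner M u' v) u v'"
  proof
    assume "fh \<in> rank_one_op M c u v O rank_one_op M c' u' v'"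
    then obtain g where g: "(f, g) \<in> rank_one_op M c u v" "(g, h) \<in> rank_one_op M c' u' v'" unfolding fh by auto
    then show "fh \<in> rank_one_op M (c * c' * L2_inner M u' v) u v'"
      using eq[OF g(1)] unfolding fh rank_one_op_iff by auto
  next
    assume *: "fh \<in> rank_one_op M (c * c' * L2_inner M u' v) u v'"
    define g where "g x = c * L2_inner M u f * v x" for x
    have g: "(f, g) \<in> rank_one_op M c u v" using * v unfolding fh rank_one_op_iff g_def by (auto intro: L2_cmult)
    moreover have "(g, h) \<in> rank_one_op M c' u' v'" using * g eq[OF g] unfolding fh rank_one_op_iff by auto
    ultimately show "fh \<in> rank_one_op M c u v O rank_one_op M c' u' v'" unfolding fh by auto
  qed
qed

text \<open>For null \<open>u\<close> the functional vanishes and every scalar gives the same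
  operator. This absorbs the degenerate case in the computation of the absolute value.\<close>

lemma rank_one_op_cong_scalar:
  assumes "c * L2_norm M u = c' * L2_norm M u" "u \<in> L2 M"
  shows "rank_one_op M c u v = rank_one_op M c' u v"
proof (cases "L2_norm M u = 0")
  case True
  then have "AE x in M. u x = 0" using L2_norm_eq_0_iff[OF assms(2)] by simp
  then have "L2_inner M u f = 0" if "f \<in> L2 M" for f
    using L2_inner_cong_AE[where M=M and f=u and f'="\<lambda>x. 0" and g=f and g'=f] assms(2) that by (auto simp: L2_inner_def intro: L2_measurable L2_cmult)
  then show ?thesis unfolding rank_one_op_def by auto
next
  case False
  then show ?thesis using assms by simp
qed

text \<open>The adjoint applied after the operator gives \<open>|c|^2 |v|^2 <u, .> u\<close>. Its
  positive square root is again of rank one, \<open>\<beta> <u, .> u\<close>, and the diagonal sum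
  of the latter converges by Parseval.\<close>

lemma rank_one_op_trace_class:
  assumes u: "u \<in> L2 M" and v: "v \<in> L2 M"
  shows "trace_class M (rank_one_op M c u v)"
proof -
  \<comment> \<open>The square of \<open>\<beta> <u, .> u\<close> has the factor
    \<open>\<beta>^2 |u|^2\<close>, which has to be \<open>|c|^2 |v|^2\<close>. For null
    \<open>u\<close> division by zero yields \<beta> = 0, and all operators involved are
    zero.\<close>
  define \<beta> where "\<beta> = cmod c * L2_norm M v / L2_norm M u"
  let ?B = "rank_one_op M (complex_of_real \<beta>) u u"
  have b: "\<beta> \<ge> 0" unfolding \<beta>_def by (simp add: L2_norm_nonneg)
  have qf: "quadratic_form M ?B f = of_real (\<beta> * (cmod (L2_inner M u f))\<^sup>2)" if "f \<in> L2 M" for f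
    unfolding rank_one_op_quadratic_form[OF u u that] L2_inner_commute[of M f u]
    by (simp add: complex_norm_square del: of_real_power)
  have "is_absolute_value M (rank_one_op M c u v) ?B"
    unfolding is_absolute_value_def
  proof (intro conjI ballI)
    show "bounded_operator M ?B" by (rule rank_one_op_bounded[OF u u])
    fix f assume f: "f \<in> L2 M"
    show "Im (quadratic_form M ?B f) = 0" unfolding qf[OF f] by simp
    show "0 \<le> Re (quadratic_form M ?B f)" unfolding qf[OF f] using b by simp
  next
    have "?B O ?B = rank_one_op M (of_real (\<beta> * \<beta> * (L2_norm M u)\<^sup>2)) u u"
      unfolding rank_one_op_comp[OF u u u] by (simp add: L2_inner_self)
    also have "\<dots> = rank_one_op M (of_real ((cmod c)\<^sup>2 * (L2_norm M v)\<^sup>2)) u u"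
      by (rule rank_one_op_cong_scalar[OF _ u]) (simp add: \<beta>_def power2_eq_square)
    also have "\<dots> = rank_one_op M c u v O adjoint_op M (rank_one_op M c u v)"
      unfolding rank_one_op_adjoint[OF u v] rank_one_op_comp[OF v v u]
      by (simp only: of_real_mult complex_norm_square L2_inner_self)
    finally show "?B O ?B = rank_one_op M c u v O adjoint_op M (rank_one_op M c u v)" .
  qed
  moreover obtain E where E: "orthonormal_basis M E"
    using orthonormal_basis_extend[of M "{}"] by (auto simp: orthonormal_def)
  moreover have "(\<lambda>e. quadratic_form M ?B e) summable_on E"
  proof -
    have "((\<lambda>e. of_real \<beta> * (L2_inner M u e * L2_inner M e u)) has_sum (of_real \<beta> * L2_inner M u u)) E"
      by (rule has_sum_cmult_right[OF Parseval[OF E u u]])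
    moreover have "quadratic_form M ?B e = of_real \<beta> * (L2_inner M u e * L2_inner M e u)" if "e \<in> E" for e
      using that E by (intro rank_one_op_quadratic_form u) (auto simp: orthonormal_basis_def)
    ultimately have "((\<lambda>e. quadratic_form M ?B e) has_sum (of_real \<beta> * L2_inner M u u)) E"
      by (subst has_sum_cong) auto
    then show ?thesis by (rule has_sum_imp_summable)
  qed
  ultimately show ?thesis unfolding trace_class_def using rank_one_op_bounded[OF u v] by blast
qed

text \<open>Parseval gives the same sum for every basis; that the described number is unique depends
  on the existence of at least one basis.\<close>

lemma rank_one_op_trace:
  assumes u: "u \<in> L2 M" and v: "v \<in> L2 M"
  shows "op_trace M (rank_one_op M c u v) = c * L2_inner M u v"
  unfolding op_trace_def
proof (rule the_equality)
  have *: "((\<lambda>e. quadratic_form M (rank_one_op M c u v) e) has_sum (c * L2_inner M u v)) E" if E: "orthonormal_basis M E" for E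
  proof -
    have "((\<lambda>e. c * (L2_inner M u e * L2_inner M e v)) has_sum (c * L2_inner M u v)) E"
      by (rule has_sum_cmult_right[OF Parseval[OF E u v]])
    moreover have "quadratic_form M (rank_one_op M c u v) e = c * (L2_inner M u e * L2_inner M e v)" if "e \<in> E" for e
      using that E by (intro rank_one_op_quadratic_form u v) (auto simp: orthonormal_basis_def)
    ultimately show ?thesis by (subst has_sum_cong) auto
  qed
  then show "\<forall>E. orthonormal_basis M E \<longrightarrow> ((\<lambda>e. quadratic_form M (rank_one_op M c u v) e) has_sum (c * L2_inner M u v)) E" by blast
  fix t assume t: "\<forall>E. orthonormal_basis M E \<longrightarrow> ((\<lambda>e. quadratic_form M (rank_one_op M c u v) e) has_sum t) E"
  obtain E where E: "orthonormal_basis M E"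
    using orthonormal_basis_extend[of M "{}"] by (auto simp: orthonormal_def)
  then show "t = c * L2_inner M u v" using t * has_sum_unique by blast
qed

section \<open>Sturm--Liouville expressions\<close>

lemma borel_measurable_lebesgue_on_cong_AE:
  fixes f g :: "'a::euclidean_space \<Rightarrow> 'b::euclidean_space"
  assumes f: "f \<in> borel_measurable (lebesgue_on S)" and S: "S \<in> sets lebesgue"
    and ae: "AE x in lebesgue_on S. f x = g x"
  shows "g \<in> borel_measurable (lebesgue_on S)"
proof -
  have "(\<lambda>x. if x \<in> S then f x else 0) \<in> borel_measurable lebesgue"
    using f S by (simp add: borel_measurable_if)
  moreover have "AE x in lebesgue. (if x \<in> S then f x else 0) = (if x \<in> S then g x else 0)"
    using ae S by (simp add: AE_restrict_space_iff)
  ultimately have "(\<lambda>x. if x \<in> S then g x else 0) \<in> borel_measurable lebesgue"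
    by (rule borel_measurable_AE)
  then show ?thesis using S by (simp add: borel_measurable_if)
qed

text \<open>The set where the functions differ is open and negligible, hence empty. This is the
  passage from almost everywhere to pointwise equality.\<close>

lemma continuous_on_AE_eq:
  fixes f g :: "real \<Rightarrow> 'b::euclidean_space"
  assumes "continuous_on S f" "continuous_on S g" "open S" "AE x in lebesgue_on S. f x = g x" "x \<in> S"
  shows "f x = g x"
proof (rule ccontr)
  assume ne: "f x \<noteq> g x"
  have "open (S \<inter> (\<lambda>x. f x - g x) -` (- {0}))"
    using assms(1-3) by (intro continuous_open_preimage continuous_on_diff) auto
  moreover have "S \<inter> (\<lambda>x. f x - g x) -` (- {0}) = {x\<in>S. f x \<noteq> g x}" by auto
  moreover have "negligible {x\<in>S. f x \<noteq> g x}"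
    using assms(3,4) by (subst (asm) AE_lebesgue_on_iff_negligible) auto
  ultimately have "{x\<in>S. f x \<noteq> g x} = {}" using open_not_negligible by metis
  then show False using ne assms(5) by auto
qed

lemma tendsto_integral_exhaustion:
  fixes F :: "real \<Rightarrow> 'a::euclidean_space"
  assumes F: "F absolutely_integrable_on S" and A: "\<And>n. A n \<in> sets lebesgue" "\<And>n. A n \<subseteq> S"
    and ev: "\<And>x. x \<in> S \<Longrightarrow> eventually (\<lambda>n. x \<in> A n) sequentially"
  shows "(\<lambda>n::nat. integral (A n) F) \<longlonglongrightarrow> integral S F"
proof -
  let ?f = "\<lambda>n x. if x \<in> A n then F x else 0"
  have sub: "A n \<inter> S = A n" for n using A(2)[of n] by blast
  have "F integrable_on A n" for n
    using set_integrable_subset[OF F A(1) A(2)] set_lebesgue_integral_eq_integral(1) by blast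
  then have i: "?f n integrable_on S" for n by (simp only: integrable_restrict_Int sub)
  have "(\<lambda>n. integral S (?f n)) \<longlonglongrightarrow> integral S F"
  proof (rule dominated_convergence(2)[OF i])
    show "(\<lambda>x. norm (F x)) integrable_on S" using F absolutely_integrable_on_def by blast
    show "norm (?f n x) \<le> norm (F x)" for n x by simp
    fix x assume "x \<in> S"
    then have "eventually (\<lambda>n. ?f n x = F x) sequentially" by (intro eventually_mono[OF ev[of x]]) auto
    then show "(\<lambda>n. ?f n x) \<longlonglongrightarrow> F x" by (rule tendsto_eventually)
  qed
  then show ?thesis by (simp only: integral_restrict_Int sub)
qed

lemma at_right_ereal_neq_bot: "a < b \<Longrightarrow> at_right (a::ereal) \<noteq> bot"
  using dense by (auto simp: trivial_limit_def eventually_at_right)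

text \<open>The endpoints may be infinite, so the limits are taken in \<open>ereal\<close> and
  tested on monotone sequences, along which compact intervals exhaust each half of the
  domain.\<close>

lemma primitive_limits:
  assumes W: "primitive a b W F" and F: "F absolutely_integrable_on (einterval a b)" and ab: "a < b"
  obtains La Lb where "((W \<circ> real_of_ereal) \<longlongrightarrow> La) (at_right a)" "((W \<circ> real_of_ereal) \<longlongrightarrow> Lb) (at_left b)"
    "integral (einterval a b) F = Lb - La"
proof -
  let ?J = "einterval a b"
  obtain c where c: "c \<in> ?J" using einterval_nonempty[OF ab] by blast
  have Fs: "F absolutely_integrable_on (?J \<inter> {..c})" "F absolutely_integrable_on (?J \<inter> {c..})"
    by (rule set_integrable_subset[OF F]; simp)+
  have R: "((W \<circ> real_of_ereal) \<longlongrightarrow> W c - integral (?J \<inter> {..c}) F) (at_right a)"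
  proof (rule tendsto_at_right_sequentially)
    show "a < ereal c" using c by (simp add: einterval_iff)
    fix S assume S: "\<And>n. a < S n" "\<And>n. S n < ereal c" "decseq S" "S \<longlonglongrightarrow> a"
    define s where "s n = real_of_ereal (S n)" for n
    have Ss: "S n = ereal (s n)" for n
      using S(1,2)[of n] unfolding s_def by (cases "S n") auto
    have sJ: "s n \<in> ?J" "s n < c" for n
      using S(1,2)[of n] c less_trans[of "ereal (s n)" "ereal c" b] unfolding Ss einterval_iff by auto
    have "(\<lambda>n. integral {s n..c} F) \<longlonglongrightarrow> integral (?J \<inter> {..c}) F"
    proof (rule tendsto_integral_exhaustion[OF Fs(1)])
      show "{s n..c} \<subseteq> ?J \<inter> {..c}" for n using einterval_Icc_subset[OF sJ(1) c] by auto
      fix x assume x: "x \<in> ?J \<inter> {..c}"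
      then have "a < ereal x" by (simp add: einterval_iff)
      then have "eventually (\<lambda>n. S n < ereal x) sequentially" using S(4) by (rule order_tendstoD(2)[rotated])
      then show "eventually (\<lambda>n. x \<in> {s n..c}) sequentially" by eventually_elim (use x in \<open>auto simp: Ss\<close>)
    qed simp
    moreover have "integral {s n..c} F = W c - W (s n)" for n using primitiveD[OF W sJ(1) c] sJ(2)[of n] by simp
    ultimately have "(\<lambda>n. W c - (W c - W (s n))) \<longlonglongrightarrow> W c - integral (?J \<inter> {..c}) F"
      by (intro tendsto_diff tendsto_const) simp
    then show "(\<lambda>n. (W \<circ> real_of_ereal) (S n)) \<longlonglongrightarrow> W c - integral (?J \<inter> {..c}) F" by (simp add: s_def)
  qed
  have L: "((W \<circ> real_of_ereal) \<longlongrightarrow> W c + integral (?J \<inter> {c..}) F) (at_left b)"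
  proof (rule tendsto_at_left_sequentially)
    show "ereal c < b" using c by (simp add: einterval_iff)
    fix S assume S: "\<And>n. S n < b" "\<And>n. ereal c < S n" "incseq S" "S \<longlonglongrightarrow> b"
    define s where "s n = real_of_ereal (S n)" for n
    have Ss: "S n = ereal (s n)" for n
      using S(1,2)[of n] unfolding s_def by (cases "S n") auto
    have sJ: "s n \<in> ?J" "c < s n" for n
      using S(1,2)[of n] c less_trans[of a "ereal c" "ereal (s n)"] unfolding Ss einterval_iff by auto
    have "(\<lambda>n. integral {c..s n} F) \<longlonglongrightarrow> integral (?J \<inter> {c..}) F"
    proof (rule tendsto_integral_exhaustion[OF Fs(2)])
      show "{c..s n} \<subseteq> ?J \<inter> {c..}" for n using einterval_Icc_subset[OF c sJ(1)] by auto
      fix x assume x: "x \<in> ?J \<inter> {c..}"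
      then have "ereal x < b" by (simp add: einterval_iff)
      then have "eventually (\<lambda>n. ereal x < S n) sequentially" using S(4) by (rule order_tendstoD(1)[rotated])
      then show "eventually (\<lambda>n. x \<in> {c..s n}) sequentially" by eventually_elim (use x in \<open>auto simp: Ss\<close>)
    qed simp
    moreover have "integral {c..s n} F = W (s n) - W c" for n using primitiveD[OF W c sJ(1)] sJ(2)[of n] by simp
    ultimately have "(\<lambda>n. W c + (W (s n) - W c)) \<longlonglongrightarrow> W c + integral (?J \<inter> {c..}) F"
      by (intro tendsto_add tendsto_const) simp
    then show "(\<lambda>n. (W \<circ> real_of_ereal) (S n)) \<longlonglongrightarrow> W c + integral (?J \<inter> {c..}) F" by (simp add: s_def)
  qed
  have "integral ?J F = integral (?J \<inter> {..c}) F + integral (?J \<inter> {c..}) F"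
  proof -
    have "integral ((?J \<inter> {..c}) \<union> (?J \<inter> {c..})) F = integral (?J \<inter> {..c}) F + integral (?J \<inter> {c..}) F"
    proof (rule integral_Un)
      show "negligible ((?J \<inter> {..c}) \<inter> (?J \<inter> {c..}))" by (rule negligible_subset[of "{c}"]) auto
    qed (use Fs set_lebesgue_integral_eq_integral(1) in blast)+
    moreover have "(?J \<inter> {..c}) \<union> (?J \<inter> {c..}) = ?J" by auto
    ultimately show ?thesis by simp
  qed
  then have "integral ?J F = (W c + integral (?J \<inter> {c..}) F) - (W c - integral (?J \<inter> {..c}) F)" by simp
  then show thesis using that R L by blast
qed

locale sturm_liouville =
  fixes a b :: ereal and p q r :: "real \<Rightarrow> real"
  assumes coefficients: "sl_coefficients a b p q r"
begin

abbreviation J :: "real set" where "J \<equiv> einterval a b"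
abbreviation M :: "real measure" where "M \<equiv> weighted a b r"
abbreviation bracket_left :: "(real \<Rightarrow> complex) \<Rightarrow> (real \<Rightarrow> complex) \<Rightarrow> complex" where
  "bracket_left \<equiv> lagrange_bracket_left a b p"
abbreviation D_max :: "(real \<Rightarrow> complex) set" where "D_max \<equiv> dom_max a b p q r"
abbreviation \<tau> :: "(real \<Rightarrow> complex) \<Rightarrow> real \<Rightarrow> complex" where "\<tau> \<equiv> sl_expr a b p q r"

section \<open>Coefficients and the weighted measure\<close>

lemma ab: "a < b" using coefficients by (simp add: sl_coefficients_def)

lemma AE_p_pos: "AE x in lebesgue_on J. 0 < p x" and AE_r_pos: "AE x in lebesgue_on J. 0 < r x"
  using coefficients by (simp_all add: sl_coefficients_def)

lemma r_measurable: "r \<in> borel_measurable (lebesgue_on J)"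
  using coefficients by (simp add: sl_coefficients_def)

lemma loc_integrable_coefficients:
  "loc_integrable a b (\<lambda>x. complex_of_real (1 / p x))"
  "loc_integrable a b (\<lambda>x. complex_of_real (q x))"
  "loc_integrable a b (\<lambda>x. complex_of_real (r x))"
proof -
  have *: "loc_integrable a b f" if "f \<in> L1_loc a b" for f using that by (simp add: loc_integrable_def L1_loc_def)
  show "loc_integrable a b (\<lambda>x. complex_of_real (1 / p x))" "loc_integrable a b (\<lambda>x. complex_of_real (q x))"
    "loc_integrable a b (\<lambda>x. complex_of_real (r x))"
    by (rule loc_integrable_bounded_linear[OF bounded_linear_of_real *];
        use coefficients in \<open>simp add: sl_coefficients_def\<close>)+
qed

lemma borel_measurable_M: "borel_measurable M = (borel_measurable (lebesgue_on J) :: (real \<Rightarrow> complex) set)"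
  by (rule measurable_cong_sets) (simp_all add: weighted_def)

text \<open>\<open>r\<close> is positive almost everywhere, so passing to the density neither loses
  nor creates null sets.\<close>

lemma AE_M_iff: "(AE x in M. P x) \<longleftrightarrow> (AE x in lebesgue_on J. P x)"
proof -
  have "(AE x in M. P x) \<longleftrightarrow> (AE x in lebesgue_on J. 0 < ennreal (r x) \<longrightarrow> P x)"
    unfolding weighted_def by (rule AE_density) (use r_measurable in measurable)
  also have "\<dots> \<longleftrightarrow> (AE x in lebesgue_on J. P x)"
    using AE_r_pos by (auto elim: eventually_elim2)
  finally show ?thesis .
qed

lemma L2_cong_AE': "f \<in> L2 M \<Longrightarrow> AE x in lebesgue_on J. f x = g x \<Longrightarrow> g \<in> L2 M"
  by (rule L2_cong_AE[of f])
    (auto simp: AE_M_iff borel_measurable_M L2_def intro: borel_measurable_lebesgue_on_cong_AE)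

text \<open>Turns integrals with respect to \<open>M\<close> into gauge integrals over
  \<open>J\<close>, the kind in which primitives are expressed.\<close>

lemma L2_mult_weighted:
  assumes "f \<in> L2 M" "g \<in> L2 M"
  shows "(\<lambda>x. complex_of_real (r x) * (f x * g x)) absolutely_integrable_on J"
    "(\<integral>x. f x * g x \<partial>M) = integral J (\<lambda>x. complex_of_real (r x) * (f x * g x))"
proof -
  have m: "(\<lambda>x. f x * g x) \<in> borel_measurable (lebesgue_on J)"
    using assms by (auto intro!: borel_measurable_times simp: L2_def borel_measurable_M)
  have nn: "AE x in lebesgue_on J. 0 \<le> r x" using AE_r_pos by eventually_elim simp
  have "integrable M (\<lambda>x. f x * g x)" by (rule L2_mult_integrable[OF assms])
  then have i: "integrable (lebesgue_on J) (\<lambda>x. complex_of_real (r x) * (f x * g x))"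
    unfolding weighted_def using integrable_density[OF m r_measurable nn] by (simp add: scaleR_conv_of_real)
  then show "(\<lambda>x. complex_of_real (r x) * (f x * g x)) absolutely_integrable_on J"
    by (simp add: integrable_restrict_space set_integrable_def)
  have "(\<integral>x. f x * g x \<partial>M) = integral\<^sup>L (lebesgue_on J) (\<lambda>x. complex_of_real (r x) * (f x * g x))"
    unfolding weighted_def using integral_density[OF m r_measurable nn] by (simp add: scaleR_conv_of_real)
  also have "\<dots> = integral J (\<lambda>x. complex_of_real (r x) * (f x * g x))"
    by (rule lebesgue_integral_eq_integral[OF i]) simp
  finally show "(\<integral>x. f x * g x \<partial>M) = integral J (\<lambda>x. complex_of_real (r x) * (f x * g x))" .
qed

text \<open>The equation \<tau> f = k as a first-order system for \<open>f\<close> and its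
  quasi-derivative \<open>v\<close>. While \<open>quasi_deriv\<close> and \<open>sl_expr\<close>
  rest on choice and pointwise derivatives, this relation is visibly linear and insensitive to null
  sets in \<open>k\<close>.\<close>

definition sl_system :: "(real \<Rightarrow> complex) \<Rightarrow> (real \<Rightarrow> complex) \<Rightarrow> (real \<Rightarrow> complex) \<Rightarrow> bool" where
  "sl_system f v k \<longleftrightarrow> primitive a b f (\<lambda>x. v x / complex_of_real (p x)) \<and>
     primitive a b v (\<lambda>x. complex_of_real (q x) * f x - complex_of_real (r x) * k x)"

lemma sl_functions_sl_system:
  assumes f: "f \<in> sl_functions a b p"
  shows "sl_system f (quasi_deriv a b p f) (\<tau> f)"
proof -
  let ?h = "quasi_deriv a b p f"
  have fAC: "f \<in> AC_loc a b" and ex: "\<exists>h. is_quasi_deriv a b p f h" using f by (auto simp: sl_functions_def)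
  have h: "is_quasi_deriv a b p f ?h" unfolding quasi_deriv_def using ex by (rule someI_ex)
  have hAC: "?h \<in> AC_loc a b" and hae: "AE x in lebesgue_on J. ?h x = complex_of_real (p x) * vector_derivative f (at x)"
    using h by (auto simp: is_quasi_deriv_def)
  have "primitive a b f (\<lambda>x. ?h x / complex_of_real (p x))"
  proof (rule primitive_cong_AE[OF AC_loc_primitive(1)[OF fAC]])
    show "AE x in lebesgue_on J. vector_derivative f (at x) = ?h x / complex_of_real (p x)"
      using hae AE_p_pos by eventually_elim simp
  qed simp
  moreover have "primitive a b ?h (\<lambda>x. complex_of_real (q x) * f x - complex_of_real (r x) * \<tau> f x)"
  proof (rule primitive_cong_AE[OF AC_loc_primitive(1)[OF hAC]])
    show "AE x in lebesgue_on J. vector_derivative ?h (at x) = complex_of_real (q x) * f x - complex_of_real (r x) * \<tau> f x"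
      using AE_r_pos by eventually_elim (simp add: sl_expr_def)
  qed simp
  ultimately show ?thesis by (simp add: sl_system_def)
qed

lemma sl_system_continuous: "sl_system f v k \<Longrightarrow> continuous_on J f" "sl_system f v k \<Longrightarrow> continuous_on J v"
  unfolding sl_system_def using primitive_continuous_on by blast+

text \<open>Uniqueness of derivatives determines \<open>v / p\<close>, hence \<open>v\<close> almost
  everywhere and, by continuity, everywhere. The second equation then determines \<open>k\<close>,
  since \<open>r > 0\<close> almost everywhere.\<close>

lemma sl_system_unique:
  assumes "sl_system f v k" "sl_system f' v' k'" and eq: "\<And>x. x \<in> J \<Longrightarrow> f x = f' x"
  shows "\<And>x. x \<in> J \<Longrightarrow> v x = v' x" "AE x in lebesgue_on J. k x = k' x"
proof -
  have "AE x in lebesgue_on J. v x / complex_of_real (p x) = v' x / complex_of_real (p x)"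
    by (rule primitive_unique_AE[OF assms(1)[unfolded sl_system_def, THEN conjunct1]
          assms(2)[unfolded sl_system_def, THEN conjunct1] eq])
  then have "AE x in lebesgue_on J. v x = v' x" using AE_p_pos by eventually_elim simp
  then show vv: "\<And>x. x \<in> J \<Longrightarrow> v x = v' x"
    by (rule continuous_on_AE_eq[OF sl_system_continuous(2)[OF assms(1)] sl_system_continuous(2)[OF assms(2)] open_einterval])
  have "AE x in lebesgue_on J. complex_of_real (q x) * f x - complex_of_real (r x) * k x =
      complex_of_real (q x) * f' x - complex_of_real (r x) * k' x"
    by (rule primitive_unique_AE[OF assms(1)[unfolded sl_system_def, THEN conjunct2]
          assms(2)[unfolded sl_system_def, THEN conjunct2] vv])
  moreover have "AE x in lebesgue_on J. x \<in> J" by (rule AE_I2) simp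
  ultimately show "AE x in lebesgue_on J. k x = k' x"
    using AE_r_pos
  proof eventually_elim
    case (elim x)
    then show ?case using eq[of x] by simp
  qed
qed

text \<open>The way back from the system to the official notions: by uniqueness the chosen
  \<open>quasi_deriv\<close> can only be \<open>v\<close>.\<close>

lemma sl_system_sl_functions:
  assumes s: "sl_system f v k"
  shows "f \<in> sl_functions a b p" "\<And>x. x \<in> J \<Longrightarrow> quasi_deriv a b p f x = v x" "AE x in lebesgue_on J. \<tau> f x = k x"
proof -
  have f: "primitive a b f (\<lambda>x. v x / complex_of_real (p x))" and v: "v \<in> AC_loc a b"
    using s primitive_AC_loc unfolding sl_system_def by blast+
  have "AE x in lebesgue_on J. v x = complex_of_real (p x) * vector_derivative f (at x)"
    using primitive_has_vector_derivative_ae[OF f] AE_p_pos by eventually_elim (simp add: vector_derivative_at)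
  then have "is_quasi_deriv a b p f v" using v by (simp add: is_quasi_deriv_def)
  then show sf: "f \<in> sl_functions a b p" using primitive_AC_loc[OF f] by (auto simp: sl_functions_def)
  show "\<And>x. x \<in> J \<Longrightarrow> quasi_deriv a b p f x = v x" "AE x in lebesgue_on J. \<tau> f x = k x"
    using sl_system_unique[OF sl_functions_sl_system[OF sf] s] by auto
qed

lemma sl_system_cong:
  assumes s: "sl_system f v k" and "\<And>x. x \<in> J \<Longrightarrow> f x = f' x" "\<And>x. x \<in> J \<Longrightarrow> v x = v' x" "AE x in lebesgue_on J. k x = k' x"
  shows "sl_system f' v' k'"
proof -
  have J: "AE x in lebesgue_on J. x \<in> J" by (rule AE_I2) simp
  have 1: "AE x in lebesgue_on J. v x / complex_of_real (p x) = v' x / complex_of_real (p x)"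
    using J by eventually_elim (simp add: assms)
  have 2: "AE x in lebesgue_on J. complex_of_real (q x) * f x - complex_of_real (r x) * k x =
      complex_of_real (q x) * f' x - complex_of_real (r x) * k' x"
    using J assms(4) by eventually_elim (simp add: assms)
  show ?thesis
    unfolding sl_system_def
  proof
    show "primitive a b f' (\<lambda>x. v' x / complex_of_real (p x))"
      by (rule primitive_cong_AE[of a b f, OF _ _ 1]) (use s assms(2) in \<open>auto simp: sl_system_def\<close>)
    show "primitive a b v' (\<lambda>x. complex_of_real (q x) * f' x - complex_of_real (r x) * k' x)"
      by (rule primitive_cong_AE[of a b v, OF _ _ 2]) (use s assms(3) in \<open>auto simp: sl_system_def\<close>)
  qed
qed

lemma sl_system_add:
  assumes "sl_system f v k" "sl_system g u l"
  shows "sl_system (\<lambda>x. f x + g x) (\<lambda>x. v x + u x) (\<lambda>x. k x + l x)"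
  unfolding sl_system_def
proof (intro conjI)
  show "primitive a b (\<lambda>x. f x + g x) (\<lambda>x. (v x + u x) / complex_of_real (p x))"
    using primitive_add[of a b f "\<lambda>x. v x / complex_of_real (p x)" g "\<lambda>x. u x / complex_of_real (p x)"] assms
    by (simp add: sl_system_def add_divide_distrib)
  show "primitive a b (\<lambda>x. v x + u x) (\<lambda>x. complex_of_real (q x) * (f x + g x) - complex_of_real (r x) * (k x + l x))"
    using primitive_add[of a b v "\<lambda>x. complex_of_real (q x) * f x - complex_of_real (r x) * k x"
        u "\<lambda>x. complex_of_real (q x) * g x - complex_of_real (r x) * l x"] assms
    by (simp add: sl_system_def algebra_simps)
qed

lemma sl_system_cmult:
  assumes "sl_system f v k"
  shows "sl_system (\<lambda>x. c * f x) (\<lambda>x. c * v x) (\<lambda>x. c * k x)"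
  unfolding sl_system_def
proof (intro conjI)
  show "primitive a b (\<lambda>x. c * f x) (\<lambda>x. c * v x / complex_of_real (p x))"
    using primitive_bounded_linear[OF bounded_linear_mult_right[of c], of a b f "\<lambda>x. v x / complex_of_real (p x)"] assms
    by (simp add: sl_system_def)
  show "primitive a b (\<lambda>x. c * v x) (\<lambda>x. complex_of_real (q x) * (c * f x) - complex_of_real (r x) * (c * k x))"
    using primitive_bounded_linear[OF bounded_linear_mult_right[of c], of a b v "\<lambda>x. complex_of_real (q x) * f x - complex_of_real (r x) * k x"] assms
    by (simp add: sl_system_def algebra_simps)
qed

lemma sl_system_diff:
  assumes "sl_system f v k" "sl_system g u l"
  shows "sl_system (\<lambda>x. f x - g x) (\<lambda>x. v x - u x) (\<lambda>x. k x - l x)"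
  using sl_system_add[OF assms(1) sl_system_cmult[OF assms(2), of "-1"]] by simp

lemma sl_system_cnj:
  assumes "sl_system f v k"
  shows "sl_system (\<lambda>x. cnj (f x)) (\<lambda>x. cnj (v x)) (\<lambda>x. cnj (k x))"
  using assms primitive_bounded_linear[OF bounded_linear_cnj, of a b f "\<lambda>x. v x / complex_of_real (p x)"]
    primitive_bounded_linear[OF bounded_linear_cnj, of a b v "\<lambda>x. complex_of_real (q x) * f x - complex_of_real (r x) * k x"]
  by (simp add: sl_system_def)

text \<open>Bilinear form of the Lagrange bracket, with the quasi-derivatives passed explicitly;
  conjugating the second pair of arguments gives \<open>lagrange_bracket\<close>.\<close>

definition wronskian :: "(real \<Rightarrow> complex) \<Rightarrow> (real \<Rightarrow> complex) \<Rightarrow> (real \<Rightarrow> complex) \<Rightarrow> (real \<Rightarrow> complex) \<Rightarrow> real \<Rightarrow> complex" where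
  "wronskian f v g u x = f x * u x - v x * g x"

text \<open>Lagrange's identity: in the product rule the terms with \<open>1 / p\<close> and those
  with \<open>q\<close> cancel.\<close>

lemma wronskian_primitive:
  assumes f: "sl_system f v k" and g: "sl_system g u l"
  shows "primitive a b (wronskian f v g u) (\<lambda>x. complex_of_real (r x) * (k x * g x - f x * l x))"
proof -
  have "primitive a b (\<lambda>x. f x * u x) (\<lambda>x. f x * (complex_of_real (q x) * g x - complex_of_real (r x) * l x) + v x / complex_of_real (p x) * u x)"
    "primitive a b (\<lambda>x. v x * g x) (\<lambda>x. v x * (u x / complex_of_real (p x)) + (complex_of_real (q x) * f x - complex_of_real (r x) * k x) * g x)"
    by (rule primitive_mult[OF f[unfolded sl_system_def, THEN conjunct1] g[unfolded sl_system_def, THEN conjunct2]],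
        rule primitive_mult[OF f[unfolded sl_system_def, THEN conjunct2] g[unfolded sl_system_def, THEN conjunct1]])
  then have "primitive a b (\<lambda>x. f x * u x + (-1) * (v x * g x))
      (\<lambda>x. (f x * (complex_of_real (q x) * g x - complex_of_real (r x) * l x) + v x / complex_of_real (p x) * u x) +
        (-1) * (v x * (u x / complex_of_real (p x)) + (complex_of_real (q x) * f x - complex_of_real (r x) * k x) * g x))"
    by (intro primitive_add primitive_bounded_linear[OF bounded_linear_mult_right])
  then show ?thesis
    by (rule primitive_cong_AE) (auto simp: wronskian_def algebra_simps intro!: AE_I2)
qed

section \<open>The maximal domain\<close>

lemma D_max_sl_system: "f \<in> D_max \<Longrightarrow> sl_system f (quasi_deriv a b p f) (\<tau> f)"
  by (auto simp: dom_max_def intro: sl_functions_sl_system)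

lemma D_max_L2: "f \<in> D_max \<Longrightarrow> f \<in> L2 M" "f \<in> D_max \<Longrightarrow> \<tau> f \<in> L2 M"
  by (simp_all add: dom_max_def)

lemma D_maxI:
  assumes s: "sl_system f v k" and L: "f \<in> L2 M" "k \<in> L2 M"
  shows "f \<in> D_max"
proof -
  have "AE x in lebesgue_on J. k x = \<tau> f x" using sl_system_sl_functions(3)[OF s] by eventually_elim simp
  then have "\<tau> f \<in> L2 M" using L(2) by (rule L2_cong_AE'[rotated])
  then show ?thesis using sl_system_sl_functions(1)[OF s] L by (simp add: dom_max_def)
qed

lemma D_max_diff_cmult:
  assumes f: "f \<in> D_max" and g: "g \<in> D_max"
  shows "(\<lambda>x. f x - c * g x) \<in> D_max"
    "AE x in lebesgue_on J. \<tau> (\<lambda>x. f x - c * g x) x = \<tau> f x - c * \<tau> g x"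
    "\<And>x. x \<in> J \<Longrightarrow> quasi_deriv a b p (\<lambda>x. f x - c * g x) x = quasi_deriv a b p f x - c * quasi_deriv a b p g x"
proof -
  have s: "sl_system (\<lambda>x. f x - c * g x) (\<lambda>x. quasi_deriv a b p f x - c * quasi_deriv a b p g x) (\<lambda>x. \<tau> f x - c * \<tau> g x)"
    by (rule sl_system_diff[OF D_max_sl_system[OF f] sl_system_cmult[OF D_max_sl_system[OF g]]])
  show "(\<lambda>x. f x - c * g x) \<in> D_max"
    by (rule D_maxI[OF s L2_diff[OF D_max_L2(1)[OF f] L2_cmult[OF D_max_L2(1)[OF g]]]
          L2_diff[OF D_max_L2(2)[OF f] L2_cmult[OF D_max_L2(2)[OF g]]]])
  show "AE x in lebesgue_on J. \<tau> (\<lambda>x. f x - c * g x) x = \<tau> f x - c * \<tau> g x"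
    "\<And>x. x \<in> J \<Longrightarrow> quasi_deriv a b p (\<lambda>x. f x - c * g x) x = quasi_deriv a b p f x - c * quasi_deriv a b p g x"
    using sl_system_sl_functions[OF s] by auto
qed

lemma D_max_cnj:
  assumes f: "f \<in> D_max"
  shows "(\<lambda>x. cnj (f x)) \<in> D_max"
    "AE x in lebesgue_on J. \<tau> (\<lambda>x. cnj (f x)) x = cnj (\<tau> f x)"
    "\<And>x. x \<in> J \<Longrightarrow> quasi_deriv a b p (\<lambda>x. cnj (f x)) x = cnj (quasi_deriv a b p f x)"
proof -
  have s: "sl_system (\<lambda>x. cnj (f x)) (\<lambda>x. cnj (quasi_deriv a b p f x)) (\<lambda>x. cnj (\<tau> f x))"
    by (rule sl_system_cnj[OF D_max_sl_system[OF f]])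
  show "(\<lambda>x. cnj (f x)) \<in> D_max" by (rule D_maxI[OF s L2_cnj[OF D_max_L2(1)[OF f]] L2_cnj[OF D_max_L2(2)[OF f]]])
  show "AE x in lebesgue_on J. \<tau> (\<lambda>x. cnj (f x)) x = cnj (\<tau> f x)"
    "\<And>x. x \<in> J \<Longrightarrow> quasi_deriv a b p (\<lambda>x. cnj (f x)) x = cnj (quasi_deriv a b p f x)"
    using sl_system_sl_functions[OF s] by auto
qed

lemma D_max_cong:
  assumes f: "f \<in> D_max" and eq: "\<And>x. x \<in> J \<Longrightarrow> f x = g x"
  shows "g \<in> D_max" "AE x in lebesgue_on J. \<tau> g x = \<tau> f x"
    "\<And>x. x \<in> J \<Longrightarrow> quasi_deriv a b p g x = quasi_deriv a b p f x"
proof -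
  have s: "sl_system g (quasi_deriv a b p f) (\<tau> f)"
    by (rule sl_system_cong[OF D_max_sl_system[OF f]]) (use eq in auto)
  have "AE x in lebesgue_on J. f x = g x" using eq by (intro AE_I2) simp
  then have "g \<in> L2 M" using D_max_L2(1)[OF f] by (rule L2_cong_AE'[rotated])
  then show "g \<in> D_max" using D_max_L2(2)[OF f] by (intro D_maxI[OF s])
  show "AE x in lebesgue_on J. \<tau> g x = \<tau> f x"
    "\<And>x. x \<in> J \<Longrightarrow> quasi_deriv a b p g x = quasi_deriv a b p f x"
    using sl_system_sl_functions[OF s] by auto
qed

lemma D_max_AE_eq:
  assumes "f \<in> D_max" "g \<in> D_max" "AE x in M. f x = g x" "x \<in> J"
  shows "f x = g x"
  using assms D_max_sl_system sl_system_continuous(1) continuous_on_AE_eq[of J f g x] by (auto simp: AE_M_iff)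

section \<open>Green's formula and the brackets at the left endpoint\<close>

lemma eventually_at_right_J: "eventually (\<lambda>t. real_of_ereal t \<in> J) (at_right a)"
  unfolding eventually_at_right[OF ab]
proof (intro exI[of _ b] conjI allI impI ab)
  fix t assume "a < t" "t < b"
  then show "real_of_ereal t \<in> J" by (cases t) (auto simp: einterval_iff)
qed

lemma lagrange_bracket_cong:
  assumes "f \<in> D_max" "g \<in> D_max" "\<And>x. x \<in> J \<Longrightarrow> f x = f' x" "\<And>x. x \<in> J \<Longrightarrow> g x = g' x" "x \<in> J"
  shows "lagrange_bracket a b p f g x = lagrange_bracket a b p f' g' x"
  using D_max_cong(3)[OF assms(1,3), of x] D_max_cong(3)[OF assms(2,4), of x] assms by (simp add: lagrange_bracket_def)

lemma lagrange_bracket_wronskian: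
  "lagrange_bracket a b p f g = wronskian f (quasi_deriv a b p f) (\<lambda>x. cnj (g x)) (\<lambda>x. cnj (quasi_deriv a b p g x))"
  by (simp add: lagrange_bracket_def wronskian_def fun_eq_iff)

text \<open>Green's formula with both boundary terms. As \<open>f\<close>, \<open>g\<close>, \<tau>
  f and \<tau> g are square integrable, the derivative of the bracket is integrable up to the
  endpoints, and this is what makes the limits exist.\<close>

lemma D_max_bracket_limits:
  assumes f: "f \<in> D_max" and g: "g \<in> D_max"
  obtains Lb where
    "((lagrange_bracket a b p f g \<circ> real_of_ereal) \<longlongrightarrow> bracket_left f g) (at_right a)"
    "((lagrange_bracket a b p f g \<circ> real_of_ereal) \<longlongrightarrow> Lb) (at_left b)"
    "L2_inner M g (\<tau> f) - L2_inner M (\<tau> g) f = Lb - bracket_left f g"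
proof -
  let ?F = "\<lambda>x. complex_of_real (r x) * (\<tau> f x * cnj (g x) - f x * cnj (\<tau> g x))"
  have W: "primitive a b (lagrange_bracket a b p f g) ?F"
    unfolding lagrange_bracket_wronskian
    by (rule wronskian_primitive[OF D_max_sl_system[OF f] sl_system_cnj[OF D_max_sl_system[OF g]]])
  note 1 = L2_mult_weighted[OF D_max_L2(2)[OF f] L2_cnj[OF D_max_L2(1)[OF g]]]
  note 2 = L2_mult_weighted[OF D_max_L2(1)[OF f] L2_cnj[OF D_max_L2(2)[OF g]]]
  have eq: "?F = (\<lambda>x. complex_of_real (r x) * (\<tau> f x * cnj (g x)) - complex_of_real (r x) * (f x * cnj (\<tau> g x)))"
    by (simp add: algebra_simps)
  have F: "?F absolutely_integrable_on J" unfolding eq by (rule set_integral_diff(1)[OF 1(1) 2(1)])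
  obtain La Lb where L: "((lagrange_bracket a b p f g \<circ> real_of_ereal) \<longlongrightarrow> La) (at_right a)"
    "((lagrange_bracket a b p f g \<circ> real_of_ereal) \<longlongrightarrow> Lb) (at_left b)" "integral J ?F = Lb - La"
    using primitive_limits[OF W F ab] .
  have La: "La = bracket_left f g"
    unfolding lagrange_bracket_left_def using tendsto_Lim[OF at_right_ereal_neq_bot[OF ab] L(1)] by simp
  have "L2_inner M g (\<tau> f) - L2_inner M (\<tau> g) f = integral J (\<lambda>x. complex_of_real (r x) * (\<tau> f x * cnj (g x))) - integral J (\<lambda>x. complex_of_real (r x) * (f x * cnj (\<tau> g x)))"
    unfolding 1(2)[symmetric] 2(2)[symmetric] L2_inner_def by (simp add: mult.commute)
  also have "\<dots> = integral J ?F" unfolding eq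
    by (rule Henstock_Kurzweil_Integration.integral_diff[symmetric]; rule set_lebesgue_integral_eq_integral(1)) (rule 1(1) 2(1))+
  finally show thesis using that L La by auto
qed

lemma bracket_left_eqI:
  assumes "f \<in> D_max" "g \<in> D_max" "((lagrange_bracket a b p f g \<circ> real_of_ereal) \<longlongrightarrow> L) (at_right a)"
  shows "bracket_left f g = L"
  unfolding lagrange_bracket_left_def using tendsto_Lim[OF at_right_ereal_neq_bot[OF ab] assms(3)] .

lemma bracket_left_tendsto:
  "f \<in> D_max \<Longrightarrow> g \<in> D_max \<Longrightarrow> ((lagrange_bracket a b p f g \<circ> real_of_ereal) \<longlongrightarrow> bracket_left f g) (at_right a)"
  using D_max_bracket_limits by blast

lemma bracket_left_cong:
  assumes "f \<in> D_max" "g \<in> D_max" "\<And>x. x \<in> J \<Longrightarrow> f x = f' x" "\<And>x. x \<in> J \<Longrightarrow> g x = g' x"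
  shows "bracket_left f' g' = bracket_left f g"
proof (rule bracket_left_eqI)
  show "f' \<in> D_max" "g' \<in> D_max" using D_max_cong(1) assms by blast+
  have "eventually (\<lambda>t. (lagrange_bracket a b p f g \<circ> real_of_ereal) t = (lagrange_bracket a b p f' g' \<circ> real_of_ereal) t) (at_right a)"
    using eventually_at_right_J by eventually_elim (simp add: lagrange_bracket_cong[OF assms])
  then show "((lagrange_bracket a b p f' g' \<circ> real_of_ereal) \<longlongrightarrow> bracket_left f g) (at_right a)"
    using bracket_left_tendsto[OF assms(1,2)] by (rule Lim_transform_eventually[rotated])
qed

lemma bracket_left_diff_cmult:
  assumes f: "f \<in> D_max" and g: "g \<in> D_max" and h: "h \<in> D_max"
  shows "bracket_left (\<lambda>x. f x - c * g x) h = bracket_left f h - c * bracket_left g h"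
proof (rule bracket_left_eqI)
  have "((\<lambda>t. (lagrange_bracket a b p f h \<circ> real_of_ereal) t - c * (lagrange_bracket a b p g h \<circ> real_of_ereal) t)
      \<longlongrightarrow> bracket_left f h - c * bracket_left g h) (at_right a)"
    by (intro tendsto_intros bracket_left_tendsto f g h)
  moreover have "eventually (\<lambda>t. (lagrange_bracket a b p f h \<circ> real_of_ereal) t - c * (lagrange_bracket a b p g h \<circ> real_of_ereal) t
      = (lagrange_bracket a b p (\<lambda>x. f x - c * g x) h \<circ> real_of_ereal) t) (at_right a)"
    using eventually_at_right_J
    by eventually_elim (simp add: lagrange_bracket_def D_max_diff_cmult(3)[OF f g] algebra_simps)
  ultimately show "((lagrange_bracket a b p (\<lambda>x. f x - c * g x) h \<circ> real_of_ereal) \<longlongrightarrow> bracket_left f h - c * bracket_left g h) (at_right a)"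
    by (rule Lim_transform_eventually)
qed (use D_max_diff_cmult(1)[OF f g] h in auto)

lemma bracket_left_cnj:
  assumes f: "f \<in> D_max" and g: "g \<in> D_max"
  shows "bracket_left (\<lambda>x. cnj (f x)) (\<lambda>x. cnj (g x)) = cnj (bracket_left f g)"
proof (rule bracket_left_eqI)
  have "((\<lambda>t. cnj ((lagrange_bracket a b p f g \<circ> real_of_ereal) t)) \<longlongrightarrow> cnj (bracket_left f g)) (at_right a)"
    by (intro tendsto_intros bracket_left_tendsto f g)
  moreover have "eventually (\<lambda>t. cnj ((lagrange_bracket a b p f g \<circ> real_of_ereal) t)
      = (lagrange_bracket a b p (\<lambda>x. cnj (f x)) (\<lambda>x. cnj (g x)) \<circ> real_of_ereal) t) (at_right a)"
    using eventually_at_right_J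
    by eventually_elim (simp add: lagrange_bracket_def D_max_cnj(3)[OF f] D_max_cnj(3)[OF g])
  ultimately show "((lagrange_bracket a b p (\<lambda>x. cnj (f x)) (\<lambda>x. cnj (g x)) \<circ> real_of_ereal) \<longlongrightarrow> cnj (bracket_left f g)) (at_right a)"
    by (rule Lim_transform_eventually)
qed (use D_max_cnj(1) f g in auto)

lemma bracket_left_commute:
  assumes f: "f \<in> D_max" and g: "g \<in> D_max"
  shows "bracket_left g f = - cnj (bracket_left f g)"
proof (rule bracket_left_eqI[OF g f])
  have "((\<lambda>t. - cnj ((lagrange_bracket a b p f g \<circ> real_of_ereal) t)) \<longlongrightarrow> - cnj (bracket_left f g)) (at_right a)"
    by (intro tendsto_intros bracket_left_tendsto f g)
  moreover have "(\<lambda>t. - cnj ((lagrange_bracket a b p f g \<circ> real_of_ereal) t)) = (lagrange_bracket a b p g f \<circ> real_of_ereal)"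
    by (simp add: lagrange_bracket_def fun_eq_iff)
  ultimately show "((lagrange_bracket a b p g f \<circ> real_of_ereal) \<longlongrightarrow> - cnj (bracket_left f g)) (at_right a)" by simp
qed

text \<open>Pluecker's relation for four plane vectors, applied pointwise to values and
  quasi-derivatives and carried to the limit. Reality of \<phi> and \<psi> lets the conjugated
  brackets with them be expanded.\<close>

lemma bracket_left_pluecker:
  assumes D: "f \<in> D_max" "g \<in> D_max" "\<phi> \<in> D_max" "\<psi> \<in> D_max"
    and real: "\<And>x. x \<in> J \<Longrightarrow> \<phi> x \<in> \<real>" "\<And>x. x \<in> J \<Longrightarrow> \<psi> x \<in> \<real>"
  shows "bracket_left f g * bracket_left \<psi> \<phi> =
    bracket_left f \<psi> * cnj (bracket_left g \<phi>) - bracket_left f \<phi> * cnj (bracket_left g \<psi>)"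
proof -
  let ?q = "quasi_deriv a b p" and ?L = "\<lambda>f g. lagrange_bracket a b p f g \<circ> real_of_ereal"
  \<comment> \<open>A function that is real on \<open>J\<close> coincides there with its conjugate,
    so uniqueness of quasi-derivatives makes \<open>?q h\<close> real as well.\<close>
  have cr: "cnj (h x) = h x" "cnj (?q h x) = ?q h x" if h: "h \<in> D_max" "\<And>x. x \<in> J \<Longrightarrow> h x \<in> \<real>" and x: "x \<in> J" for h x
  proof -
    have eq: "h y = cnj (h y)" if "y \<in> J" for y using h(2)[OF that] by (simp add: Reals_cnj_iff)
    show "cnj (h x) = h x" using eq[OF x] by simp
    show "cnj (?q h x) = ?q h x" using D_max_cong(3)[OF h(1) eq x] D_max_cnj(3)[OF h(1) x] by simp
  qed
  have "((\<lambda>t. ?L f g t * ?L \<psi> \<phi> t) \<longlongrightarrow> bracket_left f g * bracket_left \<psi> \<phi>) (at_right a)"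
    by (intro tendsto_intros bracket_left_tendsto D)
  moreover have "eventually (\<lambda>t. ?L f g t * ?L \<psi> \<phi> t = ?L f \<psi> t * cnj (?L g \<phi> t) - ?L f \<phi> t * cnj (?L g \<psi> t)) (at_right a)"
    using eventually_at_right_J
  proof eventually_elim
    case (elim t)
    note cr[OF D(3) real(1) elim] cr[OF D(4) real(2) elim]
    then show ?case by (simp add: lagrange_bracket_def algebra_simps)
  qed
  ultimately have "((\<lambda>t. ?L f \<psi> t * cnj (?L g \<phi> t) - ?L f \<phi> t * cnj (?L g \<psi> t)) \<longlongrightarrow> bracket_left f g * bracket_left \<psi> \<phi>) (at_right a)"
    by (rule Lim_transform_eventually)
  moreover have "((\<lambda>t. ?L f \<psi> t * cnj (?L g \<phi> t) - ?L f \<phi> t * cnj (?L g \<psi> t)) \<longlongrightarrow>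
      bracket_left f \<psi> * cnj (bracket_left g \<phi>) - bracket_left f \<phi> * cnj (bracket_left g \<psi>)) (at_right a)"
    by (intro tendsto_intros bracket_left_tendsto D)
  ultimately show ?thesis by (rule tendsto_unique[OF at_right_ereal_neq_bot[OF ab]])
qed

end

section \<open>Linear systems with locally integrable coefficients\<close>

lemma primitive_power:
  fixes P :: "real \<Rightarrow> real"
  assumes P: "primitive a b P A"
  shows "primitive a b (\<lambda>x. P x ^ Suc n) (\<lambda>x. real (Suc n) * (A x * P x ^ n))"
proof (induction n)
  case 0 then show ?case using P by simp
next
  case (Suc n)
  show ?case
    by (rule primitive_cong_AE[OF primitive_mult[OF P Suc]]) (auto simp: algebra_simps)
qed

text \<open>To the right of \<open>x0\<close> the bound on \<open>G\<close> is
  \<open>C / (n + 1)\<close> times the derivative of a power of \<open>P\<close>; integration gains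
  the factor \<open>1 / (n + 1)\<close>, and these factors accumulate to the factorial of the Picard
  estimate.\<close>

lemma primitive_power_bound:
  fixes Z :: "real \<Rightarrow> 'a::euclidean_space"
  assumes P: "primitive a b P A" and Z: "primitive a b Z G"
    and x0: "x0 \<in> einterval a b" "P x0 = 0" "Z x0 = 0" and A: "\<And>x. 0 \<le> A x" and C: "0 \<le> C"
    and G: "\<And>x. x \<in> einterval a b \<Longrightarrow> norm (G x) \<le> C * (A x * \<bar>P x\<bar> ^ n)" and x: "x \<in> einterval a b"
  shows "norm (Z x) \<le> C * \<bar>P x\<bar> ^ Suc n / real (Suc n)"
proof -
  have mono: "P s \<le> P t" if "s \<in> einterval a b" "t \<in> einterval a b" "s \<le> t" for s t
    using primitiveD[OF P that] integral_nonneg[OF loc_integrable_integrable[OF primitive_loc_integrable[OF P] that(1,2)]] A by auto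
  have Gi: "G integrable_on {s..t}" if "s \<in> einterval a b" "t \<in> einterval a b" for s t
    by (rule loc_integrable_integrable[OF primitive_loc_integrable[OF Z] that])
  show ?thesis
  proof (cases "x0 \<le> x")
    case True
    note Q = primitive_power[OF P, of n]
    have "norm (Z x) = norm (integral {x0..x} G)" using primitiveD[OF Z x0(1) x True] x0(3) by simp
    also have "\<dots> \<le> integral {x0..x} (\<lambda>t. (C / real (Suc n)) * (real (Suc n) * (A t * P t ^ n)))"
    proof (rule integral_norm_bound_integral[OF Gi[OF x0(1) x]])
      show "(\<lambda>t. (C / real (Suc n)) * (real (Suc n) * (A t * P t ^ n))) integrable_on {x0..x}"
        by (rule integrable_on_mult_right[OF loc_integrable_integrable[OF primitive_loc_integrable[OF Q] x0(1) x]])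
      fix t assume t: "t \<in> {x0..x}"
      then have tJ: "t \<in> einterval a b" using einterval_Icc_subset[OF x0(1) x] by blast
      then have "0 \<le> P t" using mono[OF x0(1) tJ] t x0(2) by simp
      then show "norm (G t) \<le> (C / real (Suc n)) * (real (Suc n) * (A t * P t ^ n))" using G[OF tJ] by simp
    qed
    also have "\<dots> = (C / real (Suc n)) * (P x ^ Suc n - P x0 ^ Suc n)"
      by (subst Henstock_Kurzweil_Integration.integral_mult_right) (simp only: primitiveD[OF Q x0(1) x True])
    finally show ?thesis using mono[OF x0(1) x True] x0(2) by simp
  next
    case False
    then have le: "x \<le> x0" by simp
    \<comment> \<open>To the left of \<open>x0\<close> the monotone \<open>P\<close> is nonpositive,
      so \<open>|P|\<close> is \<open>- P\<close>, a primitive of \<open>- A\<close>. The two sign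
      changes cancel.\<close>
    have R: "primitive a b (\<lambda>x. - P x) (\<lambda>x. - A x)"
      using primitive_bounded_linear[OF bounded_linear_minus[OF bounded_linear_ident] P] by simp
    note Q = primitive_power[OF R, of n]
    have "norm (Z x) = norm (integral {x..x0} G)" using primitiveD[OF Z x x0(1) le] x0(3) by simp
    also have "\<dots> \<le> integral {x..x0} (\<lambda>t. (- C / real (Suc n)) * (real (Suc n) * (- A t * (- P t) ^ n)))"
    proof (rule integral_norm_bound_integral[OF Gi[OF x x0(1)]])
      show "(\<lambda>t. (- C / real (Suc n)) * (real (Suc n) * (- A t * (- P t) ^ n))) integrable_on {x..x0}"
        by (rule integrable_on_mult_right[OF loc_integrable_integrable[OF primitive_loc_integrable[OF Q] x x0(1)]])
      fix t assume t: "t \<in> {x..x0}"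
      then have tJ: "t \<in> einterval a b" using einterval_Icc_subset[OF x x0(1)] by blast
      then have "P t \<le> 0" using mono[OF tJ x0(1)] t x0(2) by simp
      then show "norm (G t) \<le> (- C / real (Suc n)) * (real (Suc n) * (- A t * (- P t) ^ n))" using G[OF tJ] by simp
    qed
    also have "\<dots> = (- C / real (Suc n)) * ((- P x0) ^ Suc n - (- P x) ^ Suc n)"
      by (subst Henstock_Kurzweil_Integration.integral_mult_right) (simp only: primitiveD[OF Q x x0(1) le])
    finally show ?thesis using mono[OF x x0(1) le] x0(2) by simp
  qed
qed

lemma loc_integrable_Pair:
  assumes "loc_integrable a b f" "loc_integrable a b g"
  shows "loc_integrable a b (\<lambda>x. (f x, g x))"
proof -
  have "bounded_linear (\<lambda>x :: 'a. (x, 0 :: 'b))" "bounded_linear (\<lambda>x :: 'b. (0 :: 'a, x))"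
    by (intro bounded_linear_Pair bounded_linear_ident bounded_linear_zero)+
  from loc_integrable_add[OF loc_integrable_bounded_linear[OF this(1) assms(1)] loc_integrable_bounded_linear[OF this(2) assms(2)]]
  show ?thesis by simp
qed

text \<open>Picard iteration: with \<open>A = |P| + |Q|\<close> and \<open>R\<close> its primitive vanishing at \<open>x0\<close>, the
  successive differences are bounded by \<open>C |R|^n / n!\<close>.\<close>

lemma linear_system_exists:
  fixes P Q :: "real \<Rightarrow> complex"
  assumes P: "loc_integrable a b P" and Q: "loc_integrable a b Q" and x0: "x0 \<in> einterval a b"
  obtains u v where "primitive a b u (\<lambda>x. P x * v x)" "primitive a b v (\<lambda>x. Q x * u x)" "u x0 = u0" "v x0 = v0"
proof -
  let ?J = "einterval a b"
  define A where "A x = norm (P x) + norm (Q x)" for x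
  have A: "0 \<le> A x" for x unfolding A_def by simp
  have Ai: "loc_integrable a b A"
    using P Q unfolding loc_integrable_def A_def by (auto intro!: set_integral_add absolutely_integrable_norm[unfolded o_def])
  obtain R where R: "primitive a b R A" "R x0 = 0" using primitive_exists[OF Ai x0] .
  define B where "B Y x = (P x * snd (Y x), Q x * fst (Y x))" for Y :: "real \<Rightarrow> complex \<times> complex" and x
  have Bnorm: "norm (B Y x) \<le> A x * norm (Y x)" for Y x
  proof -
    have "norm (B Y x) \<le> norm (P x * snd (Y x)) + norm (Q x * fst (Y x))" unfolding B_def by (rule norm_Pair_le)
    also have "\<dots> \<le> norm (P x) * norm (Y x) + norm (Q x) * norm (Y x)"
      unfolding norm_mult by (intro add_mono mult_left_mono norm_fst_le norm_snd_le) (metis norm_snd_le norm_fst_le prod.collapse norm_ge_zero)+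
    finally show ?thesis by (simp add: A_def algebra_simps)
  qed
  have Bdiff: "B Y x - B Z x = B (\<lambda>x. Y x - Z x) x" for Y Z x unfolding B_def by (simp add: algebra_simps)
  have Bint: "loc_integrable a b (B Y)" if "continuous_on ?J Y" for Y
    unfolding B_def
    using loc_integrable_continuous_mult[OF continuous_on_snd[OF that] P] loc_integrable_continuous_mult[OF continuous_on_fst[OF that] Q]
    by (intro loc_integrable_Pair) (simp_all add: mult.commute)
  \<comment> \<open>The next iterate is the primitive of \<open>B Y\<close> with the prescribed
    initial value; the choice is justified for continuous \<open>Y\<close> only, and the iterates
    stay continuous.\<close>
  define step where "step Y = (SOME Z. primitive a b Z (B Y) \<and> Z x0 = (u0, v0))" for Y
  have step: "primitive a b (step Y) (B Y) \<and> step Y x0 = (u0, v0)" if Y: "continuous_on ?J Y" for Y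
  proof -
    obtain Z where "primitive a b Z (B Y)" "Z x0 = (u0, v0)" using primitive_exists[OF Bint[OF Y] x0] .
    then have "\<exists>Z. primitive a b Z (B Y) \<and> Z x0 = (u0, v0)" by blast
    then show ?thesis unfolding step_def by (rule someI_ex)
  qed
  define Y where "Y n = (step ^^ n) (\<lambda>x. (u0, v0))" for n
  have Y0: "Y 0 = (\<lambda>x. (u0, v0))" and YS: "Y (Suc n) = step (Y n)" for n unfolding Y_def by simp_all
  have Yc: "continuous_on ?J (Y n)" for n
  proof (induction n)
    case 0 show ?case unfolding Y0 by (rule continuous_on_const)
  next
    case (Suc n) then show ?case unfolding YS using step primitive_continuous_on by blast
  qed
  have YP: "primitive a b (Y (Suc n)) (B (Y n))" "Y (Suc n) x0 = (u0, v0)" for n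
    unfolding YS using step[OF Yc[of n]] by auto
  define C where "C = norm (u0, v0)"
  have C: "0 \<le> C" unfolding C_def by simp
  have bound: "norm (Y (Suc n) x - Y n x) \<le> C * \<bar>R x\<bar> ^ Suc n / fact (Suc n)" if "x \<in> ?J" for n x
    using that
  proof (induction n arbitrary: x)
    case 0
    have "primitive a b (\<lambda>x. Y 1 x - (u0, v0)) (B (Y 0))"
      using YP(1)[of 0] by (simp add: primitive_def)
    from primitive_power_bound[OF R(1) this x0 R(2) _ A C _ 0, of 0]
    show ?case using YP(2)[of 0] Bnorm[of "Y 0"] by (simp add: Y0 C_def mult.commute)
  next
    case (Suc n)
    have pr: "primitive a b (\<lambda>x. Y (Suc (Suc n)) x - Y (Suc n) x) (B (\<lambda>x. Y (Suc n) x - Y n x))"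
      using primitive_add[OF YP(1)[of "Suc n"] primitive_bounded_linear[OF bounded_linear_minus[OF bounded_linear_ident] YP(1)[of n]]]
      by (simp add: Bdiff)
    have "norm (B (\<lambda>x. Y (Suc n) x - Y n x) x) \<le> C / fact (Suc n) * (A x * \<bar>R x\<bar> ^ Suc n)" if "x \<in> ?J" for x
      using order_trans[OF Bnorm[of "\<lambda>x. Y (Suc n) x - Y n x" x] mult_left_mono[OF Suc.IH[OF that] A[of x]]]
      by (simp add: mult_ac)
    from primitive_power_bound[OF R(1) pr x0 R(2) _ A _ this Suc.prems]
    have "norm (Y (Suc (Suc n)) x - Y (Suc n) x) \<le> C / fact (Suc n) * \<bar>R x\<bar> ^ Suc (Suc n) / real (Suc (Suc n))"
      using YP(2) C by simp
    then show ?case by (simp add: fact_Suc mult_ac del: of_nat_Suc)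
  qed
  define L where "L x = lim (\<lambda>n. Y n x)" for x
  have tel: "(\<Sum>k<n. Y (Suc k) x - Y k x) = Y n x - Y 0 x" for n x by (induction n) auto
  have sm: "summable (\<lambda>n. C * \<bar>K\<bar> ^ Suc n / fact (Suc n))" for K
  proof -
    have "summable (\<lambda>n. C * (inverse (fact n) * \<bar>K\<bar> ^ n))" by (intro summable_mult summable_exp)
    then have "summable (\<lambda>n. C * (inverse (fact (Suc n)) * \<bar>K\<bar> ^ Suc n))" by (rule summable_Suc_iff[THEN iffD2])
    then show ?thesis by (simp add: field_simps del: fact_Suc power_Suc)
  qed
  have conv: "(\<lambda>n. Y n x) \<longlonglongrightarrow> L x" if x: "x \<in> ?J" for x
  proof -
    have "summable (\<lambda>n. Y (Suc n) x - Y n x)"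
      by (rule summable_comparison_test'[OF sm[of "R x"], where N=0]) (use bound[OF x] in simp)
    then have "convergent (\<lambda>n. Y n x - Y 0 x)" by (simp add: summable_iff_convergent tel)
    then have "convergent (\<lambda>n. (Y n x - Y 0 x) + Y 0 x)" by (intro convergent_add convergent_const)
    then show ?thesis by (simp add: L_def convergent_LIMSEQ_iff)
  qed
  have Ybd: "norm (Y n x) \<le> C + (\<Sum>k. C * \<bar>K\<bar> ^ Suc k / fact (Suc k))" if x: "x \<in> ?J" "\<bar>R x\<bar> \<le> K" for n x K
  proof -
    have "norm (Y n x) \<le> norm (Y 0 x) + norm (\<Sum>k<n. Y (Suc k) x - Y k x)"
      using norm_triangle_ineq[of "Y 0 x" "Y n x - Y 0 x"] by (simp add: tel)
    also have "norm (\<Sum>k<n. Y (Suc k) x - Y k x) \<le> (\<Sum>k<n. C * \<bar>K\<bar> ^ Suc k / fact (Suc k))"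
    proof (rule sum_norm_le)
      fix k
      have "norm (Y (Suc k) x - Y k x) \<le> C * \<bar>R x\<bar> ^ Suc k / fact (Suc k)" by (rule bound[OF x(1)])
      also have "\<dots> \<le> C * \<bar>K\<bar> ^ Suc k / fact (Suc k)"
        using x(2) C by (intro divide_right_mono mult_left_mono power_mono) auto
      finally show "norm (Y (Suc k) x - Y k x) \<le> C * \<bar>K\<bar> ^ Suc k / fact (Suc k)" .
    qed
    also have "\<dots> \<le> (\<Sum>k. C * \<bar>K\<bar> ^ Suc k / fact (Suc k))"
    proof (rule sum_le_suminf)
      show "summable (\<lambda>k. C * \<bar>K\<bar> ^ Suc k / fact (Suc k))"
        by (rule sm)
    qed (use C in auto)
    finally show ?thesis by (simp add: Y0 C_def)
  qed
  have dom: "B L absolutely_integrable_on {c..d} \<and> integral {c..d} (B L) = L d - L c"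
    if cd: "c \<in> ?J" "d \<in> ?J" "c \<le> d" for c d
  proof -
    have "bounded (R ` {c..d})"
      by (intro compact_imp_bounded compact_continuous_image ac_on_continuous primitive_ac_on[OF R(1)] cd) simp
    then obtain K where "\<forall>y\<in>R ` {c..d}. norm y \<le> K" unfolding bounded_iff by blast
    then have K: "\<And>x. x \<in> {c..d} \<Longrightarrow> \<bar>R x\<bar> \<le> K" by (metis imageI real_norm_def)
    \<comment> \<open>A bound for all iterates on \<open>{c..d}\<close> at once, so that
      \<open>A x * S\<close> is an integrable majorant and the integral equation passes to the
      limit.\<close>
    define S where "S = C + (\<Sum>k. C * \<bar>K\<bar> ^ Suc k / fact (Suc k))"
    have xJ: "x \<in> ?J" if "x \<in> {c..d}" for x using einterval_Icc_subset[OF cd(1,2)] that by blast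
    have Bi: "B (Y n) absolutely_integrable_on {c..d}" for n by (rule loc_integrableD[OF Bint[OF Yc] cd(1,2)])
    have hi: "(\<lambda>x. A x * S) integrable_on {c..d}"
      by (rule integrable_on_mult_left[OF loc_integrable_integrable[OF Ai cd(1,2)]])
    have le: "norm (B (Y n) x) \<le> A x * S" if x: "x \<in> {c..d}" for n x
      using order_trans[OF Bnorm[of "Y n" x] mult_left_mono[OF Ybd[OF xJ[OF x] K[OF x], of n] A[of x]]] unfolding S_def .
    have lim: "(\<lambda>n. B (Y n) x) \<longlonglongrightarrow> B L x" if x: "x \<in> {c..d}" for x
      unfolding B_def by (intro tendsto_intros conv[OF xJ[OF x]])
    have leL: "norm (B L x) \<le> A x * S" if x: "x \<in> {c..d}" for x
      by (rule LIMSEQ_le_const2[OF tendsto_norm[OF lim[OF x]]]) (use le[OF x] in blast)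
    have ab: "B L absolutely_integrable_on {c..d}"
      by (rule dominated_convergence_absolutely_integrable[OF Bi hi leL lim])
    have "(\<lambda>n. integral {c..d} (B (Y n))) \<longlonglongrightarrow> integral {c..d} (B L)"
      by (rule dominated_convergence(2)[OF set_lebesgue_integral_eq_integral(1)[OF Bi] hi le lim])
    moreover have "integral {c..d} (B (Y n)) = Y (Suc n) d - Y (Suc n) c" for n by (rule primitiveD[OF YP(1) cd])
    ultimately have "(\<lambda>n. Y (Suc n) d - Y (Suc n) c) \<longlonglongrightarrow> integral {c..d} (B L)" by simp
    moreover have "(\<lambda>n. Y (Suc n) d - Y (Suc n) c) \<longlonglongrightarrow> L d - L c"
      by (intro tendsto_diff LIMSEQ_Suc conv cd)
    ultimately show ?thesis using ab LIMSEQ_unique by blast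
  qed
  have LP: "primitive a b L (B L)"
    unfolding primitive_def loc_integrable_def
  proof (intro conjI ballI impI)
    fix c d assume cd: "c \<in> ?J" "d \<in> ?J"
    show "B L absolutely_integrable_on {c..d}" using dom[OF cd] by (cases "c \<le> d") auto
  next
    fix c d assume cd: "c \<in> ?J" "d \<in> ?J" "c \<le> d"
    then show "integral {c..d} (B L) = L d - L c" using dom by blast
  qed
  have "(\<lambda>n. Y (Suc n) x0) \<longlonglongrightarrow> L x0" by (rule LIMSEQ_Suc[OF conv[OF x0]])
  then have Lx0: "L x0 = (u0, v0)" by (simp add: YP(2) LIMSEQ_const_iff)
  show thesis
  proof (rule that)
    show "primitive a b (\<lambda>x. fst (L x)) (\<lambda>x. P x * snd (L x))"
      using primitive_bounded_linear[OF bounded_linear_fst LP] by (simp add: B_def)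
    show "primitive a b (\<lambda>x. snd (L x)) (\<lambda>x. Q x * fst (L x))"
      using primitive_bounded_linear[OF bounded_linear_snd LP] by (simp add: B_def)
  qed (simp_all add: Lx0)
qed


context sturm_liouville
begin

section \<open>Homogeneous solutions and variation of constants\<close>

lemma homogeneous_solution_exists:
  assumes x0: "x0 \<in> J"
  obtains y v where "sl_system y v (\<lambda>x. 0)" "y x0 = u0" "v x0 = v0"
proof -
  obtain u v where uv: "primitive a b u (\<lambda>x. complex_of_real (1 / p x) * v x)" "primitive a b v (\<lambda>x. complex_of_real (q x) * u x)"
    "u x0 = u0" "v x0 = v0"
    using linear_system_exists[OF loc_integrable_coefficients(1,2) x0] .
  have "sl_system u v (\<lambda>x. 0)" unfolding sl_system_def using uv(1,2) by simp
  then show thesis using that uv by blast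
qed

lemma wronskian_constant:
  assumes "sl_system y1 v1 (\<lambda>x. 0)" "sl_system y2 v2 (\<lambda>x. 0)" "x \<in> J" "x0 \<in> J"
  shows "wronskian y1 v1 y2 v2 x = wronskian y1 v1 y2 v2 x0"
proof -
  have W: "primitive a b (wronskian y1 v1 y2 v2) (\<lambda>x. 0)" using wronskian_primitive[OF assms(1,2)] by simp
  show ?thesis using primitiveD[OF W assms(3,4)] primitiveD[OF W assms(4,3)] by (cases "x \<le> x0") auto
qed

text \<open>The terms with the derivatives of \<open>A1\<close> and \<open>A2\<close> cancel in the
  first equation and combine to \<open>- r k\<close> times the Wronskian in the second, which is why
  the Wronskian is normalised to 1.\<close>

lemma variation_of_constants:
  assumes y: "sl_system y1 v1 (\<lambda>x. 0)" "sl_system y2 v2 (\<lambda>x. 0)" and W: "\<And>x. x \<in> J \<Longrightarrow> wronskian y1 v1 y2 v2 x = 1"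
    and A: "primitive a b A1 (\<lambda>x. complex_of_real (r x) * (k x * y1 x))" "primitive a b A2 (\<lambda>x. complex_of_real (r x) * (k x * y2 x))"
  shows "sl_system (\<lambda>x. y1 x * A2 x - y2 x * A1 x) (\<lambda>x. v1 x * A2 x - v2 x * A1 x) k"
proof -
  note y' = y[unfolded sl_system_def]
  have J: "AE x in lebesgue_on J. x \<in> J" by (rule AE_I2) simp
  have diff: "primitive a b (\<lambda>x. f x - g x) (\<lambda>x. f' x - g' x)" if "primitive a b f f'" "primitive a b g g'"
    for f g f' g' :: "real \<Rightarrow> complex"
    using primitive_add[OF that(1) primitive_bounded_linear[OF bounded_linear_minus[OF bounded_linear_ident] that(2)]] by simp
  have "primitive a b (\<lambda>x. y1 x * A2 x - y2 x * A1 x) (\<lambda>x. (v1 x * A2 x - v2 x * A1 x) / complex_of_real (p x))"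
    by (rule primitive_cong_AE[OF diff[OF primitive_mult[OF conjunct1[OF y'(1)] A(2)] primitive_mult[OF conjunct1[OF y'(2)] A(1)]]])
      (auto simp: diff_divide_distrib algebra_simps)
  moreover have "primitive a b (\<lambda>x. v1 x * A2 x - v2 x * A1 x)
      (\<lambda>x. complex_of_real (q x) * (y1 x * A2 x - y2 x * A1 x) - complex_of_real (r x) * k x)"
  proof (rule primitive_cong_AE[OF diff[OF primitive_mult[OF conjunct2[OF y'(1)] A(2)] primitive_mult[OF conjunct2[OF y'(2)] A(1)]]])
    show "AE x in lebesgue_on J. v1 x * (complex_of_real (r x) * (k x * y2 x)) + (complex_of_real (q x) * y1 x - complex_of_real (r x) * 0) * A2 x -
        (v2 x * (complex_of_real (r x) * (k x * y1 x)) + (complex_of_real (q x) * y2 x - complex_of_real (r x) * 0) * A1 x) =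
        complex_of_real (q x) * (y1 x * A2 x - y2 x * A1 x) - complex_of_real (r x) * k x"
      using J
    proof eventually_elim
      case (elim x)
      have w: "y1 x * v2 x - v1 x * y2 x = 1" using W[OF elim] by (simp add: wronskian_def)
      have "v1 x * (complex_of_real (r x) * (k x * y2 x)) + (complex_of_real (q x) * y1 x - complex_of_real (r x) * 0) * A2 x -
        (v2 x * (complex_of_real (r x) * (k x * y1 x)) + (complex_of_real (q x) * y2 x - complex_of_real (r x) * 0) * A1 x) =
        complex_of_real (q x) * (y1 x * A2 x - y2 x * A1 x) - complex_of_real (r x) * k x * (y1 x * v2 x - v1 x * y2 x)"
        by (simp add: algebra_simps)
      then show ?case unfolding w by simp
    qed
  qed simp
  ultimately show ?thesis by (simp add: sl_system_def)
qed

lemma L2_restrict: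
  assumes "f \<in> L2 M" shows "(\<lambda>x. indicator {c..d} x * f x) \<in> L2 M"
proof -
  have m: "(\<lambda>x. indicator {c..d} x * f x) \<in> borel_measurable M"
  proof (rule borel_measurable_times)
    have "(indicator {c..d} :: real \<Rightarrow> complex) \<in> borel_measurable (lebesgue_on J)"
      by (intro measurable_restrict_space1 measurable_completion borel_measurable_indicator) simp
    then show "(indicator {c..d} :: real \<Rightarrow> complex) \<in> borel_measurable M" by (simp add: borel_measurable_M)
  qed (rule L2_measurable[OF assms])
  have "integrable M (\<lambda>x. (cmod (indicator {c..d} x * f x))\<^sup>2)"
  proof (rule Bochner_Integration.integrable_bound[OF L2_integrable[OF assms]])
    show "(\<lambda>x. (cmod (indicator {c..d} x * f x))\<^sup>2) \<in> borel_measurable M" using m by measurable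
    show "AE x in M. norm ((cmod (indicator {c..d} x * f x))\<^sup>2) \<le> norm ((cmod (f x))\<^sup>2)"
      by (intro AE_I2) (simp add: indicator_def)
  qed
  then show ?thesis using m by (simp add: L2_def)
qed

text \<open>On \<open>{c..d}\<close> the function is bounded and \<open>r\<close> is integrable.
  This is the source of compactly supported elements of \<open>L2 M\<close>.\<close>

lemma L2_continuous_restrict:
  assumes f: "continuous_on J f" and cd: "c \<in> J" "d \<in> J"
  shows "(\<lambda>x. indicator {c..d} x * f x) \<in> L2 M"
proof -
  have fm: "f \<in> borel_measurable (lebesgue_on J)" by (rule continuous_imp_measurable_on_sets_lebesgue[OF f]) simp
  have im: "(indicator {c..d} :: real \<Rightarrow> complex) \<in> borel_measurable (lebesgue_on J)"
    by (intro measurable_restrict_space1 measurable_completion borel_measurable_indicator) simp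
  have m: "(\<lambda>x. indicator {c..d} x * f x) \<in> borel_measurable (lebesgue_on J)" using im fm by (rule borel_measurable_times)
  have m2: "(\<lambda>x. (cmod (indicator {c..d} x * f x))\<^sup>2) \<in> borel_measurable (lebesgue_on J)" using m by measurable
  have sub: "{c..d} \<subseteq> J" by (rule einterval_Icc_subset[OF cd])
  have cont: "continuous_on {c..d} f" using f sub by (rule continuous_on_subset)
  have "bounded (f ` {c..d})" using cont by (auto intro!: compact_imp_bounded compact_continuous_image)
  then obtain K where "\<forall>y\<in>f ` {c..d}. norm y \<le> K" unfolding bounded_iff by blast
  then have K: "\<And>x. x \<in> {c..d} \<Longrightarrow> norm (f x) \<le> K" by blast
  have nn: "AE x in lebesgue_on J. 0 \<le> r x" using AE_r_pos by eventually_elim simp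
  have ri: "integrable (lebesgue_on J) (\<lambda>x. indicat_real {c..d} x * (norm (r x) * K\<^sup>2))"
  proof -
    have "(\<lambda>x. complex_of_real (r x)) absolutely_integrable_on {c..d}"
      by (rule loc_integrableD[OF loc_integrable_coefficients(3) cd])
    then have "(\<lambda>x. norm (complex_of_real (r x))) absolutely_integrable_on {c..d}" by (rule absolutely_integrable_norm[unfolded o_def])
    then have "set_integrable lebesgue {c..d} (\<lambda>x. norm (r x) * K\<^sup>2)" by simp
    then have "integrable lebesgue (\<lambda>x. indicator J x *\<^sub>R (indicator {c..d} x * (norm (r x) * K\<^sup>2)))"
      unfolding set_integrable_def
      by (rule Bochner_Integration.integrable_cong[THEN iffD1, rotated 2]) (use sub in \<open>auto simp: indicator_def\<close>)
    then show ?thesis by (simp add: integrable_restrict_space)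
  qed
  have "integrable (lebesgue_on J) (\<lambda>x. r x *\<^sub>R (cmod (indicator {c..d} x * f x))\<^sup>2)"
  proof (rule Bochner_Integration.integrable_bound[OF ri])
    show "(\<lambda>x. r x *\<^sub>R (cmod (indicator {c..d} x * f x))\<^sup>2) \<in> borel_measurable (lebesgue_on J)"
      using r_measurable m2 by measurable
    have "norm (r x *\<^sub>R (cmod (indicator {c..d} x * f x))\<^sup>2) \<le> norm (indicat_real {c..d} x * (norm (r x) * K\<^sup>2))" for x
    proof (cases "x \<in> {c..d}")
      case True
      have "(cmod (f x))\<^sup>2 \<le> K\<^sup>2" by (rule power_mono[OF K[OF True]]) simp
      then show ?thesis using True by (simp add: abs_mult mult_left_mono)
    qed simp
    then show "AE x in lebesgue_on J. norm (r x *\<^sub>R (cmod (indicator {c..d} x * f x))\<^sup>2) \<le> norm (indicat_real {c..d} x * (norm (r x) * K\<^sup>2))"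
      by (intro AE_I2)
  qed
  then have "integrable M (\<lambda>x. (cmod (indicator {c..d} x * f x))\<^sup>2)"
    unfolding weighted_def using integrable_density[OF m2 r_measurable nn] by simp
  then show ?thesis using m by (simp add: L2_def borel_measurable_M)
qed

lemma loc_integrable_weighted_L2:
  assumes k: "k \<in> L2 M" and f: "continuous_on J f"
  shows "loc_integrable a b (\<lambda>x. complex_of_real (r x) * (k x * f x))"
  unfolding loc_integrable_def
proof (intro ballI)
  fix c d assume cd: "c \<in> J" "d \<in> J"
  have "(\<lambda>x. complex_of_real (r x) * (k x * (indicator {c..d} x * f x))) absolutely_integrable_on J"
    by (rule L2_mult_weighted(1)[OF k L2_continuous_restrict[OF f cd]])
  then have "(\<lambda>x. complex_of_real (r x) * (k x * (indicator {c..d} x * f x))) absolutely_integrable_on {c..d}"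
    by (rule set_integrable_subset) (use einterval_Icc_subset[OF cd] in auto)
  then show "(\<lambda>x. complex_of_real (r x) * (k x * f x)) absolutely_integrable_on {c..d}"
    by (rule absolutely_integrable_spike[OF _ negligible_empty]) simp
qed

lemma L2_project:
  assumes Y: "Y \<in> L2 M" and x: "x \<in> L2 M"
  shows "\<exists>t. L2_inner M Y (\<lambda>s. x s - t * Y s) = 0"
proof (cases "L2_norm M Y = 0")
  case True
  then have "cmod (L2_inner M Y (\<lambda>s. x s - 0 * Y s)) \<le> 0"
    using L2_Cauchy_Schwarz[OF Y x] by simp
  then show ?thesis by (intro exI[of _ 0]) simp
next
  case False
  define t where "t = L2_inner M Y x / L2_inner M Y Y"
  have nz: "L2_inner M Y Y \<noteq> 0" using False by (simp add: L2_inner_self)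
  have "L2_inner M Y (\<lambda>s. x s - t * Y s) = L2_inner M Y x - t * L2_inner M Y Y"
    by (simp only: L2_inner_diff_right[OF Y x L2_cmult[OF Y]] L2_inner_cmult_right)
  then have "L2_inner M Y (\<lambda>s. x s - t * Y s) = 0" using nz by (simp add: t_def)
  then show ?thesis by blast
qed

text \<open>Gram-Schmidt. Projecting in two steps avoids inverting a Gram matrix that may be
  singular.\<close>

lemma L2_project2:
  assumes Y: "Y1 \<in> L2 M" "Y2 \<in> L2 M" and x: "x \<in> L2 M"
  shows "\<exists>\<alpha> \<beta>. L2_inner M Y1 (\<lambda>s. x s - (\<alpha> * Y1 s + \<beta> * Y2 s)) = 0 \<and> L2_inner M Y2 (\<lambda>s. x s - (\<alpha> * Y1 s + \<beta> * Y2 s)) = 0"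
proof -
  obtain t where t: "L2_inner M Y1 (\<lambda>s. Y2 s - t * Y1 s) = 0" using L2_project[OF Y] by blast
  define Z where "Z s = Y2 s - t * Y1 s" for s
  have Z: "Z \<in> L2 M" unfolding Z_def by (rule L2_diff[OF Y(2) L2_cmult[OF Y(1)]])
  obtain s where s: "L2_inner M Y1 (\<lambda>x'. x x' - s * Y1 x') = 0" using L2_project[OF Y(1) x] by blast
  define x1 where "x1 u = x u - s * Y1 u" for u
  have x1: "x1 \<in> L2 M" unfolding x1_def by (rule L2_diff[OF x L2_cmult[OF Y(1)]])
  obtain \<beta> where b: "L2_inner M Z (\<lambda>u. x1 u - \<beta> * Z u) = 0" using L2_project[OF Z x1] by blast
  define E where "E u = x1 u - \<beta> * Z u" for u
  have E: "E \<in> L2 M" unfolding E_def by (rule L2_diff[OF x1 L2_cmult[OF Z]])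
  have Y1Z: "L2_inner M Y1 Z = 0" using t unfolding Z_def .
  have Y1x1: "L2_inner M Y1 x1 = 0" using s unfolding x1_def .
  have Y1E: "L2_inner M Y1 E = 0"
    unfolding E_def L2_inner_diff_right[OF Y(1) x1 L2_cmult[OF Z]] L2_inner_cmult_right Y1Z Y1x1 by simp
  have ZE: "L2_inner M Z E = 0" using b unfolding E_def .
  have "L2_inner M Z E = L2_inner M Y2 E - cnj t * L2_inner M Y1 E"
    unfolding Z_def L2_inner_diff_left[OF E Y(2) L2_cmult[OF Y(1)]] L2_inner_cmult_left ..
  then have Y2E: "L2_inner M Y2 E = 0" using ZE Y1E by simp
  have eq: "E = (\<lambda>u. x u - ((s - \<beta> * t) * Y1 u + \<beta> * Y2 u))"
    by (simp add: E_def x1_def Z_def fun_eq_iff algebra_simps)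
  show ?thesis using Y1E Y2E unfolding eq by blast
qed

end

section \<open>The adjoint of the maximal operator\<close>

context sturm_liouville
begin

lemma integral_supported:
  fixes F :: "real \<Rightarrow> complex"
  assumes "\<And>x. x \<in> J \<Longrightarrow> x \<notin> {c..d} \<Longrightarrow> F x = 0" "{c..d} \<subseteq> J"
  shows "integral J F = integral {c..d} F"
proof -
  have "integral J F = integral J (\<lambda>x. if x \<in> {c..d} then F x else 0)"
    using assms(1) by (intro integral_cong) auto
  also have "\<dots> = integral ({c..d} \<inter> J) F" by (rule integral_restrict_Int)
  also have "{c..d} \<inter> J = {c..d}" using assms(2) by blast
  finally show ?thesis .
qed

text \<open>\<open>D\<close> is what remains of \<open>f - h\<close> on \<open>{c..d}\<close> after
  projecting off \<open>y1\<close> and \<open>y2\<close>, and \<open>k\<close> is its conjugate.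
  Orthogonality makes the variation of constants solution \<open>u\<close> of \<tau> u = k vanish
  outside \<open>{c..d}\<close> together with its quasi-derivative, so \<open>u\<close> is an
  admissible test function. Green's formula without boundary terms then turns \<open>orth\<close>, a
  bilinear pairing without conjugation, into \<open><D, D> = 0\<close>.\<close>

lemma orthogonal_range_solution:
  assumes y: "sl_system y1 v1 (\<lambda>x. 0)" "sl_system y2 v2 (\<lambda>x. 0)" and W: "\<And>x. x \<in> J \<Longrightarrow> wronskian y1 v1 y2 v2 x = 1"
    and h: "sl_system h w g" and f: "f \<in> L2 M" and g: "g \<in> L2 M"
    and orth: "\<And>u. u \<in> D_max \<Longrightarrow> (\<integral>x. f x * \<tau> u x \<partial>M) = (\<integral>x. g x * u x \<partial>M)"
    and cd: "c \<in> J" "d \<in> J" "c \<le> d"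
  shows "\<exists>\<alpha> \<beta>. AE x in lebesgue_on J. x \<in> {c..d} \<longrightarrow> f x = h x + (\<alpha> * y1 x + \<beta> * y2 x)"
proof -
  let ?i = "indicator {c..d} :: real \<Rightarrow> complex"
  have sub: "{c..d} \<subseteq> J" by (rule einterval_Icc_subset[OF cd(1,2)])
  note yc = sl_system_continuous(1)[OF y(1)] sl_system_continuous(1)[OF y(2)] and hc = sl_system_continuous(1)[OF h]
  define Y1 where "Y1 x = ?i x * y1 x" for x
  define Y2 where "Y2 x = ?i x * y2 x" for x
  define H where "H x = ?i x * h x" for x
  define E where "E x = ?i x * f x - H x" for x
  have L: "Y1 \<in> L2 M" "Y2 \<in> L2 M" "H \<in> L2 M"
    unfolding Y1_def Y2_def H_def by (rule L2_continuous_restrict[OF _ cd(1,2)], fact)+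
  have EL: "E \<in> L2 M" unfolding E_def by (rule L2_diff[OF L2_restrict[OF f] L(3)])
  obtain \<alpha> \<beta> where ab: "L2_inner M Y1 (\<lambda>s. E s - (\<alpha> * Y1 s + \<beta> * Y2 s)) = 0" "L2_inner M Y2 (\<lambda>s. E s - (\<alpha> * Y1 s + \<beta> * Y2 s)) = 0"
    using L2_project2[OF L(1,2) EL] by blast
  define D where "D s = E s - (\<alpha> * Y1 s + \<beta> * Y2 s)" for s
  have DL: "D \<in> L2 M" unfolding D_def by (rule L2_diff[OF EL L2_add[OF L2_cmult[OF L(1)] L2_cmult[OF L(2)]]])
  define k where "k s = cnj (D s)" for s
  have kL: "k \<in> L2 M" unfolding k_def by (rule L2_cnj[OF DL])
  have k0: "k s = 0" if "s \<notin> {c..d}" for s using that unfolding k_def D_def E_def H_def Y1_def Y2_def by simp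
  have orthY: "(\<integral>s. k s * Y1 s \<partial>M) = 0" "(\<integral>s. k s * Y2 s \<partial>M) = 0"
    using L2_inner_commute[of M D Y1] L2_inner_commute[of M D Y2] ab unfolding L2_inner_def k_def D_def by simp_all
  note lk = loc_integrable_weighted_L2[OF kL yc(1)] loc_integrable_weighted_L2[OF kL yc(2)]
  \<comment> \<open>To the left of \<open>c\<close> the integrand is zero. To the right of
    \<open>d\<close> the integral has collected the whole pairing of \<open>k\<close> with the
    solution, which is zero by orthogonality.\<close>
  have vanish: "B x = 0" if B: "primitive a b B (\<lambda>x. complex_of_real (r x) * (k x * yy x))" "B c = 0"
    and Y: "Y \<in> L2 M" "Y = (\<lambda>x. ?i x * yy x)" "(\<integral>s. k s * Y s \<partial>M) = 0" and x: "x \<in> J" "x \<le> c \<or> d \<le> x" for B yy Y x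
  proof (cases "x \<le> c")
    case True
    have "integral {x..c} (\<lambda>x. complex_of_real (r x) * (k x * yy x)) = integral {x..c} (\<lambda>x. 0)"
      by (rule integral_spike[of "{c}"]) (use k0 in auto)
    then show ?thesis using primitiveD[OF B(1) x(1) cd(1) True] B(2) by simp
  next
    case False
    then have le: "d \<le> x" "c \<le> x" using x(2) cd by auto
    have "integral {c..x} (\<lambda>x. complex_of_real (r x) * (k x * yy x)) = integral {c..x} (\<lambda>x. complex_of_real (r x) * (k x * Y x))"
      by (intro integral_cong) (use k0 in \<open>auto simp: Y(2) indicator_def\<close>)
    also have "\<dots> = integral J (\<lambda>x. complex_of_real (r x) * (k x * Y x))"
      by (rule integral_supported[symmetric]) (use k0 le einterval_Icc_subset[OF cd(1) x(1)] in auto)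
    also have "\<dots> = 0" using L2_mult_weighted(2)[OF kL Y(1)] Y(3) by simp
    finally show ?thesis using primitiveD[OF B(1) cd(1) x(1) le(2)] B(2) by simp
  qed
  obtain B1 where B1: "primitive a b B1 (\<lambda>x. complex_of_real (r x) * (k x * y1 x))" "B1 c = 0"
    using primitive_exists[OF lk(1) cd(1)] .
  obtain B2 where B2: "primitive a b B2 (\<lambda>x. complex_of_real (r x) * (k x * y2 x))" "B2 c = 0"
    using primitive_exists[OF lk(2) cd(1)] .
  have B0: "B1 x = 0" "B2 x = 0" if "x \<in> J" "x \<le> c \<or> d \<le> x" for x
    using vanish[OF B1 L(1) _ orthY(1) that] vanish[OF B2 L(2) _ orthY(2) that] by (simp_all add: Y1_def[abs_def] Y2_def[abs_def])
  define u where "u x = y1 x * B2 x - y2 x * B1 x" for x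
  define v where "v x = v1 x * B2 x - v2 x * B1 x" for x
  have uv: "sl_system u v k" unfolding u_def v_def by (rule variation_of_constants[OF y W B1(1) B2(1)])
  have u0: "u x = 0" "v x = 0" if "x \<in> J" "x \<le> c \<or> d \<le> x" for x unfolding u_def v_def using B0[OF that] by simp_all
  have uL: "u \<in> L2 M"
  proof (rule L2_cong_AE')
    show "(\<lambda>x. ?i x * u x) \<in> L2 M" by (rule L2_continuous_restrict[OF sl_system_continuous(1)[OF uv] cd(1,2)])
    have "?i x * u x = u x" if "x \<in> J" for x
      using u0(1)[OF that] by (cases "x \<le> c \<or> d \<le> x") (auto simp: indicator_def)
    then show "AE x in lebesgue_on J. ?i x * u x = u x" by (intro AE_I2) simp
  qed
  have uD: "u \<in> D_max" by (rule D_maxI[OF uv uL kL])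
  have "(\<integral>x. f x * k x \<partial>M) = (\<integral>x. f x * \<tau> u x \<partial>M)"
  proof (rule integral_cong_AE)
    show "AE x in M. f x * k x = f x * \<tau> u x" unfolding AE_M_iff using sl_system_sl_functions(3)[OF uv] by eventually_elim simp
  qed (intro borel_measurable_times L2_measurable f kL D_max_L2[OF uD])+
  also have "\<dots> = (\<integral>x. g x * u x \<partial>M)" by (rule orth[OF uD])
  \<comment> \<open>Green's formula for \<open>h\<close> and \<open>u\<close> on
    \<open>{c..d}\<close>, where \<tau> h = g and \<tau> u = k; \<open>u\<close> and
    \<open>v\<close> vanish at both endpoints.\<close>
  also have "\<dots> = (\<integral>x. H x * k x \<partial>M)"
  proof -
    have gu: "(\<lambda>x. complex_of_real (r x) * (g x * u x)) integrable_on {c..d}" "(\<lambda>x. complex_of_real (r x) * (H x * k x)) integrable_on {c..d}"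
      using L2_mult_weighted(1)[OF g uL] L2_mult_weighted(1)[OF L(3) kL] sub
      by (auto intro!: set_lebesgue_integral_eq_integral(1) elim!: set_integrable_subset)
    have "(\<integral>x. g x * u x \<partial>M) - (\<integral>x. H x * k x \<partial>M) =
        integral {c..d} (\<lambda>x. complex_of_real (r x) * (g x * u x)) - integral {c..d} (\<lambda>x. complex_of_real (r x) * (H x * k x))"
    proof -
      have "integral J (\<lambda>x. complex_of_real (r x) * (g x * u x)) = integral {c..d} (\<lambda>x. complex_of_real (r x) * (g x * u x))"
        by (rule integral_supported[OF _ sub]) (use u0(1) in auto)
      moreover have "integral J (\<lambda>x. complex_of_real (r x) * (H x * k x)) = integral {c..d} (\<lambda>x. complex_of_real (r x) * (H x * k x))"
        by (rule integral_supported[OF _ sub]) (use k0 in auto)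
      ultimately show ?thesis by (simp add: L2_mult_weighted(2)[OF g uL] L2_mult_weighted(2)[OF L(3) kL])
    qed
    also have "\<dots> = integral {c..d} (\<lambda>x. complex_of_real (r x) * (g x * u x) - complex_of_real (r x) * (H x * k x))"
      by (rule Henstock_Kurzweil_Integration.integral_diff[symmetric, OF gu])
    also have "\<dots> = integral {c..d} (\<lambda>x. complex_of_real (r x) * (g x * u x - h x * k x))"
      by (intro integral_cong) (simp add: H_def algebra_simps)
    also have "\<dots> = wronskian h w u v d - wronskian h w u v c" by (rule primitiveD[OF wronskian_primitive[OF h uv] cd])
    also have "\<dots> = 0" using u0[OF cd(1)] u0[OF cd(2)] by (simp add: wronskian_def)
    finally show ?thesis by simp
  qed
  finally have fk: "(\<integral>x. f x * k x \<partial>M) = (\<integral>x. H x * k x \<partial>M)" .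
  \<comment> \<open>Since \<open>k\<close> vanishes outside \<open>{c..d}\<close>, the restriction
    of \<open>f\<close> may be replaced by \<open>f\<close>; the multiples of \<open>Y1\<close> and
    \<open>Y2\<close> contribute nothing.\<close>
  have "L2_inner M D D = (\<integral>x. (f x * k x - H x * k x) - (\<alpha> * (k x * Y1 x) + \<beta> * (k x * Y2 x)) \<partial>M)"
    unfolding L2_inner_def
  proof (rule Bochner_Integration.integral_cong[OF refl])
    fix x
    have "k x * D x = k x * (f x - H x - (\<alpha> * Y1 x + \<beta> * Y2 x))"
      using k0[of x] by (cases "x \<in> {c..d}") (simp_all add: D_def E_def)
    then show "cnj (D x) * D x = (f x * k x - H x * k x) - (\<alpha> * (k x * Y1 x) + \<beta> * (k x * Y2 x))"
      by (simp add: k_def algebra_simps)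
  qed
  also have "\<dots> = 0"
    by (simp add: L2_mult_integrable f kL L fk orthY)
  finally have "L2_norm M D = 0" by (simp add: L2_inner_self)
  then have "AE x in lebesgue_on J. D x = 0" using L2_norm_eq_0_iff[OF DL] by (simp add: AE_M_iff)
  then have "AE x in lebesgue_on J. x \<in> {c..d} \<longrightarrow> f x = h x + (\<alpha> * y1 x + \<beta> * y2 x)"
    by eventually_elim (auto simp: D_def E_def H_def Y1_def Y2_def algebra_simps)
  then show ?thesis by blast
qed

lemma AE_subinterval:
  assumes "AE x in lebesgue_on J. x \<in> {c..d} \<longrightarrow> P x" "{c..d} \<subseteq> J"
  shows "AE x in lebesgue_on {c<..<d}. P x"
proof -
  have "negligible {x \<in> J. \<not> (x \<in> {c..d} \<longrightarrow> P x)}" using assms(1) by (subst (asm) AE_lebesgue_on_iff_negligible) auto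
  then have "negligible {x \<in> {c<..<d}. \<not> P x}" by (rule negligible_subset) (use assms(2) in auto)
  then show ?thesis by (subst AE_lebesgue_on_iff_negligible) auto
qed

text \<open>The derivative \<open>v / p\<close> of \<open>y\<close> is zero almost everywhere on the
  subinterval, hence so is \<open>v\<close>, and continuity removes the exceptional points.\<close>

lemma solution_vanishing_on_subinterval:
  assumes y: "sl_system y v k" and cd: "c \<in> J" "d \<in> J" and zero: "\<And>x. x \<in> {c<..<d} \<Longrightarrow> y x = 0" and x: "x \<in> {c<..<d}"
  shows "v x = 0"
proof -
  have sub: "{c..d} \<subseteq> J" by (rule einterval_Icc_subset[OF cd])
  have "AE x in lebesgue_on J. (y has_vector_derivative v x / complex_of_real (p x)) (at x)"
    using y primitive_has_vector_derivative_ae unfolding sl_system_def by blast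
  with AE_p_pos have "AE x in lebesgue_on J. 0 < p x \<and> (y has_vector_derivative v x / complex_of_real (p x)) (at x)"
    by eventually_elim simp
  then have "AE x in lebesgue_on {c<..<d}. 0 < p x \<and> (y has_vector_derivative v x / complex_of_real (p x)) (at x)"
    by (intro AE_subinterval[OF _ sub]) (auto elim: eventually_mono)
  moreover have "AE x in lebesgue_on {c<..<d}. x \<in> {c<..<d}" by (rule AE_I2) simp
  ultimately have "AE x in lebesgue_on {c<..<d}. v x = 0"
  proof eventually_elim
    case (elim x)
    have "((\<lambda>x. 0 :: complex) has_vector_derivative 0) (at x)" by (rule has_vector_derivative_const)
    then have "(y has_vector_derivative 0) (at x)"
      by (rule has_vector_derivative_transform_within_open[of _ _ _ "{c<..<d}"]) (use elim zero in auto)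
    then have "v x / complex_of_real (p x) = 0" using elim vector_derivative_unique_at by blast
    then show ?case using elim by simp
  qed
  moreover have "continuous_on {c<..<d} v"
    using sl_system_continuous(2)[OF y] by (rule continuous_on_subset) (use sub in auto)
  ultimately show ?thesis using continuous_on_AE_eq[of "{c<..<d}" v "\<lambda>x. 0" x] x by simp
qed

text \<open>The coefficients found on a compact interval might depend on it. Each interval is
  therefore enlarged to contain a fixed \<open>{c0..d0}\<close>: two representations differ by a
  solution that vanishes there, and its data at \<open>x0\<close> are the differences of the
  coefficients.\<close>

lemma orthogonal_range_D_max:
  assumes f: "f \<in> L2 M" and g: "g \<in> L2 M"
    and orth: "\<And>u. u \<in> D_max \<Longrightarrow> (\<integral>x. f x * \<tau> u x \<partial>M) = (\<integral>x. g x * u x \<partial>M)"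
  obtains F where "F \<in> D_max" "AE x in M. f x = F x" "AE x in M. g x = \<tau> F x"
proof -
  obtain x0 where x0: "x0 \<in> J" using einterval_nonempty[OF ab] by blast
  obtain e where e: "e > 0" "ball x0 e \<subseteq> J" using open_contains_ball x0 by (metis open_einterval)
  define c0 where "c0 = x0 - e / 2"
  define d0 where "d0 = x0 + e / 2"
  have cd0: "c0 \<in> J" "d0 \<in> J" "c0 < x0" "x0 < d0"
    using e by (auto simp: subset_eq dist_real_def c0_def d0_def)
  \<comment> \<open>These initial values give Wronskian 1 and let the coefficients of a combination
    be read off at \<open>x0\<close>.\<close>
  obtain y1 v1 where y1: "sl_system y1 v1 (\<lambda>x. 0)" "y1 x0 = 1" "v1 x0 = 0" using homogeneous_solution_exists[OF x0] .
  obtain y2 v2 where y2: "sl_system y2 v2 (\<lambda>x. 0)" "y2 x0 = 0" "v2 x0 = 1" using homogeneous_solution_exists[OF x0] .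
  have W: "wronskian y1 v1 y2 v2 x = 1" if "x \<in> J" for x
    using wronskian_constant[OF y1(1) y2(1) that x0] y1 y2 by (simp add: wronskian_def)
  obtain A1 where A1: "primitive a b A1 (\<lambda>x. complex_of_real (r x) * (g x * y1 x))" "A1 x0 = 0"
    using primitive_exists[OF loc_integrable_weighted_L2[OF g sl_system_continuous(1)[OF y1(1)]] x0] .
  obtain A2 where A2: "primitive a b A2 (\<lambda>x. complex_of_real (r x) * (g x * y2 x))" "A2 x0 = 0"
    using primitive_exists[OF loc_integrable_weighted_L2[OF g sl_system_continuous(1)[OF y2(1)]] x0] .
  obtain h w where h: "sl_system h w g" using variation_of_constants[OF y1(1) y2(1) W A1(1) A2(1)] by blast
  have loc: "\<exists>\<alpha> \<beta>. AE x in lebesgue_on J. x \<in> {c..d} \<longrightarrow> f x = h x + (\<alpha> * y1 x + \<beta> * y2 x)"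
    if "c \<in> J" "d \<in> J" "c \<le> d" for c d
    by (rule orthogonal_range_solution[OF y1(1) y2(1) W h f g orth that])
  obtain \<alpha> \<beta> where ab0: "AE x in lebesgue_on J. x \<in> {c0..d0} \<longrightarrow> f x = h x + (\<alpha> * y1 x + \<beta> * y2 x)"
    using loc[OF cd0(1,2)] cd0 by auto
  have ae: "AE x in lebesgue_on J. f x = h x + (\<alpha> * y1 x + \<beta> * y2 x)"
    unfolding AE_einterval_iff
  proof (intro ballI)
    fix c d assume cd: "c \<in> J" "d \<in> J"
    define c' where "c' = min c c0"
    define d' where "d' = max d d0"
    have cd': "c' \<in> J" "d' \<in> J" "c' \<le> d'" "c' \<le> c0" "d0 \<le> d'" "c' \<le> c" "d \<le> d'"
      using cd cd0 by (auto simp: c'_def d'_def min_def max_def)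
    obtain \<alpha>' \<beta>' where ab': "AE x in lebesgue_on J. x \<in> {c'..d'} \<longrightarrow> f x = h x + (\<alpha>' * y1 x + \<beta>' * y2 x)"
      using loc[OF cd'(1-3)] by auto
    define z where "z x = (\<alpha> - \<alpha>') * y1 x + (\<beta> - \<beta>') * y2 x" for x
    define zv where "zv x = (\<alpha> - \<alpha>') * v1 x + (\<beta> - \<beta>') * v2 x" for x
    have zs: "sl_system z zv (\<lambda>x. 0)"
      using sl_system_add[OF sl_system_cmult[OF y1(1), of "\<alpha> - \<alpha>'"] sl_system_cmult[OF y2(1), of "\<beta> - \<beta>'"]]
      unfolding z_def zv_def by simp
    have sub0: "{c0..d0} \<subseteq> J" by (rule einterval_Icc_subset[OF cd0(1,2)])
    have "AE x in lebesgue_on J. x \<in> {c0..d0} \<longrightarrow> z x = 0"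
      using ab0 ab' by eventually_elim (use cd' in \<open>auto simp: z_def algebra_simps\<close>)
    then have "AE x in lebesgue_on {c0<..<d0}. z x = 0" by (rule AE_subinterval[OF _ sub0])
    moreover have "continuous_on {c0<..<d0} z"
      using sl_system_continuous(1)[OF zs] by (rule continuous_on_subset) (use sub0 in auto)
    ultimately have z0: "z x = 0" if "x \<in> {c0<..<d0}" for x
      using continuous_on_AE_eq[of "{c0<..<d0}" z "\<lambda>x. 0" x] that by simp
    have "zv x0 = 0" using solution_vanishing_on_subinterval[OF zs cd0(1,2) z0, of x0] cd0 by simp
    moreover have "z x0 = 0" using z0[of x0] cd0 by simp
    ultimately have eq: "\<alpha>' = \<alpha>" "\<beta>' = \<beta>" using y1 y2 by (auto simp: z_def zv_def)
    have "negligible {x \<in> J. \<not> (x \<in> {c'..d'} \<longrightarrow> f x = h x + (\<alpha> * y1 x + \<beta> * y2 x))}"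
      using ab' unfolding eq by (subst (asm) AE_lebesgue_on_iff_negligible) auto
    then show "negligible {x \<in> {c..d}. f x \<noteq> h x + (\<alpha> * y1 x + \<beta> * y2 x)}"
      by (rule negligible_subset) (use cd' einterval_Icc_subset[OF cd] in auto)
  qed
  define F where "F x = h x + (\<alpha> * y1 x + \<beta> * y2 x)" for x
  have Fs: "sl_system F (\<lambda>x. w x + (\<alpha> * v1 x + \<beta> * v2 x)) g"
    using sl_system_add[OF h sl_system_add[OF sl_system_cmult[OF y1(1), of \<alpha>] sl_system_cmult[OF y2(1), of \<beta>]]]
    unfolding F_def by simp
  have FL: "F \<in> L2 M" by (rule L2_cong_AE'[OF f]) (use ae in \<open>simp add: F_def\<close>)
  show thesis
  proof (rule that)
    show "F \<in> D_max" by (rule D_maxI[OF Fs FL g])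
    show "AE x in M. f x = F x" unfolding AE_M_iff using ae by (simp add: F_def)
    show "AE x in M. g x = \<tau> F x" unfolding AE_M_iff using sl_system_sl_functions(3)[OF Fs] by eventually_elim simp
  qed
qed

section \<open>The limit point case\<close>

lemma eventually_at_left_J:
  assumes "eventually P (at_left b)"
  obtains c where "c \<in> J" "\<And>t. t \<in> J \<Longrightarrow> c \<le> t \<Longrightarrow> P (ereal t)"
proof -
  obtain s where s: "s < b" "\<And>y. s < y \<Longrightarrow> y < b \<Longrightarrow> P y"
    using assms unfolding eventually_at_left[OF ab] by blast
  have "max a s < b" using s(1) ab by simp
  then obtain c where c: "c \<in> einterval (max a s) b" using einterval_nonempty by blast
  show thesis
  proof (rule that)
    show "c \<in> J" using c by (simp add: einterval_iff)
    fix t assume t: "t \<in> J" "c \<le> t"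
    have "s < ereal t" using c t(2) less_le_trans[of s "ereal c" "ereal t"] by (simp add: einterval_iff)
    then show "P (ereal t)" using s(2) t by (simp add: einterval_iff)
  qed
qed

text \<open>A primitive of \<open>K\<close> has a limit at \<open>b\<close>, so its increments near
  \<open>b\<close> are small.\<close>

lemma small_tail:
  fixes K :: "real \<Rightarrow> real"
  assumes K: "K absolutely_integrable_on J" "\<epsilon> > 0"
  obtains c where "c \<in> J" "\<And>s t. s \<in> J \<Longrightarrow> t \<in> J \<Longrightarrow> c \<le> s \<Longrightarrow> s \<le> t \<Longrightarrow> integral {s..t} K < \<epsilon>"
proof -
  have loc: "loc_integrable a b K"
    unfolding loc_integrable_def using K(1) einterval_Icc_subset[of _ a b] by (auto intro!: set_integrable_subset[OF K(1)])
  obtain x0 where x0: "x0 \<in> J" using einterval_nonempty[OF ab] by blast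
  obtain P where P: "primitive a b P K" using primitive_exists[OF loc x0] .
  obtain La Lb where "((P \<circ> real_of_ereal) \<longlongrightarrow> Lb) (at_left b)" using primitive_limits[OF P K(1) ab] by blast
  then have "eventually (\<lambda>t. dist ((P \<circ> real_of_ereal) t) Lb < \<epsilon> / 2) (at_left b)" by (rule tendstoD) (use K(2) in simp)
  then obtain c where c: "c \<in> J" "\<And>t. t \<in> J \<Longrightarrow> c \<le> t \<Longrightarrow> dist (P t) Lb < \<epsilon> / 2" by (rule eventually_at_left_J) simp
  show thesis
  proof (rule that[OF c(1)])
    fix s t assume st: "s \<in> J" "t \<in> J" "c \<le> s" "s \<le> t"
    show "integral {s..t} K < \<epsilon>"
      using primitiveD[OF P st(1,2,4)] c(2)[OF st(1,3)] c(2)[OF st(2) order_trans[OF st(3,4)]] unfolding dist_real_def by linarith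
  qed
qed

text \<open>If \<open>W(f, G)\<close> had a nonzero limit at \<open>b\<close>, then by the Pluecker identity
  \<open>y W(f, G) = f W(y, G) - G W(y, f)\<close> the functions \<open>W(y, G)\<close> and \<open>W(y, f)\<close> would satisfy a linear
  system with coefficients integrable up to \<open>b\<close>, hence be bounded, for every solution \<open>y\<close>; then
  \<open>y\<close> would be square integrable near \<open>b\<close>.\<close>

lemma wronskian_limit_zero:
  assumes lp: "limit_point_right a b p q r"
    and f: "sl_system f v k" "f \<in> L2 M" "k \<in> L2 M" and G: "sl_system G u l" "G \<in> L2 M" "l \<in> L2 M"
    and lim: "((wronskian f v G u \<circ> real_of_ereal) \<longlongrightarrow> L) (at_left b)"
  shows "L = 0"
proof (rule ccontr)
  assume L: "L \<noteq> 0"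
  \<comment> \<open>Half the modulus of the limit: near \<open>b\<close> the Wronskian stays at
    least \<open>m\<close> in modulus, so the identity for \<open>y\<close> can be divided by
    it.\<close>
  define m where "m = norm L / 2"
  have m: "m > 0" using L by (simp add: m_def)
  have "eventually (\<lambda>t. dist ((wronskian f v G u \<circ> real_of_ereal) t) L < m) (at_left b)"
    using lim m by (rule tendstoD)
  then obtain c1 where c1: "c1 \<in> J" "\<And>t. t \<in> J \<Longrightarrow> c1 \<le> t \<Longrightarrow> dist (wronskian f v G u t) L < m"
    by (rule eventually_at_left_J) simp
  have Wm: "m \<le> norm (wronskian f v G u t)" if "t \<in> J" "c1 \<le> t" for t
    using c1(2)[OF that] norm_triangle_ineq2[of L "L - wronskian f v G u t"]
    by (simp add: dist_norm m_def norm_minus_commute)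
  obtain y where y: "sl_solution a b p q r 0 y"
    "\<not> (\<exists>c\<in>J. set_integrable M {c<..} (\<lambda>x. (cmod (y x))\<^sup>2))"
    using lp unfolding limit_point_right_def by blast
  define z where "z = quasi_deriv a b p y"
  have ys: "sl_system y z (\<lambda>x. 0)"
    unfolding z_def using y(1)
    by (intro sl_system_cong[OF sl_functions_sl_system]) (auto simp: sl_solution_def)
  define U where "U = wronskian y z G u"
  define V where "V = wronskian y z f v"
  have U: "primitive a b U (\<lambda>x. complex_of_real (r x) * (0 * G x - y x * l x))" unfolding U_def by (rule wronskian_primitive[OF ys G(1)])
  have V: "primitive a b V (\<lambda>x. complex_of_real (r x) * (0 * f x - y x * k x))" unfolding V_def by (rule wronskian_primitive[OF ys f(1)])
  have yle: "norm (y t) \<le> (norm (f t) + norm (G t)) * S / m" if t: "t \<in> J" "c1 \<le> t" "norm (U t) + norm (V t) \<le> S" for t S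
  proof -
    have "y t * wronskian f v G u t = f t * U t - G t * V t"
      by (simp add: U_def V_def wronskian_def algebra_simps)
    then have "norm (y t) * norm (wronskian f v G u t) \<le> norm (f t) * norm (U t) + norm (G t) * norm (V t)"
      by (metis norm_mult norm_triangle_ineq4)
    moreover have "norm (y t) * m \<le> norm (y t) * norm (wronskian f v G u t)" by (intro mult_left_mono Wm t) simp
    moreover have "norm (U t) \<le> S" "norm (V t) \<le> S"
      using t(3) norm_ge_zero[of "U t"] norm_ge_zero[of "V t"] by linarith+
    then have "norm (f t) * norm (U t) \<le> norm (f t) * S" "norm (G t) * norm (V t) \<le> norm (G t) * S"
      by (intro mult_left_mono; simp)+
    ultimately show ?thesis using m by (simp add: field_simps)
  qed
  \<comment> \<open>When \<open>|y|\<close> is at most \<open>(|f| + |G|) S / m\<close>, the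
    integrand \<open>r y n\<close> in an increment of \<open>U\<close> or \<open>V\<close> is at
    most \<open>\<kappa> n\<close> times \<open>S\<close> in modulus.\<close>
  define \<kappa> where "\<kappa> n x = (norm (complex_of_real (r x) * (f x * n x)) + norm (complex_of_real (r x) * (G x * n x))) / m" for n :: "real \<Rightarrow> complex" and x
  have \<kappa>i: "\<kappa> n absolutely_integrable_on J" if "n \<in> L2 M" for n
    unfolding \<kappa>_def
    by (intro set_integrable_divide set_integral_add absolutely_integrable_norm[unfolded o_def] L2_mult_weighted(1) f G that)
  \<comment> \<open>\<open>U\<close> and \<open>V\<close> each change by at most a quarter of the
    maximum of \<open>s\<close>, together by half of it, which leaves the bound
    \<open>2 * s c\<close>.\<close>
  have quarter: "(0::real) < 1/4" by simp
  obtain c2 where c2: "c2 \<in> J" "\<And>s t. s \<in> J \<Longrightarrow> t \<in> J \<Longrightarrow> c2 \<le> s \<Longrightarrow> s \<le> t \<Longrightarrow> integral {s..t} (\<kappa> l) < 1/4"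
  proof (rule small_tail[OF \<kappa>i[OF G(3)] quarter])
    fix c assume "c \<in> J" "\<And>s t. s \<in> J \<Longrightarrow> t \<in> J \<Longrightarrow> c \<le> s \<Longrightarrow> s \<le> t \<Longrightarrow> integral {s..t} (\<kappa> l) < 1/4"
    then show thesis by (rule that)
  qed
  obtain c3 where c3: "c3 \<in> J" "\<And>s t. s \<in> J \<Longrightarrow> t \<in> J \<Longrightarrow> c3 \<le> s \<Longrightarrow> s \<le> t \<Longrightarrow> integral {s..t} (\<kappa> k) < 1/4"
  proof (rule small_tail[OF \<kappa>i[OF f(3)] quarter])
    fix c assume "c \<in> J" "\<And>s t. s \<in> J \<Longrightarrow> t \<in> J \<Longrightarrow> c \<le> s \<Longrightarrow> s \<le> t \<Longrightarrow> integral {s..t} (\<kappa> k) < 1/4"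
    then show thesis by (rule that)
  qed
  define c where "c = max c1 (max c2 c3)"
  have cJ: "c \<in> J" and cge: "c1 \<le> c" "c2 \<le> c" "c3 \<le> c" using c1 c2 c3 by (auto simp: c_def max_def)
  define s where "s t = norm (U t) + norm (V t)" for t
  have sc: "continuous_on J s" unfolding s_def by (intro continuous_intros primitive_continuous_on[OF U] primitive_continuous_on[OF V])
  have sle: "s x \<le> 2 * s c" if x: "x \<in> J" "c \<le> x" for x
  proof -
    have sub: "{c..x} \<subseteq> J" by (rule einterval_Icc_subset[OF cJ x(1)])
    \<comment> \<open>At a maximiser \<open>t\<close> of \<open>s\<close> the unknown bound occurs
      on both sides and can be absorbed.\<close>
    have "\<exists>t\<in>{c..x}. \<forall>t'\<in>{c..x}. s t' \<le> s t"
      using x(2) by (intro continuous_attains_sup continuous_on_subset[OF sc sub]) auto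
    then obtain t where t: "t \<in> {c..x}" "\<And>t'. t' \<in> {c..x} \<Longrightarrow> s t' \<le> s t" by blast
    have tJ: "t \<in> J" "c \<le> t" using t(1) sub by auto
    have S0: "0 \<le> s t" by (simp add: s_def)
    have step: "norm (Q t - Q c) \<le> s t / 4"
      if Q: "primitive a b Q (\<lambda>x. complex_of_real (r x) * (0 * F x - y x * n x))" and n: "n \<in> L2 M" "integral {c..t} (\<kappa> n) < 1/4" for Q F n
    proof -
      have ki: "\<kappa> n integrable_on {c..t}"
        using set_integrable_subset[OF \<kappa>i[OF n(1)], of "{c..t}"] einterval_Icc_subset[OF cJ tJ(1)]
        by (intro set_lebesgue_integral_eq_integral(1)) auto
      have "norm (Q t - Q c) = norm (integral {c..t} (\<lambda>x. complex_of_real (r x) * (0 * F x - y x * n x)))"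
        using primitiveD[OF Q cJ tJ] by simp
      also have "\<dots> \<le> integral {c..t} (\<lambda>x. \<kappa> n x * s t)"
      proof (rule integral_norm_bound_integral)
        show "(\<lambda>x. complex_of_real (r x) * (0 * F x - y x * n x)) integrable_on {c..t}"
          by (rule loc_integrable_integrable[OF primitive_loc_integrable[OF Q] cJ tJ(1)])
        show "(\<lambda>x. \<kappa> n x * s t) integrable_on {c..t}" by (rule integrable_on_mult_left[OF ki])
        fix x' assume x': "x' \<in> {c..t}"
        then have x'J: "x' \<in> J" "c1 \<le> x'" "x' \<in> {c..x}" using sub t(1) cge by auto
        have "norm (y x') \<le> (norm (f x') + norm (G x')) * s t / m"
          by (rule yle[OF x'J(1,2)]) (use t(2)[OF x'J(3)] in \<open>simp add: s_def\<close>)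
        then have "norm (r x') * norm (n x') * norm (y x') \<le> norm (r x') * norm (n x') * ((norm (f x') + norm (G x')) * s t / m)"
          by (intro mult_left_mono) auto
        then show "norm (complex_of_real (r x') * (0 * F x' - y x' * n x')) \<le> \<kappa> n x' * s t"
          by (simp add: norm_mult \<kappa>_def field_simps)
      qed
      also have "\<dots> = integral {c..t} (\<kappa> n) * s t" by (rule Henstock_Kurzweil_Integration.integral_mult_left)
      also have "\<dots> \<le> 1/4 * s t" using n(2) S0 by (intro mult_right_mono) auto
      finally show ?thesis by simp
    qed
    have "norm (U t - U c) \<le> s t / 4" by (rule step[OF U G(3) c2(2)[OF cJ tJ(1) cge(2) tJ(2)]])
    moreover have "norm (V t - V c) \<le> s t / 4" by (rule step[OF V f(3) c3(2)[OF cJ tJ(1) cge(3) tJ(2)]])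
    moreover have "norm (U t) \<le> norm (U c) + norm (U t - U c)" "norm (V t) \<le> norm (V c) + norm (V t - V c)"
      by (metis add.commute diff_add_cancel norm_triangle_ineq)+
    moreover have "\<mu> + \<nu> \<le> 2 * (\<alpha> + \<beta>)"
      if "\<xi> \<le> (\<mu> + \<nu>) / 4" "\<eta> \<le> (\<mu> + \<nu>) / 4" "\<mu> \<le> \<alpha> + \<xi>" "\<nu> \<le> \<beta> + \<eta>" for \<mu> \<nu> \<alpha> \<beta> \<xi> \<eta> :: real
    proof -
      have "\<mu> + \<nu> \<le> (\<alpha> + \<xi>) + (\<beta> + \<eta>)" by (intro add_mono that)
      also have "\<dots> \<le> (\<alpha> + (\<mu> + \<nu>) / 4) + (\<beta> + (\<mu> + \<nu>) / 4)" by (intro add_mono order_refl that)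
      finally show ?thesis by (simp add: field_simps)
    qed
    ultimately have "s t \<le> 2 * s c" unfolding s_def by blast
    moreover have "s x \<le> s t" using t(2)[of x] x(2) by simp
    ultimately show ?thesis by linarith
  qed
  define B where "B = 2 * s c / m"
  have yB: "norm (y x) \<le> (norm (f x) + norm (G x)) * B" if "x \<in> J" "c \<le> x" for x
    using yle[of x "2 * s c"] sle[OF that] that cge unfolding s_def B_def by simp
  have "set_integrable M {c<..} (\<lambda>x. (cmod (y x))\<^sup>2)"
    unfolding set_integrable_def
  proof (rule Bochner_Integration.integrable_bound)
    show "integrable M (\<lambda>x. 2 * B\<^sup>2 * (cmod (f x))\<^sup>2 + 2 * B\<^sup>2 * (cmod (G x))\<^sup>2)"
      by (intro Bochner_Integration.integrable_add integrable_mult_right L2_integrable f G)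
    have ym: "y \<in> borel_measurable (lebesgue_on J)"
      by (rule continuous_imp_measurable_on_sets_lebesgue[OF sl_system_continuous(1)[OF ys]]) simp
    have im: "(indicator {c<..} :: real \<Rightarrow> real) \<in> borel_measurable (lebesgue_on J)"
      by (intro measurable_restrict_space1 measurable_completion borel_measurable_indicator) simp
    have "(\<lambda>x. indicat_real {c<..} x *\<^sub>R (cmod (y x))\<^sup>2) \<in> borel_measurable (lebesgue_on J)"
      using im ym by measurable
    moreover have "borel_measurable M = (borel_measurable (lebesgue_on J) :: (real \<Rightarrow> real) set)"
      by (rule measurable_cong_sets) (simp_all add: weighted_def)
    ultimately show "(\<lambda>x. indicat_real {c<..} x *\<^sub>R (cmod (y x))\<^sup>2) \<in> borel_measurable M" by simp
    have "norm (indicat_real {c<..} x *\<^sub>R (cmod (y x))\<^sup>2) \<le> norm (2 * B\<^sup>2 * (cmod (f x))\<^sup>2 + 2 * B\<^sup>2 * (cmod (G x))\<^sup>2)" if x: "x \<in> J" for x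
    proof (cases "c < x")
      case True
      have "(cmod (y x))\<^sup>2 \<le> ((norm (f x) + norm (G x)) * B)\<^sup>2" by (rule power_mono[OF yB]) (use x True in auto)
      also have "\<dots> = B\<^sup>2 * (norm (f x) + norm (G x))\<^sup>2" by (simp add: power_mult_distrib)
      also have "\<dots> \<le> B\<^sup>2 * (2 * (norm (f x))\<^sup>2 + 2 * (norm (G x))\<^sup>2)"
        using zero_le_power2[of "norm (f x) - norm (G x)"] by (intro mult_left_mono) (simp_all add: power2_diff power2_sum)
      finally have "(cmod (y x))\<^sup>2 \<le> 2 * B\<^sup>2 * (cmod (f x))\<^sup>2 + 2 * B\<^sup>2 * (cmod (G x))\<^sup>2" by (simp add: algebra_simps)
      then show ?thesis using True by (simp add: abs_of_nonneg)
    qed simp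
    then show "AE x in M. norm (indicat_real {c<..} x *\<^sub>R (cmod (y x))\<^sup>2) \<le> norm (2 * B\<^sup>2 * (cmod (f x))\<^sup>2 + 2 * B\<^sup>2 * (cmod (G x))\<^sup>2)"
      unfolding AE_M_iff by (intro AE_I2) simp
  qed
  then show False using y(2) cJ by blast
qed

lemma Green_limit_point:
  assumes lp: "limit_point_right a b p q r" and f: "f \<in> D_max" and g: "g \<in> D_max"
  shows "L2_inner M g (\<tau> f) - L2_inner M (\<tau> g) f = - bracket_left f g"
proof -
  obtain Lb where Lb: "((lagrange_bracket a b p f g \<circ> real_of_ereal) \<longlongrightarrow> Lb) (at_left b)"
    "L2_inner M g (\<tau> f) - L2_inner M (\<tau> g) f = Lb - bracket_left f g"
    using D_max_bracket_limits[OF f g] .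
  have "Lb = 0"
    by (rule wronskian_limit_zero[OF lp D_max_sl_system[OF f] D_max_L2[OF f] sl_system_cnj[OF D_max_sl_system[OF g]]
          L2_cnj[OF D_max_L2(1)[OF g]] L2_cnj[OF D_max_L2(2)[OF g]] Lb(1)[unfolded lagrange_bracket_wronskian]])
  then show ?thesis using Lb(2) by simp
qed

end

section \<open>Self-adjoint extensions and their resolvents\<close>

locale limit_point_problem = sturm_liouville +
  fixes \<phi> \<psi> :: "real \<Rightarrow> complex"
  assumes basis: "bc_basis_left a b p q r \<phi> \<psi>" and limit_point: "limit_point_right a b p q r"
begin

lemma basis_D_max: "\<phi> \<in> D_max" "\<psi> \<in> D_max"
  and basis_real: "\<And>x. x \<in> J \<Longrightarrow> \<phi> x \<in> \<real>" "\<And>x. x \<in> J \<Longrightarrow> \<psi> x \<in> \<real>"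
  and basis_bracket: "bracket_left \<psi> \<phi> = 1"
  using basis by (auto simp: bc_basis_left_def)

definition D_bc :: "real \<Rightarrow> (real \<Rightarrow> complex) set" where
  "D_bc \<theta> = {g \<in> D_max. complex_of_real (cos \<theta>) * bracket_left g \<phi> + complex_of_real (sin \<theta>) * bracket_left g \<psi> = 0}"

abbreviation T :: "real \<Rightarrow> real l2_graph" where "T \<equiv> T_bc a b p q r \<phi> \<psi>"

lemma T_eq: "T \<theta> = graph_on M (D_bc \<theta>) \<tau>"
  by (simp add: T_bc_def D_bc_def)

lemma D_bc_0_iff: "g \<in> D_bc 0 \<longleftrightarrow> g \<in> D_max \<and> bracket_left g \<phi> = 0"
  by (simp add: D_bc_def)

lemma D_max_zero: "(\<lambda>x. 0) \<in> D_max"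
  using D_max_diff_cmult(1)[OF basis_D_max(1) basis_D_max(1), of 1] by simp

lemma bracket_left_zero: "g \<in> D_max \<Longrightarrow> bracket_left (\<lambda>x. 0) g = 0"
  using bracket_left_diff_cmult[OF basis_D_max(1) basis_D_max(1), of g 1] by simp

lemma bracket_left_vanishing:
  "f \<in> D_max \<Longrightarrow> g \<in> D_max \<Longrightarrow> (\<And>x. x \<in> J \<Longrightarrow> f x = 0) \<Longrightarrow> bracket_left f g = 0"
  using bracket_left_cong[OF D_max_zero, of g f g] bracket_left_zero[of g] by simp

text \<open>Pluecker's relation, normalised by \<open>[\<psi>, \<phi>](a) = 1\<close>.\<close>

lemma bracket_left_decompose:
  "f \<in> D_max \<Longrightarrow> g \<in> D_max \<Longrightarrow> bracket_left f g =
    bracket_left f \<psi> * cnj (bracket_left g \<phi>) - bracket_left f \<phi> * cnj (bracket_left g \<psi>)"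
  using bracket_left_pluecker[OF _ _ basis_D_max, of f g] basis_real basis_bracket by simp

lemma L2_inner_cong_M:
  assumes "f \<in> L2 M" "f' \<in> L2 M" "g \<in> L2 M" "g' \<in> L2 M" "AE x in M. f x = f' x" "AE x in M. g x = g' x"
  shows "L2_inner M f g = L2_inner M f' g'"
  using assms by (intro L2_inner_cong_AE L2_measurable)

lemma graph_onI: "g \<in> D \<Longrightarrow> D \<subseteq> D_max \<Longrightarrow> (g, \<tau> g) \<in> graph_on M D \<tau>"
  using D_max_L2[of g] by (auto simp: graph_on_def)

text \<open>An element of the adjoint lies in the maximal domain by
  \<open>orthogonal_range_D_max\<close>, and Green's formula then makes its brackets at
  \<open>a\<close> with that whole domain vanish. Conversely, the two conditions annihilate all
  brackets at \<open>a\<close>, and Green's formula gives the adjoint relation.\<close>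

lemma T_min_iff:
  "(f, g) \<in> T_min a b p q r \<longleftrightarrow> f \<in> L2 M \<and> g \<in> L2 M \<and>
     (\<exists>F\<in>D_max. (AE x in M. f x = F x) \<and> (AE x in M. g x = \<tau> F x) \<and> bracket_left F \<phi> = 0 \<and> bracket_left F \<psi> = 0)"
  (is "?L \<longleftrightarrow> ?R")
proof
  assume ?L
  then have L: "f \<in> L2 M" "g \<in> L2 M" and adj: "\<And>u v. (u, v) \<in> T_max a b p q r \<Longrightarrow> L2_inner M f v = L2_inner M g u"
    unfolding T_min_def adjoint_op_def by auto
  have orth: "L2_inner M f (\<tau> u) = L2_inner M g u" if "u \<in> D_max" for u
    by (rule adj) (use that graph_onI[of u D_max] in \<open>simp add: T_max_def\<close>)
  \<comment> \<open>\<open>L2_inner\<close> conjugates its first argument, whereas the orthogonality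
    lemma is bilinear; it is therefore applied to the conjugates, and \<open>F\<close> is conjugated
    back.\<close>
  obtain F where F: "F \<in> D_max" "AE x in M. cnj (f x) = F x" "AE x in M. cnj (g x) = \<tau> F x"
    using orthogonal_range_D_max[OF L2_cnj[OF L(1)] L2_cnj[OF L(2)] orth[unfolded L2_inner_def]] .
  define G where "G x = cnj (F x)" for x
  have G: "G \<in> D_max" unfolding G_def by (rule D_max_cnj(1)[OF F(1)])
  have fG: "AE x in M. f x = G x" using F(2) unfolding G_def by eventually_elim (metis complex_cnj_cnj)
  have "AE x in M. \<tau> G x = cnj (\<tau> F x)" unfolding AE_M_iff G_def by (rule D_max_cnj(2)[OF F(1)])
  with F(3) have gG: "AE x in M. g x = \<tau> G x" by eventually_elim (metis complex_cnj_cnj)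
  have "bracket_left G h = 0" if h: "h \<in> D_max" for h
  proof -
    have "L2_inner M f (\<tau> h) = L2_inner M G (\<tau> h)" "L2_inner M g h = L2_inner M (\<tau> G) h"
      using L fG gG by (auto intro!: L2_inner_cong_M D_max_L2 G h)
    then have "bracket_left h G = 0" using Green_limit_point[OF limit_point h G] orth[OF h] by simp
    then show ?thesis using bracket_left_commute[OF h G] by simp
  qed
  then show ?R using L G fG gG basis_D_max by blast
next
  assume ?R
  then obtain F where L: "f \<in> L2 M" "g \<in> L2 M" and F: "F \<in> D_max" "AE x in M. f x = F x" "AE x in M. g x = \<tau> F x"
    and bc: "bracket_left F \<phi> = 0" "bracket_left F \<psi> = 0" by blast
  have "L2_inner M f v = L2_inner M g u" if uv: "(u, v) \<in> T_max a b p q r" for u v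
  proof -
    obtain h where uvL: "u \<in> L2 M" "v \<in> L2 M" and h: "h \<in> D_max" "AE x in M. u x = h x" "AE x in M. v x = \<tau> h x"
      using uv unfolding T_max_def graph_on_def by blast
    have "bracket_left h F = 0" using bracket_left_decompose[OF h(1) F(1)] bc by simp
    then have "L2_inner M F (\<tau> h) = L2_inner M (\<tau> F) h" using Green_limit_point[OF limit_point h(1) F(1)] by simp
    moreover have "L2_inner M f v = L2_inner M F (\<tau> h)" "L2_inner M g u = L2_inner M (\<tau> F) h"
      using L F uvL h by (auto intro!: L2_inner_cong_M D_max_L2)
    ultimately show ?thesis by simp
  qed
  then show ?L using L unfolding T_min_def adjoint_op_def by auto
qed

text \<open>On the common domain \<open>[F, \<phi>](a) = 0\<close>, so the condition for \<theta>
  reduces to \<open>sin \<theta> [F, \<psi>](a) = 0\<close>.\<close>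

lemma T_relatively_prime:
  assumes "sin \<theta> \<noteq> 0"
  shows "relatively_prime M (T_min a b p q r) (T 0) (T \<theta>)"
  unfolding relatively_prime_def
proof (intro set_eqI)
  fix fg :: "(real \<Rightarrow> complex) \<times> (real \<Rightarrow> complex)"
  obtain f g where fg: "fg = (f, g)" by (cases fg)
  show "fg \<in> max_common_part M (T 0) (T \<theta>) \<longleftrightarrow> fg \<in> T_min a b p q r"
  proof
    assume "fg \<in> max_common_part M (T 0) (T \<theta>)"
    then obtain g' where 0: "(f, g) \<in> T 0" and \<theta>: "(f, g') \<in> T \<theta>" unfolding fg max_common_part_def by blast
    obtain F where F: "F \<in> D_bc 0" "AE x in M. f x = F x" "AE x in M. g x = \<tau> F x" and L: "f \<in> L2 M" "g \<in> L2 M"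
      using 0 unfolding T_eq graph_on_def by blast
    obtain G where G: "G \<in> D_bc \<theta>" "AE x in M. f x = G x"
      using \<theta> unfolding T_eq graph_on_def by blast
    have D: "F \<in> D_max" "G \<in> D_max" using F G by (auto simp: D_bc_def)
    \<comment> \<open>\<open>F\<close> and \<open>G\<close> represent the same class but satisfy
      different boundary conditions. Continuity makes them equal on \<open>J\<close>, so a single
      function satisfies both.\<close>
    have "AE x in M. F x = G x" using F(2) G(2) by eventually_elim simp
    then have eq: "F x = G x" if "x \<in> J" for x using D_max_AE_eq[OF D _ that] by blast
    have F\<phi>: "bracket_left F \<phi> = 0" using F(1) by (simp add: D_bc_0_iff)
    have "bracket_left G \<phi> = bracket_left F \<phi>" "bracket_left G \<psi> = bracket_left F \<psi>"
      using bracket_left_cong[OF D(1) _ eq] basis_D_max by auto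
    then have "bracket_left F \<psi> = 0" using G(1) F\<phi> assms by (simp add: D_bc_def)
    then show "fg \<in> T_min a b p q r" unfolding fg T_min_iff using L D(1) F F\<phi> by blast
  next
    assume "fg \<in> T_min a b p q r"
    then obtain F where L: "f \<in> L2 M" "g \<in> L2 M" and F: "F \<in> D_max" "AE x in M. f x = F x" "AE x in M. g x = \<tau> F x"
      "bracket_left F \<phi> = 0" "bracket_left F \<psi> = 0" unfolding fg T_min_iff by blast
    then have "F \<in> D_bc 0" "F \<in> D_bc \<theta>" by (simp_all add: D_bc_def)
    then have "(f, g) \<in> T 0" "(f, g) \<in> T \<theta>" unfolding T_eq graph_on_def using L F by blast+
    then show "fg \<in> max_common_part M (T 0) (T \<theta>)" unfolding fg max_common_part_def by auto
  qed
qed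

section \<open>Resolvents and Weyl solutions\<close>

lemma resolvent_op_T_iff:
  "(f, u) \<in> resolvent_op M (T \<theta>) z \<longleftrightarrow> f \<in> L2 M \<and> u \<in> L2 M \<and>
     (\<exists>h\<in>D_bc \<theta>. (AE x in M. u x = h x) \<and> (AE x in M. f x = \<tau> h x - z * h x))" (is "?L \<longleftrightarrow> ?R")
proof
  assume ?L
  then obtain v where f: "f \<in> L2 M" and uv: "(u, v) \<in> T \<theta>" and ae: "AE x in M. f x = v x - z * u x"
    unfolding resolvent_op_def op_minus_scalar_def by auto
  obtain h where h: "h \<in> D_bc \<theta>" "AE x in M. u x = h x" "AE x in M. v x = \<tau> h x" and u: "u \<in> L2 M"
    using uv unfolding T_eq graph_on_def by blast
  have "AE x in M. f x = \<tau> h x - z * h x" using ae h(2,3) by eventually_elim simp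
  then show ?R using f u h by blast
next
  assume ?R
  then obtain h where L: "f \<in> L2 M" "u \<in> L2 M" and h: "h \<in> D_bc \<theta>" "AE x in M. u x = h x" "AE x in M. f x = \<tau> h x - z * h x"
    by blast
  have "h \<in> D_max" using h(1) by (simp add: D_bc_def)
  then have "(u, \<tau> h) \<in> T \<theta>" unfolding T_eq graph_on_def using L(2) h D_max_L2(2) by auto
  moreover have "AE x in M. f x = \<tau> h x - z * u x" using h(2,3) by eventually_elim simp
  ultimately show ?L unfolding resolvent_op_def op_minus_scalar_def using L(1) by auto
qed

lemma resolvent_set_surj:
  assumes z: "z \<in> resolvent_set M (T \<theta>)" and f: "f \<in> L2 M"
  obtains h where "h \<in> D_bc \<theta>" "AE x in M. f x = \<tau> h x - z * h x"
proof -
  have "f \<in> Domain (resolvent_op M (T \<theta>) z)" using z f by (simp add: resolvent_set_def bounded_operator_def)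
  then obtain u where "(f, u) \<in> resolvent_op M (T \<theta>) z" by blast
  then show thesis using that unfolding resolvent_op_T_iff by blast
qed

text \<open>Single-valuedness of the resolvent: \<open>h\<close> and 0 are both images of 0.\<close>

lemma resolvent_set_inj:
  assumes z: "z \<in> resolvent_set M (T \<theta>)" and h: "h \<in> D_bc \<theta>" "AE x in M. \<tau> h x = z * h x" and x: "x \<in> J"
  shows "h x = 0"
proof -
  have hD: "h \<in> D_max" using h(1) by (simp add: D_bc_def)
  have lin: "linear_operator M (resolvent_op M (T \<theta>) z)" using z by (simp add: resolvent_set_def bounded_operator_def)
  have "AE x in M. 0 = \<tau> h x - z * h x" using h(2) by eventually_elim simp
  then have "((\<lambda>_. 0), h) \<in> resolvent_op M (T \<theta>) z"
    unfolding resolvent_op_T_iff using L2_zero D_max_L2(1)[OF hD] h(1) by auto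
  moreover have "((\<lambda>_. 0), (\<lambda>_. 0)) \<in> resolvent_op M (T \<theta>) z" using lin by (simp add: linear_operator_def)
  moreover have "AE x in M. u x = v x"
    if "(f, u) \<in> resolvent_op M (T \<theta>) z" "(f, v) \<in> resolvent_op M (T \<theta>) z" for f u v
    using lin that unfolding linear_operator_def by blast
  ultimately have "AE x in M. h x = 0" by blast
  then show ?thesis using D_max_AE_eq[OF hD D_max_zero _ x] by simp
qed

definition is_weyl :: "complex \<Rightarrow> (real \<Rightarrow> complex) \<Rightarrow> bool" where
  "is_weyl z w \<longleftrightarrow> sl_solution a b p q r z w \<and> w \<in> L2 M \<and> bracket_left w \<phi> = 1 \<and> (\<forall>x. x \<notin> J \<longrightarrow> w x = 0)"

lemma weyl_solution_eq: "weyl_solution a b p q r \<phi> z = (THE w. is_weyl z w)"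
  by (simp add: weyl_solution_def is_weyl_def)

lemma is_weyl_iff:
  "is_weyl z w \<longleftrightarrow> w \<in> D_max \<and> (AE x in M. \<tau> w x = z * w x) \<and> bracket_left w \<phi> = 1 \<and> (\<forall>x. x \<notin> J \<longrightarrow> w x = 0)"
proof -
  have "w \<in> D_max" if "sl_solution a b p q r z w" "w \<in> L2 M"
  proof -
    have "AE x in lebesgue_on J. z * w x = \<tau> w x" using that(1) unfolding sl_solution_def by (auto elim: eventually_mono)
    then have "\<tau> w \<in> L2 M" using L2_cmult[OF that(2)] by (rule L2_cong_AE'[rotated])
    then show ?thesis using that by (simp add: dom_max_def sl_solution_def)
  qed
  then show ?thesis by (auto simp: is_weyl_def AE_M_iff sl_solution_def dom_max_def)
qed

text \<open>Subtracting from \<open>\<psi>\<close> the element of the domain of \<open>T 0\<close> on which \<open>\<tau> - z\<close> takes the same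
  value leaves a solution, without changing the bracket with \<open>\<phi>\<close>.\<close>

lemma is_weyl_exists:
  assumes z: "z \<in> resolvent_set M (T 0)"
  obtains w where "is_weyl z w"
proof -
  have "(\<lambda>x. \<tau> \<psi> x - z * \<psi> x) \<in> L2 M" by (intro L2_diff L2_cmult D_max_L2 basis_D_max)
  then obtain h where h: "h \<in> D_bc 0" "AE x in M. \<tau> \<psi> x - z * \<psi> x = \<tau> h x - z * h x"
    using resolvent_set_surj[OF z] by blast
  have hD: "h \<in> D_max" "bracket_left h \<phi> = 0" using h(1) by (simp_all add: D_bc_0_iff)
  define v where "v x = \<psi> x - 1 * h x" for x
  define w where "w x = (if x \<in> J then v x else 0)" for x
  have v: "v \<in> D_max" unfolding v_def by (rule D_max_diff_cmult(1)[OF basis_D_max(2) hD(1)])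
  have wv: "\<And>x. x \<in> J \<Longrightarrow> v x = w x" by (simp add: w_def)
  have "AE x in M. \<tau> v x = \<tau> \<psi> x - 1 * \<tau> h x"
    unfolding AE_M_iff v_def by (rule D_max_diff_cmult(2)[OF basis_D_max(2) hD(1)])
  moreover have "AE x in M. \<tau> w x = \<tau> v x" unfolding AE_M_iff by (rule D_max_cong(2)[OF v wv])
  moreover have "AE x in M. x \<in> J" unfolding AE_M_iff by (rule AE_I2) simp
  ultimately have "AE x in M. \<tau> w x = z * w x"
    using h(2)
  proof eventually_elim
    case (elim x)
    have "\<tau> \<psi> x - \<tau> h x = z * \<psi> x - z * h x" using elim(4) by (simp add: algebra_simps)
    then show ?case using elim(1-3) by (simp add: w_def v_def right_diff_distrib)
  qed
  moreover have "w \<in> D_max" by (rule D_max_cong(1)[OF v wv])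
  moreover have "bracket_left w \<phi> = bracket_left v \<phi>" by (rule bracket_left_cong[OF v basis_D_max(1) wv refl])
  then have "bracket_left w \<phi> = 1"
    using bracket_left_diff_cmult[OF basis_D_max(2) hD(1) basis_D_max(1), of 1] hD(2) basis_bracket by (simp add: v_def[abs_def])
  moreover have "\<forall>x. x \<notin> J \<longrightarrow> w x = 0" by (simp add: w_def)
  ultimately show thesis using that is_weyl_iff by blast
qed

text \<open>\<open>d - [d, \<phi>](a) w\<close> solves the equation at \<open>z\<close> and
  satisfies the boundary condition of \<open>T 0\<close>, hence vanishes.\<close>

lemma eigenfunction_multiple:
  assumes z: "z \<in> resolvent_set M (T 0)" and w: "is_weyl z w" and d: "d \<in> D_max" "AE x in M. \<tau> d x = z * d x" and x: "x \<in> J"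
  shows "d x = bracket_left d \<phi> * w x"
proof -
  let ?c = "bracket_left d \<phi>"
  have w': "w \<in> D_max" "AE x in M. \<tau> w x = z * w x" "bracket_left w \<phi> = 1" using w by (auto simp: is_weyl_iff)
  have "AE x in M. \<tau> (\<lambda>x. d x - ?c * w x) x = \<tau> d x - ?c * \<tau> w x"
    unfolding AE_M_iff by (rule D_max_diff_cmult(2)[OF d(1) w'(1)])
  then have "AE x in M. \<tau> (\<lambda>x. d x - ?c * w x) x = z * (d x - ?c * w x)"
    using d(2) w'(2) by eventually_elim (simp add: algebra_simps)
  moreover have "(\<lambda>x. d x - ?c * w x) \<in> D_bc 0"
    unfolding D_bc_0_iff using D_max_diff_cmult(1)[OF d(1) w'(1)] bracket_left_diff_cmult[OF d(1) w'(1) basis_D_max(1)] w'(3) by simp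
  ultimately show ?thesis using resolvent_set_inj[OF z _ _ x] by fastforce
qed

lemma is_weyl_unique:
  assumes z: "z \<in> resolvent_set M (T 0)" and w: "is_weyl z w" "is_weyl z w'"
  shows "w' = w"
proof
  fix x show "w' x = w x"
    using eigenfunction_multiple[OF z w(1), of w' x] w by (cases "x \<in> J") (auto simp: is_weyl_iff)
qed

lemma is_weyl_cnj:
  assumes w: "is_weyl z w" shows "is_weyl (cnj z) (\<lambda>x. cnj (w x))"
proof -
  have w': "w \<in> D_max" "AE x in M. \<tau> w x = z * w x" "bracket_left w \<phi> = 1" using w by (auto simp: is_weyl_iff)
  have c: "(\<lambda>x. cnj (w x)) \<in> D_max" by (rule D_max_cnj(1)[OF w'(1)])
  have "AE x in M. \<tau> (\<lambda>x. cnj (w x)) x = cnj (\<tau> w x)" unfolding AE_M_iff by (rule D_max_cnj(2)[OF w'(1)])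
  then have "AE x in M. \<tau> (\<lambda>x. cnj (w x)) x = cnj z * cnj (w x)" using w'(2) by eventually_elim simp
  moreover have "bracket_left (\<lambda>x. cnj (w x)) \<phi> = bracket_left (\<lambda>x. cnj (w x)) (\<lambda>x. cnj (\<phi> x))"
    by (rule bracket_left_cong[symmetric, OF c basis_D_max(1) refl]) (use basis_real(1) in \<open>simp add: Reals_cnj_iff\<close>)
  then have "bracket_left (\<lambda>x. cnj (w x)) \<phi> = 1" using bracket_left_cnj[OF w'(1) basis_D_max(1)] w'(3) by simp
  ultimately show ?thesis using c w by (simp add: is_weyl_iff)
qed

text \<open>Each definite description demands existence and uniqueness. At \<open>z\<close> these
  come from the resolvent set; at \<open>cnj z\<close> both are transported by conjugation.\<close>

lemma weyl_solution_is_weyl: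
  assumes z: "z \<in> resolvent_set M (T 0)"
  shows "is_weyl z (weyl_solution a b p q r \<phi> z)" "is_weyl (cnj z) (weyl_solution a b p q r \<phi> (cnj z))"
proof -
  obtain w where w: "is_weyl z w" by (rule is_weyl_exists[OF z])
  show "is_weyl z (weyl_solution a b p q r \<phi> z)"
    unfolding weyl_solution_eq
  proof (rule theI[where P = "is_weyl z" and a = w])
    show "w' = w" if "is_weyl z w'" for w' by (rule is_weyl_unique[OF z w that])
  qed (rule w)
  show "is_weyl (cnj z) (weyl_solution a b p q r \<phi> (cnj z))"
    unfolding weyl_solution_eq
  proof (rule theI[where P = "is_weyl (cnj z)" and a = "\<lambda>x. cnj (w x)"])
    show "is_weyl (cnj z) (\<lambda>x. cnj (w x))" by (rule is_weyl_cnj[OF w])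
    fix w' assume "is_weyl (cnj z) w'"
    then have "(\<lambda>x. cnj (w' x)) = w" using is_weyl_cnj[of "cnj z" w'] by (intro is_weyl_unique[OF z w]) simp
    then have "cnj (w' x) = w x" for x by (rule fun_cong)
    then have "w' x = cnj (w x)" for x using complex_cnj_cnj[of "w' x"] by simp
    then show "w' = (\<lambda>x. cnj (w x))" by (rule ext)
  qed
qed

text \<open>With \<open>c = [h - h0, \<phi>](a)\<close>, both sides are \<open>c k w x\<close>,
  where \<open>k\<close> is the denominator: the left one because \<open>h - h0 = c w\<close>, the
  right one by the boundary condition of \<open>h\<close> and Green's formula for \<open>h0\<close>
  and \<open>w'\<close>. Keeping the denominator as a factor separates the identity from the proof
  that it is nonzero.\<close>

lemma resolvent_difference_kernel:
  assumes z: "z \<in> resolvent_set M (T 0)" and \<theta>: "sin \<theta> \<noteq> 0"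
    and w: "is_weyl z w" and w': "is_weyl (cnj z) w'" and f: "f \<in> L2 M"
    and h: "h \<in> D_bc \<theta>" "AE x in M. f x = \<tau> h x - z * h x"
    and h0: "h0 \<in> D_bc 0" "AE x in M. f x = \<tau> h0 x - z * h0 x"
    and x: "x \<in> J"
  shows "(complex_of_real (cot \<theta>) + bracket_left w \<psi>) * (h x - h0 x) = L2_inner M w' f * w x"
proof -
  have wD: "w \<in> D_max" "bracket_left w \<phi> = 1" using w by (auto simp: is_weyl_iff)
  have w'D: "w' \<in> D_max" "AE x in M. \<tau> w' x = cnj z * w' x" "bracket_left w' \<phi> = 1" using w' by (auto simp: is_weyl_iff)
  have hD: "h \<in> D_max" and bc: "complex_of_real (cos \<theta>) * bracket_left h \<phi> + complex_of_real (sin \<theta>) * bracket_left h \<psi> = 0"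
    using h(1) by (auto simp: D_bc_def)
  have h0D: "h0 \<in> D_max" "bracket_left h0 \<phi> = 0" using h0(1) by (auto simp: D_bc_0_iff)
  define d where "d x = h x - 1 * h0 x" for x
  have d: "d \<in> D_max" unfolding d_def by (rule D_max_diff_cmult(1)[OF hD h0D(1)])
  have "AE x in M. \<tau> d x = \<tau> h x - 1 * \<tau> h0 x" unfolding AE_M_iff d_def by (rule D_max_diff_cmult(2)[OF hD h0D(1)])
  then have dz: "AE x in M. \<tau> d x = z * d x"
    using h(2) h0(2)
  proof eventually_elim
    case (elim x)
    have "\<tau> h x - \<tau> h0 x = z * h x - z * h0 x" using elim(2,3) by (simp add: algebra_simps)
    then show ?case using elim(1) by (simp add: d_def right_diff_distrib)
  qed
  define c where "c = bracket_left d \<phi>"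
  have dc: "d x = c * w x" if "x \<in> J" for x unfolding c_def by (rule eigenfunction_multiple[OF z w d dz that])
  have brd: "bracket_left d g = bracket_left h g - bracket_left h0 g" if "g \<in> D_max" for g
    using bracket_left_diff_cmult[OF hD h0D(1) that, of 1] by (simp add: d_def[abs_def])
  have h\<phi>: "bracket_left h \<phi> = c" using brd[OF basis_D_max(1)] h0D(2) by (simp add: c_def)
  have "bracket_left (\<lambda>x. d x - c * w x) \<psi> = 0"
    by (rule bracket_left_vanishing[OF D_max_diff_cmult(1)[OF d wD(1)] basis_D_max(2)]) (simp add: dc)
  then have "bracket_left d \<psi> = c * bracket_left w \<psi>" using bracket_left_diff_cmult[OF d wD(1) basis_D_max(2), of c] by simp
  then have h\<psi>: "bracket_left h \<psi> = bracket_left h0 \<psi> + c * bracket_left w \<psi>" using brd[OF basis_D_max(2)] by (simp add: algebra_simps)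
  \<comment> \<open>Dividing the boundary condition of \<open>h\<close> by
    \<open>sin \<theta>\<close> produces the cotangent; with \<open>[h, \<phi>](a) = c\<close> it
    isolates \<open>[h0, \<psi>](a)\<close>.\<close>
  have ck: "c * (complex_of_real (cot \<theta>) + bracket_left w \<psi>) = - bracket_left h0 \<psi>"
  proof -
    have "complex_of_real (sin \<theta>) * (c * (complex_of_real (cot \<theta>) + bracket_left w \<psi>) + bracket_left h0 \<psi>) =
        complex_of_real (cos \<theta>) * bracket_left h \<phi> + complex_of_real (sin \<theta>) * bracket_left h \<psi>"
      unfolding h\<phi> h\<psi> cot_def using \<theta> by (simp add: algebra_simps)
    then have "c * (complex_of_real (cot \<theta>) + bracket_left w \<psi>) + bracket_left h0 \<psi> = 0" using bc \<theta> by simp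
    then show ?thesis by (simp add: eq_neg_iff_add_eq_0)
  qed
  have w'L: "w' \<in> L2 M" by (rule D_max_L2(1)[OF w'D(1)])
  have hL: "h0 \<in> L2 M" "\<tau> h0 \<in> L2 M" by (rule D_max_L2[OF h0D(1)])+
  have "L2_inner M w' f = L2_inner M w' (\<lambda>x. \<tau> h0 x - z * h0 x)"
    by (rule L2_inner_cong_M[OF w'L w'L f _ _ h0(2)]) (intro L2_diff L2_cmult hL, simp)
  also have "\<dots> = L2_inner M w' (\<tau> h0) - z * L2_inner M w' h0"
    by (simp only: L2_inner_diff_right[OF w'L hL(2) L2_cmult[OF hL(1)]] L2_inner_cmult_right)
  \<comment> \<open>The first argument is conjugate linear, so \<open>z\<close> enters as
    \<open>cnj z\<close>, the spectral parameter of \<open>w'\<close>.\<close>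
  also have "z * L2_inner M w' h0 = L2_inner M (\<lambda>x. cnj z * w' x) h0" by (simp add: L2_inner_cmult_left)
  also have "\<dots> = L2_inner M (\<tau> w') h0"
    by (rule L2_inner_cong_M[OF L2_cmult[OF w'L] D_max_L2(2)[OF w'D(1)] hL(1) hL(1)])
      (use w'D(2) in \<open>auto elim: eventually_mono\<close>)
  also have "L2_inner M w' (\<tau> h0) - L2_inner M (\<tau> w') h0 = - bracket_left h0 w'" by (rule Green_limit_point[OF limit_point h0D(1) w'D(1)])
  also have "bracket_left h0 w' = bracket_left h0 \<psi>" using bracket_left_decompose[OF h0D(1) w'D(1)] h0D(2) w'D(3) by simp
  finally have "L2_inner M w' f = c * (complex_of_real (cot \<theta>) + bracket_left w \<psi>)" using ck by simp
  moreover have "h x - h0 x = c * w x" using dc[OF x] by (simp add: d_def)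
  ultimately show ?thesis by (simp only: mult_ac)
qed

lemma weyl_denominator_nonzero:
  assumes z: "z \<in> resolvent_set M (T \<theta>)" and \<theta>: "sin \<theta> \<noteq> 0" and w: "is_weyl z w"
  shows "complex_of_real (cot \<theta>) + bracket_left w \<psi> \<noteq> 0"
proof
  assume 0: "complex_of_real (cot \<theta>) + bracket_left w \<psi> = 0"
  have wD: "w \<in> D_max" "AE x in M. \<tau> w x = z * w x" "bracket_left w \<phi> = 1" using w by (auto simp: is_weyl_iff)
  \<comment> \<open>As \<open>[w, \<phi>](a) = 1\<close>, the boundary form of
    \<open>T \<theta>\<close> on \<open>w\<close> is \<open>sin \<theta>\<close> times the
    denominator.\<close>
  have "complex_of_real (cos \<theta>) * bracket_left w \<phi> + complex_of_real (sin \<theta>) * bracket_left w \<psi> =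
      complex_of_real (sin \<theta>) * (complex_of_real (cot \<theta>) + bracket_left w \<psi>)"
    unfolding wD(3) cot_def using \<theta> by (simp add: algebra_simps)
  then have "w \<in> D_bc \<theta>" using wD(1) 0 by (simp add: D_bc_def)
  then have "w x = 0" if "x \<in> J" for x using resolvent_set_inj[OF z _ wD(2) that] by blast
  then have "bracket_left w \<phi> = 0" by (rule bracket_left_vanishing[OF wD(1) basis_D_max(1)])
  then show False using wD(3) by simp
qed

lemma resolvent_difference:
  assumes z: "z \<in> resolvent_set M (T 0)" "z \<in> resolvent_set M (T \<theta>)" and \<theta>: "sin \<theta> \<noteq> 0"
    and w: "is_weyl z w" and w': "is_weyl (cnj z) w'"
  shows "op_diff M (resolvent_op M (T \<theta>) z) (resolvent_op M (T 0) z) =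
    rank_one_op M (inverse (complex_of_real (cot \<theta>) + bracket_left w \<psi>)) w' w"
proof (intro set_eqI)
  let ?k = "complex_of_real (cot \<theta>) + bracket_left w \<psi>"
  have k: "?k \<noteq> 0" by (rule weyl_denominator_nonzero[OF z(2) \<theta> w])
  have J: "AE x in M. x \<in> J" unfolding AE_M_iff by (rule AE_I2) simp
  have key: "AE x in M. h x - h0 x = inverse ?k * L2_inner M w' f * w x"
    if "f \<in> L2 M" "h \<in> D_bc \<theta>" "AE x in M. f x = \<tau> h x - z * h x" "h0 \<in> D_bc 0" "AE x in M. f x = \<tau> h0 x - z * h0 x" for f h h0
    using J
  proof eventually_elim
    case (elim x)
    show ?case using resolvent_difference_kernel[OF z(1) \<theta> w w' that elim] k by (simp add: field_simps)
  qed
  fix fg :: "(real \<Rightarrow> complex) \<times> (real \<Rightarrow> complex)"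
  obtain f g where fg: "fg = (f, g)" by (cases fg)
  show "fg \<in> op_diff M (resolvent_op M (T \<theta>) z) (resolvent_op M (T 0) z) \<longleftrightarrow> fg \<in> rank_one_op M (inverse ?k) w' w"
  proof
    assume "fg \<in> op_diff M (resolvent_op M (T \<theta>) z) (resolvent_op M (T 0) z)"
    then obtain u v where g: "g \<in> L2 M" and uv: "(f, u) \<in> resolvent_op M (T \<theta>) z" "(f, v) \<in> resolvent_op M (T 0) z"
      and ae: "AE x in M. g x = u x - v x" unfolding op_diff_def fg by blast
    obtain h where f: "f \<in> L2 M" and h: "h \<in> D_bc \<theta>" "AE x in M. u x = h x" "AE x in M. f x = \<tau> h x - z * h x"
      using uv(1) unfolding resolvent_op_T_iff by blast
    obtain h0 where h0: "h0 \<in> D_bc 0" "AE x in M. v x = h0 x" "AE x in M. f x = \<tau> h0 x - z * h0 x"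
      using uv(2) unfolding resolvent_op_T_iff by blast
    have "AE x in M. g x = inverse ?k * L2_inner M w' f * w x"
      using ae h(2) h0(2) key[OF f h(1,3) h0(1,3)] by eventually_elim simp
    then show "fg \<in> rank_one_op M (inverse ?k) w' w" using f g by (simp add: fg rank_one_op_iff)
  next
    assume "fg \<in> rank_one_op M (inverse ?k) w' w"
    then have f: "f \<in> L2 M" and g: "g \<in> L2 M" and ae: "AE x in M. g x = inverse ?k * L2_inner M w' f * w x"
      by (auto simp: fg rank_one_op_iff)
    \<comment> \<open>An element of the rank one graph only names \<open>f\<close> and
      \<open>g\<close>; the preimages \<open>h\<close> and \<open>h0\<close> exist because both
      resolvents are defined on all of \<open>L2 M\<close>.\<close>
    obtain h where h: "h \<in> D_bc \<theta>" "AE x in M. f x = \<tau> h x - z * h x" using resolvent_set_surj[OF z(2) f] .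
    obtain h0 where h0: "h0 \<in> D_bc 0" "AE x in M. f x = \<tau> h0 x - z * h0 x" using resolvent_set_surj[OF z(1) f] .
    have "h \<in> L2 M" "h0 \<in> L2 M" using h(1) h0(1) D_max_L2(1) by (auto simp: D_bc_def)
    then have "(f, h) \<in> resolvent_op M (T \<theta>) z" "(f, h0) \<in> resolvent_op M (T 0) z"
      unfolding resolvent_op_T_iff using f h h0 by auto
    moreover have "AE x in M. g x = h x - h0 x" using ae key[OF f h h0] by eventually_elim simp
    ultimately show "fg \<in> op_diff M (resolvent_op M (T \<theta>) z) (resolvent_op M (T 0) z)"
      unfolding op_diff_def fg using g by blast
  qed
qed

end

theorem theorem3p4:
  fixes a b :: ereal and p q r :: "real \<Rightarrow> real"
    and \<phi> \<psi> :: "real \<Rightarrow> complex" and \<theta> :: real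
    and M :: "real measure" and T :: "real \<Rightarrow> real l2_graph"
    and w :: "complex \<Rightarrow> real \<Rightarrow> complex" and k :: "complex \<Rightarrow> complex"
  assumes coefficients: "sl_coefficients a b p q r"
    and limit_circle_at_a: "limit_circle_left a b p q r"
    and basis_at_a: "bc_basis_left a b p q r \<phi> \<psi>"
    and limit_point_at_b: "limit_point_right a b p q r"
    and theta: "0 < \<theta>" "\<theta> < pi"
    and M: "M = weighted a b r"
    and T: "T = T_bc a b p q r \<phi> \<psi>"
    and w: "w = weyl_solution a b p q r \<phi>"
    and k: "k = (\<lambda>z. complex_of_real (cot \<theta>) + lagrange_bracket_left a b p (w z) \<psi>)"
  shows "relatively_prime M (T_min a b p q r) (T 0) (T \<theta>) \<and>
    (\<forall>z \<in> resolvent_set M (T 0) \<inter> resolvent_set M (T \<theta>).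
       k z \<noteq> 0 \<and>
       op_diff M (resolvent_op M (T \<theta>) z) (resolvent_op M (T 0) z)
         = rank_one_op M (inverse (k z)) (w (cnj z)) (w z) \<and>
       trace_class M (op_diff M (resolvent_op M (T \<theta>) z) (resolvent_op M (T 0) z)) \<and>
       op_trace M (op_diff M (resolvent_op M (T \<theta>) z) (resolvent_op M (T 0) z))
         = L2_inner M (w (cnj z)) (w z) / k z)"
proof -
  interpret limit_point_problem a b p q r \<phi> \<psi>
    by unfold_locales (fact coefficients basis_at_a limit_point_at_b)+
  have s: "sin \<theta> \<noteq> 0" using sin_gt_zero[OF theta] by simp
  show ?thesis
    unfolding M T w k
  proof (intro conjI ballI)
    show "relatively_prime (weighted a b r) (T_min a b p q r) (T_bc a b p q r \<phi> \<psi> 0) (T_bc a b p q r \<phi> \<psi> \<theta>)"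
      by (rule T_relatively_prime[OF s])
    fix z
    assume "z \<in> resolvent_set (weighted a b r) (T_bc a b p q r \<phi> \<psi> 0) \<inter> resolvent_set (weighted a b r) (T_bc a b p q r \<phi> \<psi> \<theta>)"
    then have z: "z \<in> resolvent_set (weighted a b r) (T_bc a b p q r \<phi> \<psi> 0)" "z \<in> resolvent_set (weighted a b r) (T_bc a b p q r \<phi> \<psi> \<theta>)"
      by auto
    note weyl = weyl_solution_is_weyl[OF z(1)]
    have L: "weyl_solution a b p q r \<phi> z \<in> L2 (weighted a b r)" "weyl_solution a b p q r \<phi> (cnj z) \<in> L2 (weighted a b r)"
      using weyl by (simp_all add: is_weyl_def)
    note diff = resolvent_difference[OF z s weyl]
    show "complex_of_real (cot \<theta>) + lagrange_bracket_left a b p (weyl_solution a b p q r \<phi> z) \<psi> \<noteq> 0"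
      by (rule weyl_denominator_nonzero[OF z(2) s weyl(1)])
    show "op_diff (weighted a b r) (resolvent_op (weighted a b r) (T_bc a b p q r \<phi> \<psi> \<theta>) z) (resolvent_op (weighted a b r) (T_bc a b p q r \<phi> \<psi> 0) z) =
        rank_one_op (weighted a b r) (inverse (complex_of_real (cot \<theta>) + lagrange_bracket_left a b p (weyl_solution a b p q r \<phi> z) \<psi>))
          (weyl_solution a b p q r \<phi> (cnj z)) (weyl_solution a b p q r \<phi> z)"
      by (rule diff)
    show "trace_class (weighted a b r) (op_diff (weighted a b r) (resolvent_op (weighted a b r) (T_bc a b p q r \<phi> \<psi> \<theta>) z)
        (resolvent_op (weighted a b r) (T_bc a b p q r \<phi> \<psi> 0) z))"
      unfolding diff by (rule rank_one_op_trace_class[OF L(2,1)])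
    show "op_trace (weighted a b r) (op_diff (weighted a b r) (resolvent_op (weighted a b r) (T_bc a b p q r \<phi> \<psi> \<theta>) z)
        (resolvent_op (weighted a b r) (T_bc a b p q r \<phi> \<psi> 0) z)) =
      L2_inner (weighted a b r) (weyl_solution a b p q r \<phi> (cnj z)) (weyl_solution a b p q r \<phi> z) /
        (complex_of_real (cot \<theta>) + lagrange_bracket_left a b p (weyl_solution a b p q r \<phi> z) \<psi>)"
      unfolding diff rank_one_op_trace[OF L(2,1)] by (simp add: field_simps)
  qed
qed

thm_deps theorem3p4

end
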